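(* Let $K$ be a field and let $\mathcal{C}$ be a uniform admissible unmixed clutter with $\operatorname{ht} I(\mathcal{C}) = 2$. Then the Alexander dual $I(\mathcal{C})^\vee$ of $I(\mathcal{C})$ has linear quotients, and so $\mathcal{C}$ is a Cohen-Macaulay clutter.
   Context: A clutter $\mathcal{C}$ consists of a finite vertex set $V(\mathcal{C})=\{x_1,\dots,x_n\}$ and a family $E(\mathcal{C})$ of nonempty subsets of $V(\mathcal{C})$ (edges), none of which properly contains another. It is uniform if all edges have the same cardinality. Let $K$ be a field, identify the vertices with the variables of $R=K[x_1,\dots,x_n]$, and let $I(\mathcal{C})=\langle \prod_{x_i\in e}x_i \mid e\in E(\mathcal{C})\rangle\subset R$ be the edge ideal. $\mathcal{C}$ is Cohen-Macaulay if $R/I(\mathcal{C})$ is a Cohen-Macaulay ring. A vertex cover is a subset $C\subseteq V(\mathcal{C})$ meeting every edge; it is minimal if no proper subset is a vertex cover. $\operatorname{ht} I(\mathcal{C})$ equals the smallest cardinality of a minimal vertex cover. $\mathcal{C}$ is unmixed if all its minimal vertex covers have the same cardinality. The Alexander dual of $I(\mathcal{C})$ is $I(\mathcal{C})^\vee=\langle \prod_{x_i\in C}x_i \mid C \text{ a minimal vertex cover of }\mathcal{C}\rangle$. Admissible: let $g=\operatorname{ht} I(\mathcal{C})$. Suppose that for some positive integer $d$ there are two partitions $\{X^1,\dots,X^d\}$ and $\{e_1,\dots,e_g\}$ of $V(\mathcal{C})$ with $|e_i\cap X^j|\le 1$ for all $i,j$. A subset $e\subseteq V(\mathcal{C})$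 of size $k$ with $|e\cap X^i|\le 1$ for all $i$ is admissible if $e$ meets exactly the classes $X^1,\dots,X^k$ and, writing $j_l$ for the index such that the vertex of $e\cap X^l$ lies in $e_{j_l}$, one has $j_1\le j_2\le\cdots\le j_k$. The clutter $\mathcal{C}$ is admissible if (for some such partitions) $e_1,\dots,e_g\in E(\mathcal{C})$ and all edges of $\mathcal{C}$ are admissible. Linear quotients: a monomial ideal $I$ has linear quotients if it has a system of minimal generators $\{u_1,\dots,u_r\}$, ordered with $\deg u_1\le\cdots\le\deg u_r$, such that for all $1\le i\le r-1$ the colon ideal $((u_1,\dots,u_i):u_{i+1})$ is generated by linear forms. *)

theory Defs
  imports
    Complex_Main
    "HOL-Algebra.Ring_Divisibility"
    "HOL-Algebra.QuotRing"
    "HOL-Library.Poly_Mapping"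
    "HOL-Library.Extended_Nat"
    "HOL-Library.Disjoint_Sets"
begin

section \<open>Height, depth and Cohen--Macaulay rings\<close>

definition prime_chain :: "('a, 'b) ring_scheme \<Rightarrow> 'a set \<Rightarrow> nat \<Rightarrow> (nat \<Rightarrow> 'a set) \<Rightarrow> bool" where
  "prime_chain A P n Q \<longleftrightarrow>
     (\<forall>i\<le>n. primeideal (Q i) A) \<and> (\<forall>i<n. Q i \<subset> Q (Suc i)) \<and> Q n = P"

definition prime_height :: "('a, 'b) ring_scheme \<Rightarrow> 'a set \<Rightarrow> enat" where
  "prime_height A P = Sup {enat n | n. \<exists>Q. prime_chain A P n Q}"

definition ideal_height :: "('a, 'b) ring_scheme \<Rightarrow> 'a set \<Rightarrow> enat" where
  "ideal_height A I = Inf {prime_height A P | P. primeideal P A \<and> I \<subseteq> P}"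

definition regular_sequence :: "('a, 'b) ring_scheme \<Rightarrow> 'a list \<Rightarrow> bool" where
  "regular_sequence A xs \<longleftrightarrow>
     set xs \<subseteq> carrier A \<and>
     (\<forall>i<length xs. \<forall>a\<in>carrier A.
        xs ! i \<otimes>\<^bsub>A\<^esub> a \<in> Idl\<^bsub>A\<^esub> (set (take i xs)) \<longrightarrow> a \<in> Idl\<^bsub>A\<^esub> (set (take i xs))) \<and>
     Idl\<^bsub>A\<^esub> (set xs) \<noteq> carrier A"

definition ideal_depth :: "('a, 'b) ring_scheme \<Rightarrow> 'a set \<Rightarrow> enat" where
  "ideal_depth A I = Sup {enat (length xs) | xs. regular_sequence A xs \<and> set xs \<subseteq> I}"

text \<open>The definition of a Cohen--Macaulay ring for not necessarily local rings, as in Eisenbud,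
  Commutative Algebra, Section 18.2: depth equals height at every maximal ideal.\<close>

definition cohen_macaulay_ring :: "('a, 'b) ring_scheme \<Rightarrow> bool" where
  "cohen_macaulay_ring A \<longleftrightarrow>
     cring A \<and> noetherian_ring A \<and>
     (\<forall>M. maximalideal M A \<longrightarrow> ideal_depth A M = prime_height A M)"


section \<open>Polynomial rings and linear quotients\<close>

text \<open>The polynomial ring over the field \<open>'k\<close> in the variables \<open>V\<close>. A polynomial maps exponent
  vectors \<open>'v \<Rightarrow>\<^sub>0 nat\<close> to coefficients. The argument \<open>K\<close> only carries the type \<open>'k\<close>.\<close>

definition mpoly_ring :: "'k::field itself \<Rightarrow> 'v set \<Rightarrow> (('v \<Rightarrow>\<^sub>0 nat) \<Rightarrow>\<^sub>0 'k) ring" where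
  "mpoly_ring K V =
     \<lparr>carrier = {p. \<forall>m\<in>Poly_Mapping.keys p. Poly_Mapping.keys m \<subseteq> V},
      monoid.mult = (*), one = 1, zero = 0, add = (+)\<rparr>"

definition mpoly_var :: "'v \<Rightarrow> (('v \<Rightarrow>\<^sub>0 nat) \<Rightarrow>\<^sub>0 'k::field)" where
  "mpoly_var v = Poly_Mapping.single (Poly_Mapping.single v 1) 1"

definition mpoly_monomial :: "('v \<Rightarrow>\<^sub>0 nat) \<Rightarrow> (('v \<Rightarrow>\<^sub>0 nat) \<Rightarrow>\<^sub>0 'k::field)" where
  "mpoly_monomial m = Poly_Mapping.single m 1"

definition exponent_degree :: "('v \<Rightarrow>\<^sub>0 nat) \<Rightarrow> nat" where
  "exponent_degree m = (\<Sum>v\<in>Poly_Mapping.keys m. Poly_Mapping.lookup m v)"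

definition linear_form :: "(('v \<Rightarrow>\<^sub>0 nat) \<Rightarrow>\<^sub>0 'k::field) \<Rightarrow> bool" where
  "linear_form f \<longleftrightarrow> (\<forall>m\<in>Poly_Mapping.keys f. exponent_degree m = 1)"

definition colon_ideal :: "('a, 'b) ring_scheme \<Rightarrow> 'a set \<Rightarrow> 'a \<Rightarrow> 'a set" where
  "colon_ideal A I u = {f \<in> carrier A. f \<otimes>\<^bsub>A\<^esub> u \<in> I}"

definition minimal_generating_set :: "('a, 'b) ring_scheme \<Rightarrow> 'a set \<Rightarrow> 'a set \<Rightarrow> bool" where
  "minimal_generating_set A I S \<longleftrightarrow>
     S \<subseteq> carrier A \<and> Idl\<^bsub>A\<^esub> S = I \<and> (\<forall>T. T \<subset> S \<longrightarrow> Idl\<^bsub>A\<^esub> T \<noteq> I)"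

text \<open>The minimal generators of a monomial ideal are taken to be monomials, given here by the list
  \<open>ms\<close> of their exponent vectors. The list is indexed from 0, so that \<open>us ! i\<close> is
  $u_{i+1}$ and \<open>take i us\<close> is $u_1,\dots,u_i$.\<close>

definition linear_quotients ::
    "'k::field itself \<Rightarrow> 'v set \<Rightarrow> (('v \<Rightarrow>\<^sub>0 nat) \<Rightarrow>\<^sub>0 'k) set \<Rightarrow> bool" where
  "linear_quotients K V I \<longleftrightarrow>
     (\<exists>ms. let us = map mpoly_monomial ms in
        distinct ms \<and>
        minimal_generating_set (mpoly_ring K V) I (set us) \<and>
        sorted (map exponent_degree ms) \<and>
        (\<forall>i. 1 \<le> i \<and> i < length us \<longrightarrow>
           (\<exists>L \<subseteq> carrier (mpoly_ring K V). (\<forall>f\<in>L. linear_form f) \<and>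
              colon_ideal (mpoly_ring K V) (Idl\<^bsub>mpoly_ring K V\<^esub> (set (take i us))) (us ! i)
                = Idl\<^bsub>mpoly_ring K V\<^esub> L)))"


section \<open>Clutters\<close>

definition clutter :: "'v set \<Rightarrow> 'v set set \<Rightarrow> bool" where
  "clutter V E \<longleftrightarrow>
     finite V \<and> (\<forall>e\<in>E. e \<noteq> {} \<and> e \<subseteq> V) \<and> (\<forall>e\<in>E. \<forall>f\<in>E. \<not> e \<subset> f)"

definition uniform_clutter :: "'v set set \<Rightarrow> bool" where
  "uniform_clutter E \<longleftrightarrow> (\<forall>e\<in>E. \<forall>f\<in>E. card e = card f)"

definition vertex_cover :: "'v set \<Rightarrow> 'v set set \<Rightarrow> 'v set \<Rightarrow> bool" where
  "vertex_cover V E C \<longleftrightarrow> C \<subseteq> V \<and> (\<forall>e\<in>E. C \<inter> e \<noteq> {})"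

definition minimal_vertex_cover :: "'v set \<Rightarrow> 'v set set \<Rightarrow> 'v set \<Rightarrow> bool" where
  "minimal_vertex_cover V E C \<longleftrightarrow>
     vertex_cover V E C \<and> (\<forall>D. D \<subset> C \<longrightarrow> \<not> vertex_cover V E D)"

definition unmixed_clutter :: "'v set \<Rightarrow> 'v set set \<Rightarrow> bool" where
  "unmixed_clutter V E \<longleftrightarrow>
     (\<forall>C D. minimal_vertex_cover V E C \<and> minimal_vertex_cover V E D \<longrightarrow> card C = card D)"

definition edge_ideal ::
    "'k::field itself \<Rightarrow> 'v set \<Rightarrow> 'v set set \<Rightarrow> (('v \<Rightarrow>\<^sub>0 nat) \<Rightarrow>\<^sub>0 'k) set" where
  "edge_ideal K V E = Idl\<^bsub>mpoly_ring K V\<^esub> {\<Prod>v\<in>e. mpoly_var v | e. e \<in> E}"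

definition alexander_dual ::
    "'k::field itself \<Rightarrow> 'v set \<Rightarrow> 'v set set \<Rightarrow> (('v \<Rightarrow>\<^sub>0 nat) \<Rightarrow>\<^sub>0 'k) set" where
  "alexander_dual K V E =
     Idl\<^bsub>mpoly_ring K V\<^esub> {\<Prod>v\<in>C. mpoly_var v | C. minimal_vertex_cover V E C}"

definition cohen_macaulay_clutter :: "'k::field itself \<Rightarrow> 'v set \<Rightarrow> 'v set set \<Rightarrow> bool" where
  "cohen_macaulay_clutter K V E \<longleftrightarrow>
     cohen_macaulay_ring (mpoly_ring K V Quot edge_ideal K V E)"

definition indexed_partition :: "'v set \<Rightarrow> nat \<Rightarrow> (nat \<Rightarrow> 'v set) \<Rightarrow> bool" where
  "indexed_partition V n X \<longleftrightarrow> partition_on V (X ` {1..n}) \<and> inj_on X {1..n}"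

text \<open>\<open>X\<close> and \<open>F\<close> enumerate the classes $X^1,\dots,X^d$ and $e_1,\dots,e_g$.
  The set \<open>e \<inter> X l\<close> is a singleton for \<open>l \<le> card e\<close>, so the index \<open>j l\<close> is unique.\<close>

definition admissible_set ::
    "'v set \<Rightarrow> nat \<Rightarrow> (nat \<Rightarrow> 'v set) \<Rightarrow> nat \<Rightarrow> (nat \<Rightarrow> 'v set) \<Rightarrow> 'v set \<Rightarrow> bool" where
  "admissible_set V d X g F e \<longleftrightarrow>
     e \<subseteq> V \<and>
     (\<forall>i\<in>{1..d}. card (e \<inter> X i) \<le> 1) \<and>
     {i\<in>{1..d}. e \<inter> X i \<noteq> {}} = {1..card e} \<and>
     (\<exists>j. (\<forall>l\<in>{1..card e}. j l \<in> {1..g} \<and> e \<inter> X l \<subseteq> F (j l)) \<and> mono_on {1..card e} j)"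

definition admissible_clutter :: "'k::field itself \<Rightarrow> 'v set \<Rightarrow> 'v set set \<Rightarrow> bool" where
  "admissible_clutter K V E \<longleftrightarrow>
     (\<exists>g d X F.
        ideal_height (mpoly_ring K V) (edge_ideal K V E) = enat g \<and>
        d > 0 \<and>
        indexed_partition V d X \<and>
        indexed_partition V g F \<and>
        (\<forall>i\<in>{1..g}. \<forall>j\<in>{1..d}. card (F i \<inter> X j) \<le> 1) \<and>
        (\<forall>i\<in>{1..g}. F i \<in> E) \<and>
        (\<forall>e\<in>E. admissible_set V d X g F e))"

end

theory Submission
  imports Defs "HOL-Library.Product_Lexorder"
begin

text \<open>Since the partition has \<open>g = 2\<close> classes, uniformity and admissibility force every edge to be a
  staircase \<open>x\<^sub>0, \<dots>, x\<^bsub>s-1\<^esub>, z\<^sub>0, \<dots>, z\<^bsub>d-s-1\<^esub>\<close>, where \<open>x\<close> and \<open>z\<close> enumerate the two edges of the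
  partition in opposite directions. The minimal vertex covers are then pairs \<open>{x\<^sub>a, z\<^sub>b}\<close> with
  \<open>(a, b)\<close> in a Ferrers diagram, and the lexicographic order on the diagram gives linear quotients.

  For the Cohen--Macaulay property, height and depth at every maximal ideal both equal \<open>2 d - 2\<close>.
  The height is at most \<open>2 d - 2\<close> because every prime over the edge ideal contains some \<open>x\<^sub>a\<close> and
  some \<open>z\<^sub>b\<close>; it is at least the depth in any commutative ring. For the depth, put
  \<open>\<theta>\<^sub>v = v - x\<^sub>0\<close> or \<open>v - z\<^sub>0\<close>, and use Zariski's lemma to find a monic polynomial \<open>f\<^sub>v\<close> in \<open>\<theta>\<^sub>v\<close> that lies
  in the given maximal ideal. The products of powers \<open>\<theta>\<^sub>v\<^sup>i f\<^sub>v\<^sup>j\<close> with initial products of the \<open>x\<^sub>i\<close> and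
  of the \<open>z\<^sub>i\<close> form a basis of the polynomial ring in which the edge ideal, and every ideal generated
  by it and some of the \<open>f\<^sub>v\<close>, is spanned by basis elements, while multiplication by \<open>f\<^sub>v\<close> maps
  the basis injectively into itself. Hence the \<open>f\<^sub>v\<close> form a regular sequence.\<close>

text \<open>Linear quotients and Cohen-Macaulayness are commonly linked through free resolutions
  (Eagon-Reiner); here both are read off the staircase separately. The obstacle on the
  Cohen-Macaulay side is that depth is required at every maximal ideal, not only at the homogeneous
  one. Over a field that is not algebraically closed, no translate of \<open>theta v\<close> by a
  constant need lie in the given ideal, so polynomials in \<open>theta v\<close> of higher degree
  have to be allowed. The basis is suggested by the fact that all \<open>x i\<close> agree modulo
  the differences \<open>theta v\<close>: the product of \<open>x 0, ..., x (k-1)\<close> can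
  replace the k-th power of \<open>x 0\<close>, and edge monomials are products of two such initial
  products. Multiplication by \<open>x 0\<close> stays under control because \<open>x 0\<close> is
  \<open>x k\<close> minus the difference at \<open>x k\<close>: the first term extends the initial
  product by one factor, the second is absorbed by the factor of the vertex \<open>x k\<close>.
  Reversing \<open>z\<close> makes the second half of each edge an initial segment as well.\<close>

type_synonym ('v, 'k) mpoly = "('v \<Rightarrow>\<^sub>0 nat) \<Rightarrow>\<^sub>0 'k"

abbreviation "keys \<equiv> Poly_Mapping.keys"
abbreviation "lookup \<equiv> Poly_Mapping.lookup"
abbreviation "single \<equiv> Poly_Mapping.single"
abbreviation "monomial \<equiv> mpoly_monomial"
abbreviation "var \<equiv> mpoly_var"

section \<open>Polynomials in a set of variables\<close>

text \<open>The carrier of \<open>mpoly_ring K V\<close> as a plain set, so that arithmetic can use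
  the ring operations of the type instead of those of the record.\<close>

definition polys :: "'v set \<Rightarrow> ('v, 'k::field) mpoly set" where
  "polys V = {p. \<forall>m\<in>keys p. keys m \<subseteq> V}"

text \<open>Turns polynomials into a vector space over the coefficient field, which makes span,
  independence and dimension counts available.\<close>

definition scal :: "'k::field \<Rightarrow> ('v, 'k) mpoly \<Rightarrow> ('v, 'k) mpoly" where
  "scal c p = single 0 c * p"

interpretation mp: vector_space scal
  by unfold_locales
    (simp_all add: scal_def distrib_left distrib_right single_add mult_single flip: mult.assoc)

lemma scal_mult_left [simp]: "scal c p * q = scal c (p * q)"
  by (simp add: scal_def mult.assoc)

lemma scal_mult_right [simp]: "p * scal c q = scal c (p * q)"
  by (simp add: scal_def mult.left_commute)

lemma lookup_scal: "lookup (scal c p) m = c * lookup p m"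
proof -
  have "scal c p = Poly_Mapping.map ((*) c) p"
    by (simp add: scal_def mult_map_scale_conv_mult)
  then show ?thesis
    by (simp add: Poly_Mapping.map.rep_eq when_def)
qed

lemma keys_scal: "keys (scal c p) \<subseteq> keys p"
  by (auto simp: in_keys_iff lookup_scal)

lemma keys_add_nat: "keys (m + n :: 'v \<Rightarrow>\<^sub>0 nat) = keys m \<union> keys n"
  by (auto simp: in_keys_iff lookup_add)

lemma polys_mono: "U \<subseteq> V \<Longrightarrow> polys U \<subseteq> polys V"
  by (auto simp: polys_def)

lemma polys_zero [simp, intro]: "0 \<in> polys V"
  by (simp add: polys_def)

lemma polys_one [simp, intro]: "1 \<in> polys V"
  by (simp add: polys_def)

lemma polys_add [intro]: "p \<in> polys V \<Longrightarrow> q \<in> polys V \<Longrightarrow> p + q \<in> polys V"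
  using keys_add[of p q] by (auto simp: polys_def)

lemma polys_uminus [intro]: "p \<in> polys V \<Longrightarrow> - p \<in> polys V"
  by (auto simp: polys_def in_keys_iff)

lemma polys_diff [intro]: "p \<in> polys V \<Longrightarrow> q \<in> polys V \<Longrightarrow> p - q \<in> polys V"
  using polys_add[of p V "- q"] by auto

lemma polys_mult [intro]:
  assumes "p \<in> polys V" "q \<in> polys V"
  shows "p * q \<in> polys V"
  unfolding polys_def
proof (intro CollectI ballI)
  fix m assume "m \<in> keys (p * q)"
  then obtain a b where "m = a + b" "a \<in> keys p" "b \<in> keys q"
    using keys_mult[of p q] by blast
  then show "keys m \<subseteq> V"
    using assms by (auto simp: polys_def keys_add_nat)
qed

lemma polys_scal [intro]: "p \<in> polys V \<Longrightarrow> scal c p \<in> polys V"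
  using keys_scal[of c p] by (auto simp: polys_def)

lemma polys_sum [intro]: "(\<And>i. i \<in> A \<Longrightarrow> f i \<in> polys V) \<Longrightarrow> sum f A \<in> polys V"
  by (induction A rule: infinite_finite_induct) auto

lemma polys_prod [intro]: "(\<And>i. i \<in> A \<Longrightarrow> f i \<in> polys V) \<Longrightarrow> prod f A \<in> polys V"
  by (induction A rule: infinite_finite_induct) auto

lemma polys_power [intro]: "p \<in> polys V \<Longrightarrow> p ^ n \<in> polys V"
  by (induction n) auto

lemma polys_monomial [simp]: "monomial m \<in> polys V \<longleftrightarrow> keys m \<subseteq> V"
  by (simp add: polys_def mpoly_monomial_def)

lemma polys_var [simp]: "var v \<in> polys V \<longleftrightarrow> v \<in> V"
  by (simp add: polys_def mpoly_var_def)

lemma subspace_polys: "mp.subspace (polys V)"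
  by (auto simp: mp.subspace_def)

lemma mpoly_var_eq_monomial: "var v = monomial (single v 1)"
  by (simp add: mpoly_var_def mpoly_monomial_def)

lemma monomial_0 [simp]: "monomial 0 = 1"
  by (simp add: mpoly_monomial_def)

lemma monomial_add: "monomial (m + n) = monomial m * monomial n"
  by (simp add: mpoly_monomial_def mult_single)

lemma monomial_inject [simp]: "monomial m = monomial n \<longleftrightarrow> m = n"
  unfolding mpoly_monomial_def by (metis keys_single singleton_inject zero_neq_one)

lemma keys_mpoly_monomial [simp]: "keys (monomial m) = {m}"
  by (simp add: mpoly_monomial_def)

lemma monomial_nonzero [simp]: "monomial m \<noteq> 0"
  by (metis keys_mpoly_monomial keys_zero insert_not_empty)

lemma poly_eq_sum_monomials:
  "p = (\<Sum>m\<in>keys p. scal (lookup p m) (monomial m))"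
  by (rule poly_mapping_eqI)
    (auto simp: lookup_sum lookup_scal mpoly_monomial_def lookup_single when_def in_keys_iff
      if_distrib[of "(*) _"] cong: if_cong)

lemma poly_in_span_monomials: "p \<in> mp.span (monomial ` keys p)"
proof -
  have "(\<Sum>m\<in>keys p. scal (lookup p m) (monomial m))
      \<in> mp.span (monomial ` keys p)"
    by (intro mp.span_sum mp.span_scale) (auto intro: mp.span_base)
  then show ?thesis
    using poly_eq_sum_monomials[of p] by simp
qed

text \<open>The coefficient at \<open>m\<close> vanishes on the span of all other monomials, so
  \<open>monomial m\<close> lies outside that span.\<close>

lemma independent_monomials: "mp.independent (range monomial)"
proof -
  have *: "lookup p m = 0" if "p \<in> mp.span (range monomial - {monomial m})" for p m
    using that
    by (induction rule: mp.span_induct_alt)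
      (auto simp: lookup_add lookup_scal mpoly_monomial_def lookup_single when_def split: if_splits)
  show ?thesis
    unfolding mp.dependent_def using * by (fastforce simp: mpoly_monomial_def)
qed

text \<open>Induction on the total degree. Growing by one variable at a time matches hypotheses that
  only speak of multiplication by a single variable.\<close>

lemma monomial_induct [consumes 1, case_names zero add]:
  assumes "keys m \<subseteq> V"
    and "P 0"
    and step: "\<And>m v. keys m \<subseteq> V \<Longrightarrow> v \<in> V \<Longrightarrow> P m \<Longrightarrow> P (m + single v (1::nat))"
  shows "P m"
proof -
  have "P m" if "(\<Sum>v\<in>keys m. lookup m v) = n" "keys m \<subseteq> V" for n m
    using that
  proof (induction n arbitrary: m)
    case 0
    then have "m = 0"
      by (intro poly_mapping_eqI) (auto simp: in_keys_iff)
    with assms(2) show ?case by simp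
  next
    case (Suc n)
    then have "m \<noteq> 0" by force
    then obtain v where v: "v \<in> keys m"
      by (metis keys_eq_empty ex_in_conv)
    define m' where "m' = m - single v 1"
    have m: "m = m' + single v 1"
      unfolding m'_def using v
      by (intro poly_mapping_eqI) (auto simp: lookup_add lookup_minus lookup_single when_def in_keys_iff)
    have lm: "lookup m w = lookup m' w + (if w = v then 1 else 0)" for w
      using arg_cong[OF m, of "\<lambda>m. lookup m w"]
      by (simp add: lookup_add lookup_single when_def)
    have sub: "keys m' \<subseteq> keys m"
      by (subst m) (auto simp: keys_add_nat)
    have "(\<Sum>v\<in>keys m'. lookup m' v) = (\<Sum>v\<in>keys m. lookup m' v)"
      by (rule sum.mono_neutral_left) (use sub in \<open>auto simp: in_keys_iff\<close>)
    moreover have "(\<Sum>v\<in>keys m. lookup m v) = (\<Sum>w\<in>keys m. lookup m' w + (if w = v then 1 else 0))"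
      by (intro sum.cong) (auto simp: lm)
    ultimately have "(\<Sum>v\<in>keys m'. lookup m' v) = n"
      using Suc.prems(1) v by (simp add: sum.distrib)
    with Suc.IH[of m'] sub Suc.prems(2) have "P m'" by auto
    then show ?case
      using step[of m' v] sub v Suc.prems(2) m by auto
  qed
  then show ?thesis using assms(1) by blast
qed

lemma exponent_degree_superset:
  assumes "finite A" "keys m \<subseteq> A"
  shows "exponent_degree m = (\<Sum>v\<in>A. lookup m v)"
  unfolding exponent_degree_def
  by (rule sum.mono_neutral_left) (use assms in \<open>auto simp: in_keys_iff\<close>)

lemma exponent_degree_0 [simp]: "exponent_degree 0 = 0"
  by (simp add: exponent_degree_def)

lemma exponent_degree_add: "exponent_degree (m + n) = exponent_degree m + exponent_degree n"
proof -
  let ?A = "keys m \<union> keys n"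
  have "exponent_degree m = sum (lookup m) ?A"
    "exponent_degree n = sum (lookup n) ?A"
    "exponent_degree (m + n) = sum (lookup (m + n)) ?A"
    by (auto intro!: exponent_degree_superset simp: keys_add_nat)
  then show ?thesis by (simp add: lookup_add sum.distrib)
qed

lemma exponent_degree_single [simp]: "exponent_degree (single v k) = k"
  by (cases "k = 0") (auto simp: exponent_degree_def)

text \<open>For subspaces, closure under the variables already gives the ideal property. Spans of
  basis elements are later recognised as ideals in this way.\<close>

lemma subspace_closed_under_polys:
  assumes "mp.subspace J" and "\<And>v p. v \<in> V \<Longrightarrow> p \<in> J \<Longrightarrow> var v * p \<in> J"
    and "q \<in> polys V" "p \<in> J"
  shows "q * p \<in> J"
proof -
  have *: "monomial m * p \<in> J" if "keys m \<subseteq> V" for m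
    using that
  proof (induction m rule: monomial_induct)
    case (add m v)
    then show ?case
      using assms(2)[of v "monomial m * p"]
      by (simp add: monomial_add mpoly_var_eq_monomial mult_ac)
  qed (use assms in simp)
  have "q * p = (\<Sum>m\<in>keys q. scal (lookup q m) (monomial m * p))"
    by (subst poly_eq_sum_monomials) (simp add: sum_distrib_right)
  also have "\<dots> \<in> J"
    using assms(1,3) * by (intro mp.subspace_sum mp.subspace_scale) (auto simp: polys_def)
  finally show ?thesis .
qed

subsection \<open>Ideals of the polynomial ring\<close>

text \<open>The predicate \<open>ideal\<close> for \<open>mpoly_ring K V\<close> without the record;
  additive inverses come from multiplication by -1.\<close>

definition pideal :: "'v set \<Rightarrow> ('v, 'k::field) mpoly set \<Rightarrow> bool" where
  "pideal V J \<longleftrightarrow> J \<subseteq> polys V \<and> 0 \<in> J \<and> (\<forall>p\<in>J. \<forall>q\<in>J. p + q \<in> J) \<and> (\<forall>p\<in>polys V. \<forall>q\<in>J. p * q \<in> J)"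

lemma carrier_mpoly_ring [simp]: "carrier (mpoly_ring K V) = polys V"
  and mult_mpoly_ring [simp]: "p \<otimes>\<^bsub>mpoly_ring K V\<^esub> q = p * q"
  and add_mpoly_ring [simp]: "p \<oplus>\<^bsub>mpoly_ring K V\<^esub> q = p + q"
  and one_mpoly_ring [simp]: "\<one>\<^bsub>mpoly_ring K V\<^esub> = 1"
  and zero_mpoly_ring [simp]: "\<zero>\<^bsub>mpoly_ring K V\<^esub> = 0"
  by (simp_all add: mpoly_ring_def polys_def)

lemma cring_mpoly_ring: "cring (mpoly_ring K V)"
proof (rule cringI)
  show "abelian_group (mpoly_ring K V)"
  proof (rule abelian_groupI)
    fix p :: "('a, 'b) mpoly" assume "p \<in> carrier (mpoly_ring K V)"
    then show "\<exists>q\<in>carrier (mpoly_ring K V). q \<oplus>\<^bsub>mpoly_ring K V\<^esub> p = \<zero>\<^bsub>mpoly_ring K V\<^esub>"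
      by (intro bexI[of _ "- p"]) auto
  qed (auto simp: add_ac)
  show "Group.comm_monoid (mpoly_ring K V)"
    by (rule comm_monoidI) (auto simp: mult_ac)
qed (auto simp: algebra_simps)

lemma ring_mpoly_ring: "ring (mpoly_ring K V)"
  using cring_mpoly_ring cring.axioms(1) by blast

lemma pideal_uminus: "pideal V J \<Longrightarrow> p \<in> J \<Longrightarrow> - p \<in> J"
  unfolding pideal_def by (metis mult_1 mult_minus_left polys_one polys_uminus)

lemma ideal_mpoly_ring_iff: "ideal J (mpoly_ring K V) \<longleftrightarrow> pideal V J"
proof
  assume J: "ideal J (mpoly_ring K V)"
  then interpret ideal J "mpoly_ring K V" .
  show "pideal V J"
    unfolding pideal_def using Icarr I_l_closed
      additive_subgroup.zero_closed[OF additive_subgroup_axioms]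
      additive_subgroup.a_closed[OF additive_subgroup_axioms] by auto
next
  assume J: "pideal V J"
  show "ideal J (mpoly_ring K V)"
  proof (rule idealI[OF ring_mpoly_ring])
    interpret R: cring "mpoly_ring K V" by (rule cring_mpoly_ring)
    show "subgroup J (add_monoid (mpoly_ring K V))"
    proof (rule group.subgroupI)
      show "Group.group (add_monoid (mpoly_ring K V))"
        by (rule R.add.group_axioms)
      fix p assume p: "p \<in> J"
      have "inv\<^bsub>add_monoid (mpoly_ring K V)\<^esub> p = - p"
        by (rule R.add.inv_equality[of "- p" p, unfolded a_inv_def]) (use J p in \<open>auto simp: pideal_def\<close>)
      then show "inv\<^bsub>add_monoid (mpoly_ring K V)\<^esub> p \<in> J"
        using pideal_uminus[OF J p] by simp
    qed (use J in \<open>auto simp: pideal_def\<close>)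
    fix p q assume "p \<in> J" "q \<in> carrier (mpoly_ring K V)"
    then have "q * p \<in> J"
      using J by (auto simp: pideal_def)
    then show "q \<otimes>\<^bsub>mpoly_ring K V\<^esub> p \<in> J" "p \<otimes>\<^bsub>mpoly_ring K V\<^esub> q \<in> J"
      by (simp_all add: mult.commute)
  qed
qed

lemma pidealI:
  assumes "mp.subspace J" "J \<subseteq> polys V" and "\<And>v p. v \<in> V \<Longrightarrow> p \<in> J \<Longrightarrow> var v * p \<in> J"
  shows "pideal V J"
  unfolding pideal_def
  using assms subspace_closed_under_polys[OF assms(1), of V] by (auto simp: mp.subspace_def)

lemma pideal_scal: "pideal V J \<Longrightarrow> p \<in> J \<Longrightarrow> scal c p \<in> J"
  unfolding pideal_def by (metis mult_1 polys_one polys_scal scal_mult_left)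

lemma pideal_subspace: "pideal V J \<Longrightarrow> mp.subspace J"
  by (auto simp: mp.subspace_def pideal_scal) (auto simp: pideal_def)

lemma pideal_carrier: "pideal V J \<Longrightarrow> p \<in> J \<Longrightarrow> p \<in> polys V"
  by (auto simp: pideal_def)

lemma pideal_mult_left: "pideal V J \<Longrightarrow> p \<in> J \<Longrightarrow> q \<in> polys V \<Longrightarrow> q * p \<in> J"
  by (auto simp: pideal_def)

lemma pideal_mult_right: "pideal V J \<Longrightarrow> p \<in> J \<Longrightarrow> q \<in> polys V \<Longrightarrow> p * q \<in> J"
  by (auto simp: pideal_def mult.commute)

lemma pideal_add: "pideal V J \<Longrightarrow> p \<in> J \<Longrightarrow> q \<in> J \<Longrightarrow> p + q \<in> J"
  by (auto simp: pideal_def)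

lemma pideal_diff: "pideal V J \<Longrightarrow> p \<in> J \<Longrightarrow> q \<in> J \<Longrightarrow> p - q \<in> J"
  using mp.subspace_diff pideal_subspace by blast

lemma pideal_sum: "pideal V J \<Longrightarrow> (\<And>i. i \<in> A \<Longrightarrow> f i \<in> J) \<Longrightarrow> sum f A \<in> J"
  using mp.subspace_sum pideal_subspace by blast

lemma pideal_genideal: "S \<subseteq> polys V \<Longrightarrow> pideal V (Idl\<^bsub>mpoly_ring K V\<^esub> S)"
  using ring.genideal_ideal[OF ring_mpoly_ring, of S K V] by (simp add: ideal_mpoly_ring_iff)

lemma genideal_mpoly_subset: "S \<subseteq> polys V \<Longrightarrow> S \<subseteq> Idl\<^bsub>mpoly_ring K V\<^esub> S"
  using ring.genideal_self[OF ring_mpoly_ring, of S K V] by simp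

lemma genideal_mpoly_minimal: "pideal V J \<Longrightarrow> S \<subseteq> J \<Longrightarrow> Idl\<^bsub>mpoly_ring K V\<^esub> S \<subseteq> J"
  using ring.genideal_minimal[OF ring_mpoly_ring, of J K V S] by (simp add: ideal_mpoly_ring_iff)

section \<open>Depth is at most height\<close>

text \<open>Among the ideals that contain \<open>J\<close> and avoid all products of an element outside \<open>P\<close> with a
  nonzerodivisor modulo \<open>J\<close>, a maximal one is prime.\<close>

lemma (in cring) exists_prime_of_zero_divisors:
  assumes J: "ideal J R" and P: "primeideal P R" and "J \<subseteq> P"
  obtains Q where "primeideal Q R" "J \<subseteq> Q" "Q \<subseteq> P"
    "\<And>q. q \<in> Q \<Longrightarrow> \<exists>a\<in>carrier R. q \<otimes> a \<in> J \<and> a \<notin> J"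
proof -
  interpret P: primeideal P R by (rule P)
  interpret J: ideal J R by (rule J)
  define N where "N = {t \<in> carrier R. \<forall>a\<in>carrier R. t \<otimes> a \<in> J \<longrightarrow> a \<in> J}"
  define T where "T = {s \<otimes> t |s t. s \<in> carrier R - P \<and> t \<in> N}"
  have one_P: "\<one> \<notin> P"
    using P.I_notcarr P.one_imp_carrier by auto
  have one_N: "\<one> \<in> N"
    by (auto simp: N_def)
  have T_carr: "T \<subseteq> carrier R"
    unfolding T_def N_def by blast
  have N_T: "N \<subseteq> T"
  proof
    fix t assume t: "t \<in> N"
    then have "t = \<one> \<otimes> t" by (simp add: N_def)
    then show "t \<in> T" unfolding T_def using t one_P by blast
  qed
  have P_T: "carrier R - P \<subseteq> T"
  proof
    fix s assume s: "s \<in> carrier R - P"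
    then have "s = s \<otimes> \<one>" by simp
    then show "s \<in> T" unfolding T_def using s one_N by blast
  qed
  have T_mult: "t \<otimes> t' \<in> T" if "t \<in> T" "t' \<in> T" for t t'
  proof -
    obtain a b where *: "t = a \<otimes> b" "a \<in> carrier R - P" "b \<in> N"
      using \<open>t \<in> T\<close> unfolding T_def by blast
    moreover obtain a' b' where **: "t' = a' \<otimes> b'" "a' \<in> carrier R - P" "b' \<in> N"
      using \<open>t' \<in> T\<close> unfolding T_def by blast
    ultimately have carr: "a \<in> carrier R" "b \<in> carrier R" "a' \<in> carrier R" "b' \<in> carrier R"
      unfolding N_def by blast+
    have "t \<otimes> t' = (a \<otimes> a') \<otimes> (b \<otimes> b')"
      unfolding *(1) **(1) using carr by (simp add: m_ac)
    moreover have "a \<otimes> a' \<in> carrier R - P"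
      using *(2) **(2) P.I_prime[of a a'] by auto
    moreover have "b \<otimes> b' \<in> N"
      unfolding N_def
    proof (intro CollectI conjI ballI impI)
      fix c assume c: "c \<in> carrier R" "b \<otimes> b' \<otimes> c \<in> J"
      then have "b \<otimes> (b' \<otimes> c) \<in> J" using carr by (simp add: m_assoc)
      moreover have "b' \<otimes> c \<in> carrier R" using carr c by blast
      ultimately have "b' \<otimes> c \<in> J" using *(3) unfolding N_def by blast
      then show "c \<in> J" using **(3) c unfolding N_def by blast
    qed (use carr in simp)
    ultimately show ?thesis unfolding T_def by blast
  qed
  have J_T: "J \<inter> T = {}"
  proof (rule ccontr)
    assume "J \<inter> T \<noteq> {}"
    then obtain s t where st: "s \<in> carrier R - P" "t \<in> N" "s \<otimes> t \<in> J"
      unfolding T_def by blast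
    then have "t \<in> carrier R" "s \<in> carrier R" unfolding N_def by blast+
    then have "t \<otimes> s \<in> J" using st(3) m_comm by metis
    then have "s \<in> J" using st(2) \<open>s \<in> carrier R\<close> unfolding N_def by blast
    then show False using st(1) \<open>J \<subseteq> P\<close> by blast
  qed
  define \<F> where "\<F> = {I. ideal I R \<and> J \<subseteq> I \<and> I \<inter> T = {}}"
  have "\<exists>Q\<in>\<F>. \<forall>I\<in>\<F>. Q \<subseteq> I \<longrightarrow> I = Q"
  proof (rule subset_Zorn_nonempty)
    show "\<F> \<noteq> {}" using J J_T unfolding \<F>_def by blast
    fix C assume C: "C \<noteq> {}" "subset.chain \<F> C"
    then have "C \<subseteq> \<F>" unfolding subset_chain_def by blast
    moreover have "subset.chain {I. ideal I R} C"
      using C(2) unfolding subset_chain_def \<F>_def by blast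
    then have "ideal (\<Union>C) R"
      using chain_Union_is_ideal[of C] C(1) by simp
    ultimately show "\<Union>C \<in> \<F>"
      using C(1) unfolding \<F>_def by blast
  qed
  then obtain Q where "Q \<in> \<F>" and Q_max: "\<forall>I\<in>\<F>. Q \<subseteq> I \<longrightarrow> I = Q"
    by (elim bexE)
  then have Q: "ideal Q R" "J \<subseteq> Q" "Q \<inter> T = {}"
    by (simp_all add: \<F>_def)
  have max: "I = Q" if "ideal I R" "Q \<subseteq> I" "I \<inter> T = {}" for I
    using Q_max Q(2) that by (simp add: \<F>_def)
  interpret Q: ideal Q R by (rule Q(1))
  \<comment> \<open>The ideal generated by \<open>Q\<close> and \<open>a\<close> is strictly larger
    than \<open>Q\<close>, so by maximality it meets \<open>T\<close>.\<close>
  have meets: "\<exists>q\<in>Q. \<exists>r\<in>carrier R. q \<oplus> r \<otimes> a \<in> T" if a: "a \<in> carrier R" "a \<notin> Q" for a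
  proof -
    have I: "ideal (Q <+> PIdl a) R"
      using add_ideals[OF Q(1) cgenideal_ideal] a by blast
    have "Q \<subseteq> Q <+> PIdl a"
    proof
      fix q assume "q \<in> Q"
      then have "q = q \<oplus> \<zero> \<otimes> a" using a Q.Icarr by simp
      with \<open>q \<in> Q\<close> show "q \<in> Q <+> PIdl a"
        unfolding set_add_def' cgenideal_def by fastforce
    qed
    moreover have "a \<in> Q <+> PIdl a"
    proof -
      have "a = \<zero> \<oplus> \<one> \<otimes> a" using a by simp
      moreover have "\<zero> \<in> Q" by simp
      ultimately show ?thesis
        unfolding set_add_def' cgenideal_def by fastforce
    qed
    ultimately have "(Q <+> PIdl a) \<inter> T \<noteq> {}"
      using max[OF I] a by blast
    then show ?thesis
      unfolding set_add_def' cgenideal_def by fastforce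
  qed
  have "primeideal Q R"
  proof (rule primeidealI[OF Q(1) is_cring])
    show "carrier R \<noteq> Q"
      using Q(3) one_N N_T by auto
    fix a b assume ab: "a \<in> carrier R" "b \<in> carrier R" "a \<otimes> b \<in> Q"
    show "a \<in> Q \<or> b \<in> Q"
    proof (rule ccontr)
      assume "\<not> (a \<in> Q \<or> b \<in> Q)"
      then have na: "a \<notin> Q" and nb: "b \<notin> Q" by auto
      obtain q r where qr: "q \<in> Q" "r \<in> carrier R" "q \<oplus> r \<otimes> a \<in> T"
        using meets[OF ab(1) na] by blast
      obtain q' r' where qr': "q' \<in> Q" "r' \<in> carrier R" "q' \<oplus> r' \<otimes> b \<in> T"
        using meets[OF ab(2) nb] by blast
      note * = qr qr'
      have carr: "q \<in> carrier R" "q' \<in> carrier R" using * Q.Icarr by auto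
      \<comment> \<open>The product of the two elements of \<open>T\<close> is again in
        \<open>T\<close>, but each summand of its expansion contains \<open>q\<close>,
        \<open>q'\<close> or \<open>a \<otimes> b\<close> and hence lies in
        \<open>Q\<close>.\<close>
      have "(q \<oplus> r \<otimes> a) \<otimes> (q' \<oplus> r' \<otimes> b) = (q' \<oplus> r' \<otimes> b) \<otimes> q \<oplus> (r \<otimes> a \<otimes> q' \<oplus> r \<otimes> r' \<otimes> (a \<otimes> b))"
        using * ab carr by algebra
      moreover have "\<dots> \<in> Q"
        using * ab carr Q.I_l_closed[OF ab(3), of "r \<otimes> r'"]
        by (intro Q.a_closed Q.I_l_closed[of q] Q.I_l_closed[of q']) auto
      ultimately show False
        using T_mult[OF *(3,6)] Q(3) by auto
    qed
  qed
  moreover have "Q \<subseteq> P"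
    using P_T Q(3) Q.Icarr by blast
  moreover have "\<exists>a\<in>carrier R. q \<otimes> a \<in> J \<and> a \<notin> J" if "q \<in> Q" for q
    using N_T Q(3) that Q.Icarr[OF that] unfolding N_def by blast
  ultimately show ?thesis
    using Q(2) that by blast
qed

text \<open>Built from the top: the last element is a nonzerodivisor modulo the earlier ones, so it
  cannot lie in a prime \<open>Q\<close> that consists of zero divisors modulo them. It does lie in
  \<open>P\<close>, which makes the inclusion of \<open>Q\<close> in \<open>P\<close> strict, and
  the shorter sequence is handled below \<open>Q\<close>.\<close>

lemma (in cring) prime_chain_of_regular:
  assumes "primeideal P R" "set xs \<subseteq> P"
    and "\<And>i a. i < length xs \<Longrightarrow> a \<in> carrier R \<Longrightarrow> xs ! i \<otimes> a \<in> Idl (set (take i xs))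
      \<Longrightarrow> a \<in> Idl (set (take i xs))"
  shows "\<exists>Q. prime_chain R P (length xs) Q"
  using assms
proof (induction xs arbitrary: P rule: rev_induct)
  case Nil
  then show ?case by (auto simp: prime_chain_def)
next
  case (snoc x xs)
  interpret P: primeideal P R by (rule snoc.prems(1))
  have sub: "set xs \<subseteq> carrier R"
    using snoc.prems(2) P.Icarr by auto
  have "Idl (set xs) \<subseteq> P"
    using genideal_minimal[OF P.is_ideal] snoc.prems(2) by auto
  then obtain Q where Q: "primeideal Q R" "Idl (set xs) \<subseteq> Q" "Q \<subseteq> P"
    "\<And>q. q \<in> Q \<Longrightarrow> \<exists>a\<in>carrier R. q \<otimes> a \<in> Idl (set xs) \<and> a \<notin> Idl (set xs)"
    using exists_prime_of_zero_divisors[OF genideal_ideal[OF sub] snoc.prems(1)] by blast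
  have "x \<notin> Q"
    using Q(4)[of x] snoc.prems(3)[of "length xs"] by auto
  then have "Q \<subset> P"
    using Q(3) snoc.prems(2) by auto
  have "\<exists>C. prime_chain R Q (length xs) C"
  proof (rule snoc.IH[OF Q(1)])
    show "set xs \<subseteq> Q" using genideal_self[OF sub] Q(2) by auto
    show "a \<in> Idl (set (take i xs))"
      if "i < length xs" "a \<in> carrier R" "xs ! i \<otimes> a \<in> Idl (set (take i xs))" for i a
      using snoc.prems(3)[of i a] that by (auto simp: nth_append)
  qed
  then obtain C where C: "prime_chain R Q (length xs) C" by blast
  have "prime_chain R P (Suc (length xs)) (\<lambda>i. if i \<le> length xs then C i else P)"
    using C \<open>Q \<subset> P\<close> snoc.prems(1) by (auto simp: prime_chain_def le_Suc_eq less_Suc_eq_le not_le)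
  then show ?case by auto
qed

lemma (in cring) ideal_depth_le_prime_height:
  assumes "primeideal P R"
  shows "ideal_depth R P \<le> prime_height R P"
  unfolding ideal_depth_def
proof (rule Sup_least, safe)
  fix xs assume "regular_sequence R xs" "set xs \<subseteq> P"
  then have "\<exists>Q. prime_chain R P (length xs) Q"
    using prime_chain_of_regular[OF assms] by (auto simp: regular_sequence_def)
  then show "enat (length xs) \<le> prime_height R P"
    unfolding prime_height_def by (intro Sup_upper) auto
qed

section \<open>Lexicographic order and Noetherianity\<close>

text \<open>The lexicographic order with respect to an enumeration \<open>vs\<close> of the
  variables; the list stands in for an order on the type of variables.\<close>

definition mlt :: "'v list \<Rightarrow> ('v \<Rightarrow>\<^sub>0 nat) \<Rightarrow> ('v \<Rightarrow>\<^sub>0 nat) \<Rightarrow> bool" where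
  "mlt vs m n \<longleftrightarrow> (map (lookup m) vs, map (lookup n) vs) \<in> lex less_than"

lemma wfp_mlt: "wfp (mlt vs)"
proof -
  have "wf (inv_image (lex less_than) (\<lambda>m. map (lookup m) vs))"
    by (intro wf_inv_image wf_lex wf_less_than)
  then show ?thesis
    by (simp add: wfp_def mlt_def inv_image_def)
qed

lemma mlt_irrefl: "\<not> mlt vs m m"
  by (simp add: mlt_def irrefl_less_than)

lemma mlt_trans: "mlt vs a b \<Longrightarrow> mlt vs b c \<Longrightarrow> mlt vs a c"
  unfolding mlt_def by (rule transD[OF lex_transI[OF trans_less_than]])

lemma mlt_total:
  assumes "keys m \<subseteq> set vs" "keys n \<subseteq> set vs" "m \<noteq> n"
  shows "mlt vs m n \<or> mlt vs n m"
proof -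
  have "(\<forall>v\<in>set vs. f v = g v) \<or> (map f vs, map g vs) \<in> lex less_than \<or> (map g vs, map f vs) \<in> lex less_than"
    for f g :: "'a \<Rightarrow> nat"
    by (induction vs) auto
  moreover have "\<exists>v\<in>set vs. lookup m v \<noteq> lookup n v"
  proof (rule ccontr)
    assume *: "\<not> ?thesis"
    have "m = n"
    proof (rule poly_mapping_eqI)
      fix v show "lookup m v = lookup n v"
        using * assms(1,2) by (metis in_keys_iff subsetD)
    qed
    with assms(3) show False by simp
  qed
  ultimately show ?thesis unfolding mlt_def by blast
qed

lemma mlt_add_right: "mlt vs m n \<Longrightarrow> mlt vs (m + k) (n + k :: 'a \<Rightarrow>\<^sub>0 nat)"
proof -
  have *: "lookup (m + k) = (\<lambda>v. lookup m v + lookup k v)" for m :: "'a \<Rightarrow>\<^sub>0 nat"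
    by (rule ext) (rule lookup_add)
  have "(map f vs, map g vs) \<in> lex less_than \<Longrightarrow>
    (map (\<lambda>v. f v + h v) vs, map (\<lambda>v. g v + h v) vs) \<in> lex less_than" for f g h :: "'a \<Rightarrow> nat"
    by (induction vs) auto
  from this[of "lookup m" "lookup n" "lookup k"]
  show "mlt vs m n \<Longrightarrow> mlt vs (m + k) (n + k)"
    by (simp add: mlt_def *)
qed

lemma not_mlt_zero: "\<not> mlt vs (m :: 'a \<Rightarrow>\<^sub>0 nat) 0"
proof -
  have "(map f vs, map (\<lambda>_. 0) vs) \<notin> lex less_than" for f :: "'a \<Rightarrow> nat"
    by (induction vs) auto
  moreover have "lookup (0 :: 'a \<Rightarrow>\<^sub>0 nat) = (\<lambda>_. 0)"
    by (rule ext) simp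
  ultimately show ?thesis by (simp add: mlt_def)
qed

section \<open>Leading exponents\<close>

definition is_lead :: "'v list \<Rightarrow> ('v, 'k::field) mpoly \<Rightarrow> ('v \<Rightarrow>\<^sub>0 nat) \<Rightarrow> bool" where
  "is_lead vs p m \<longleftrightarrow> m \<in> keys p \<and> (\<forall>n\<in>keys p. n = m \<or> mlt vs n m)"

lemma exists_lead:
  assumes "p \<in> polys (set vs)" "p \<noteq> 0"
  shows "\<exists>m. is_lead vs p m"
proof -
  have "\<exists>m\<in>A. \<forall>n\<in>A. n = m \<or> mlt vs n m"
    if "finite A" "A \<noteq> {}" "\<forall>m\<in>A. keys m \<subseteq> set vs" for A
    using that
  proof (induction rule: finite_ne_induct)
    case (insert a A)
    then obtain m where m: "m \<in> A" "\<forall>n\<in>A. n = m \<or> mlt vs n m" by auto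
    then have "a \<noteq> m" using insert.hyps by blast
    then consider "mlt vs a m" | "mlt vs m a"
      using mlt_total[of a vs m] insert.prems m(1) by auto
    then show ?case
    proof cases
      case 1
      then have "n = m \<or> mlt vs n m" if "n \<in> insert a A" for n
        using that m(2) by auto
      then show ?thesis using m(1) by blast
    next
      case 2
      have "n = a \<or> mlt vs n a" if "n \<in> insert a A" for n
        using that m(2) 2 mlt_trans[of vs n m a] by auto
      then show ?thesis by blast
    qed
  qed auto
  from this[of "keys p"] show ?thesis
    using assms by (auto simp: is_lead_def polys_def)
qed

text \<open>Any pair of exponents other than the two leading ones has a strictly smaller sum, so a
  single product contributes to this coefficient.\<close>

lemma lookup_mult_lead:
  assumes "is_lead vs p a" "is_lead vs q b"
  shows "lookup (p * q) (a + b) = lookup p a * lookup q b"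
proof -
  have uniq: "m = a \<and> n = b" if "m \<in> keys p" "n \<in> keys q" "m + n = a + b" for m n
  proof -
    have "m = a \<or> mlt vs (m + n) (a + n)"
      using assms(1) that(1) mlt_add_right[of vs m a n] by (auto simp: is_lead_def)
    moreover have "n = b \<or> mlt vs (a + n) (a + b)"
      using assms(2) that(2) mlt_add_right[of vs n b a] by (auto simp: is_lead_def add.commute)
    ultimately show ?thesis
      using that(3) mlt_irrefl mlt_trans by metis
  qed
  have "p * q = (\<Sum>m\<in>keys p. \<Sum>n\<in>keys q.
      scal (lookup p m * lookup q n) (monomial (m + n)))"
    by (subst poly_eq_sum_monomials[of p], subst poly_eq_sum_monomials[of q])
      (simp add: sum_product monomial_add mult_ac)
  then have "lookup (p * q) (a + b) = (\<Sum>m\<in>keys p. \<Sum>n\<in>keys q.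
      lookup p m * lookup q n * (if m + n = a + b then 1 else 0))"
    by (simp add: lookup_sum lookup_scal mpoly_monomial_def lookup_single when_def)
  also have "\<dots> = (\<Sum>m\<in>keys p. \<Sum>n\<in>keys q.
      if m = a \<and> n = b then lookup p a * lookup q b else 0)"
    by (intro sum.cong refl) (use uniq in auto)
  also have "\<dots> = (\<Sum>m\<in>keys p. if m = a then
      (\<Sum>n\<in>keys q. if n = b then lookup p a * lookup q b else 0) else 0)"
    by (intro sum.cong refl) auto
  also have "\<dots> = lookup p a * lookup q b"
    using assms by (simp add: is_lead_def)
  finally show ?thesis .
qed

lemma lead_sum_in_keys_mult:
  assumes "is_lead vs p a" "is_lead vs q b"
  shows "a + b \<in> keys (p * q)"
  using lookup_mult_lead[OF assms] assms by (simp add: is_lead_def in_keys_iff)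

lemma polys_no_zero_divisors:
  assumes "finite V" "p \<in> polys V" "q \<in> polys V" "p * q = 0"
  shows "p = 0 \<or> q = 0"
proof (rule ccontr)
  assume *: "\<not> ?thesis"
  obtain vs where "set vs = V" using assms(1) finite_list by blast
  then obtain a b where "is_lead vs p a" "is_lead vs q b"
    using exists_lead[of p vs] exists_lead[of q vs] assms * by auto
  then show False using lead_sum_in_keys_mult[of vs p a q b] assms(4) by simp
qed

text \<open>The leading exponents of \<open>p\<close> and \<open>q\<close> add up to the only
  exponent of 1, so that of \<open>p\<close> is 0, and no exponent is smaller than 0. This later
  refutes the invertibility of a nonconstant polynomial.\<close>

lemma keys_unit:
  assumes "finite V" "p \<in> polys V" "q \<in> polys V" "p * q = 1"
  shows "keys p \<subseteq> {0}"
proof -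
  obtain vs where "set vs = V" using assms(1) finite_list by blast
  moreover have "p \<noteq> 0" "q \<noteq> 0" using assms(4) by auto
  ultimately obtain a b where ab: "is_lead vs p a" "is_lead vs q b"
    using exists_lead[of p vs] exists_lead[of q vs] assms by auto
  then have "a + b = 0"
    using lead_sum_in_keys_mult[OF ab] assms(4) by simp
  then have "a = 0"
    by (metis Un_empty keys_add_nat keys_zero poly_mapping_eqI in_keys_iff lookup_zero empty_iff)
  then show ?thesis
    using ab(1) not_mlt_zero by (auto simp: is_lead_def)
qed

text \<open>One coordinate at a time, by passing to a monotone subsequence. A decreasing sequence of
  natural numbers is constant from the place \<open>i0\<close> of its minimum on, so a shift by
  \<open>i0\<close> makes it increasing as well.\<close>

lemma dickson:
  assumes "finite V"
  shows "\<exists>r::nat \<Rightarrow> nat. strict_mono r \<and> (\<forall>v\<in>V. incseq (\<lambda>i. f (r i) v :: nat))"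
  using assms
proof (induction V rule: finite_induct)
  case empty
  show ?case by (intro exI[of _ id]) (auto simp: strict_mono_def)
next
  case (insert v V)
  then obtain r where r: "strict_mono r" "\<forall>v\<in>V. incseq (\<lambda>i. f (r i) v)" by blast
  have "\<exists>s. strict_mono s \<and> incseq (\<lambda>i. f (r (s i)) v)"
  proof -
    obtain s where s: "strict_mono s" "monoseq (\<lambda>i. f (r (s i)) v)"
      using seq_monosub[of "\<lambda>i. f (r i) v"] by auto
    define g where "g = (\<lambda>i. f (r (s i)) v)"
    show ?thesis
    proof (cases "incseq g")
      case False
      with s(2) have dec: "decseq g" by (auto simp: monoseq_iff g_def)
      define i0 where "i0 = (ARG_MIN g i. True)"
      have min: "g i0 \<le> g i" for i
        unfolding i0_def by (rule arg_min_nat_le) simp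
      then have "g (i + i0) = g i0" for i
        using decseqD[OF dec, of i0 "i + i0"] min[of "i + i0"] by simp
      then have "incseq (\<lambda>i. f (r (s (i + i0))) v)"
        by (simp add: g_def incseq_def)
      moreover have "strict_mono (\<lambda>i. s (i + i0))"
        using s(1) by (simp add: strict_mono_def)
      ultimately show ?thesis by (intro exI[of _ "\<lambda>i. s (i + i0)"] conjI)
    qed (use s in \<open>auto simp: g_def\<close>)
  qed
  then obtain s where s: "strict_mono s" "incseq (\<lambda>i. f (r (s i)) v)" by blast
  have "incseq (\<lambda>i. f (r (s i)) w)" if "w \<in> V" for w
    using r(2) that s(1) unfolding incseq_def by (meson strict_mono_less_eq)
  then show ?case
    using r(1) s by (intro exI[of _ "r \<circ> s"]) (auto simp: strict_mono_def)
qed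

text \<open>A sequence of elements with minimal leading monomial among those not generated so far has, by
  Dickson's lemma, a member whose leading monomial can be cancelled by an earlier one.\<close>

lemma hilbert_basis:
  fixes K :: "'k::field itself" and J :: "('v, 'k) mpoly set"
  assumes "finite V" and J: "pideal V J"
  shows "\<exists>A\<subseteq>J. finite A \<and> J = Idl\<^bsub>mpoly_ring K V\<^esub> A"
proof (rule ccontr)
  assume neg: "\<not> ?thesis"
  let ?I = "\<lambda>A. Idl\<^bsub>mpoly_ring K V\<^esub> A"
  obtain vs where vs: "set vs = V" using assms(1) finite_list by blast
  define lm where "lm = (\<lambda>p :: ('v, 'k) mpoly. SOME m. is_lead vs p m)"
  have J_polys: "J \<subseteq> polys V" using J by (simp add: pideal_def)
  have I_ideal: "pideal V (?I A)" and I_sub: "A \<subseteq> ?I A" if "A \<subseteq> J" for A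
    using that J_polys pideal_genideal genideal_mpoly_subset by (metis subset_trans)+
  have lm: "is_lead vs p (lm p)" if "p \<in> J" "p \<noteq> 0" for p
    unfolding lm_def using exists_lead[of p vs] that J_polys vs by (metis subsetD someI_ex)
  define Good where "Good = (\<lambda>A p. p \<in> J - ?I A \<and> (\<forall>q\<in>J - ?I A. \<not> mlt vs (lm q) (lm p)))"
  have ex: "\<exists>p. Good A p" if "A \<subseteq> J" "finite A" for A
  proof -
    have "?I A \<subseteq> J" using genideal_mpoly_minimal[OF J that(1)] .
    then have "J - ?I A \<noteq> {}" using neg that by blast
    then obtain m where "m \<in> lm ` (J - ?I A)" "\<And>n. mlt vs n m \<Longrightarrow> n \<notin> lm ` (J - ?I A)"
      using wfp_mlt[of vs] unfolding wfp_eq_minimal by (metis image_is_empty ex_in_conv)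
    then show ?thesis unfolding Good_def by blast
  qed
  define A where "A = rec_nat {} (\<lambda>_ B. insert (SOME p. Good B p) B)"
  define f where "f i = (SOME p. Good (A i) p)" for i
  have A_Suc: "A (Suc i) = insert (f i) (A i)" and A_0: "A 0 = {}" for i
    by (simp_all add: A_def f_def)
  have A: "A i \<subseteq> J \<and> finite (A i)" for i
  proof (induction i)
    case (Suc i)
    then have "Good (A i) (f i)" unfolding f_def using ex someI_ex by metis
    then show ?case using Suc by (auto simp: A_Suc Good_def)
  qed (simp add: A_0)
  have good: "Good (A i) (f i)" for i
    unfolding f_def using ex A someI_ex by metis
  have fJ: "f i \<in> J" and fI: "f i \<notin> ?I (A i)" for i
    using good by (auto simp: Good_def)
  have f0: "f i \<noteq> 0" for i
    using fI[of i] I_ideal[of "A i"] A by (auto simp: pideal_def)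
  have A_mono: "i < j \<Longrightarrow> f i \<in> A j" for i j
    by (induction j) (auto simp: A_Suc less_Suc_eq)
  obtain r where r: "strict_mono r" "\<forall>v\<in>V. incseq (\<lambda>i. lookup (lm (f (r i))) v)"
    using dickson[OF assms(1), of "\<lambda>i. lookup (lm (f i))"] by blast
  define i j where "i = r 0" and "j = r 1"
  have "i < j" using r(1) by (simp add: i_def j_def strict_mono_def)
  define a b where "a = lm (f i)" and "b = lm (f j)"
  have lead_a: "is_lead vs (f i) a" and lead_b: "is_lead vs (f j) b"
    using lm[OF fJ f0] by (simp_all add: a_def b_def)
  have ab_keys: "keys a \<subseteq> V" "keys b \<subseteq> V"
    using lead_a lead_b fJ[of i] fJ[of j] J_polys by (auto simp: is_lead_def polys_def)
  have le: "lookup a v \<le> lookup b v" for v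
  proof (cases "v \<in> V")
    case True
    then show ?thesis using r(2) by (simp add: a_def b_def i_def j_def incseq_def)
  next
    case False
    then have "lookup a v = 0" using ab_keys(1) by (auto simp: in_keys_iff)
    then show ?thesis by simp
  qed
  define t where "t = b - a"
  have b: "b = a + t"
    unfolding t_def using le by (intro poly_mapping_eqI) (simp add: lookup_add lookup_minus)
  have t_keys: "keys t \<subseteq> V" using ab_keys by (auto simp: b keys_add_nat)
  \<comment> \<open>The multiple \<open>h\<close> of the earlier \<open>f i\<close> cancels the
    leading term of \<open>f j\<close>. As \<open>h\<close> lies in the ideal of \<open>A j\<close>,
    the difference \<open>g\<close> stays outside it, and its smaller leading exponent contradicts
    the choice of \<open>f j\<close>.\<close>
  define c where "c = lookup (f j) b / lookup (f i) a"
  define h where "h = scal c (monomial t * f i)"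
  define g where "g = f j - h"
  have h_in: "h \<in> L" if "pideal V L" "f i \<in> L" for L
    unfolding h_def using that t_keys by (intro pideal_scal pideal_mult_left) auto
  have "g \<in> J" unfolding g_def using pideal_diff[OF J fJ h_in[OF J fJ]] .
  have "g \<notin> ?I (A j)"
  proof
    assume "g \<in> ?I (A j)"
    moreover have "h \<in> ?I (A j)"
      using h_in[of "?I (A j)"] I_ideal[of "A j"] I_sub[of "A j"] A[of j] A_mono[OF \<open>i < j\<close>] by auto
    ultimately have "g + h \<in> ?I (A j)"
      using I_ideal[of "A j"] A[of j] by (simp add: pideal_add)
    then show False using fI[of j] by (simp add: g_def)
  qed
  then have "g \<noteq> 0" using I_ideal[of "A j"] A by (auto simp: pideal_def)
  have lg: "is_lead vs g (lm g)" using lm[OF \<open>g \<in> J\<close> \<open>g \<noteq> 0\<close>] .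
  have lead_t: "is_lead vs (monomial t) t" by (simp add: is_lead_def)
  have "lm g \<noteq> b"
  proof
    assume "lm g = b"
    have "lookup (monomial t * f i) (t + a) = lookup (f i) a"
      using lookup_mult_lead[OF lead_t lead_a] by (simp add: mpoly_monomial_def)
    then have "lookup g b = 0"
      using lead_a unfolding g_def h_def
      by (simp add: lookup_minus lookup_scal c_def b add.commute is_lead_def in_keys_iff)
    then show False using lg \<open>lm g = b\<close> by (simp add: is_lead_def in_keys_iff)
  qed
  moreover have "n = b \<or> mlt vs n b" if "n \<in> keys g" for n
  proof -
    have "n \<in> keys (f j) \<or> n \<in> keys (monomial t * f i)"
      using that unfolding g_def h_def by (auto simp: in_keys_iff lookup_minus lookup_scal)
    then show ?thesis
    proof
      assume "n \<in> keys (monomial t * f i)"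
      then obtain m where m: "n = t + m" "m \<in> keys (f i)"
        using keys_mult[of "monomial t" "f i"] by auto
      then have "m = a \<or> mlt vs m a" using lead_a by (simp add: is_lead_def)
      then show ?thesis
        using mlt_add_right[of vs m a t] by (auto simp: m b add.commute)
    qed (use lead_b in \<open>simp add: is_lead_def\<close>)
  qed
  ultimately have "mlt vs (lm g) b" using lg by (auto simp: is_lead_def)
  then show False
    using good[of j] \<open>g \<in> J\<close> \<open>g \<notin> ?I (A j)\<close> by (auto simp: Good_def b_def)
qed

lemma noetherian_mpoly_ring: "finite V \<Longrightarrow> noetherian_ring (mpoly_ring K V)"
proof (rule ring.noetherian_ringI[OF ring_mpoly_ring])
  fix J assume "finite V" "ideal J (mpoly_ring K V)"
  then have J: "pideal V J" by (simp add: ideal_mpoly_ring_iff)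
  then show "\<exists>A\<subseteq>carrier (mpoly_ring K V). finite A \<and> J = Idl\<^bsub>mpoly_ring K V\<^esub> A"
    using hilbert_basis[OF \<open>finite V\<close> J, of K] by (auto simp: pideal_def)
qed

section \<open>Quotient rings\<close>

lemma (in ring) carrier_Quot: "carrier (R Quot I) = (+>) I ` carrier R"
  unfolding FactRing_def A_RCOSETS_def' by auto

text \<open>Allows regularity in a quotient to be checked in the ring itself. One direction uses
  that the preimage of an ideal is an ideal containing \<open>I \<union> S\<close>, the other that
  the image of \<open>Idl (I \<union> S)\<close> is an ideal of the quotient.\<close>

lemma (in ring) rcos_in_genideal_iff:
  assumes I: "ideal I R" and S: "S \<subseteq> carrier R" and a: "a \<in> carrier R"
  shows "I +> a \<in> Idl\<^bsub>R Quot I\<^esub> ((+>) I ` S) \<longleftrightarrow> a \<in> Idl (I \<union> S)"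
proof -
  interpret I: ideal I R by (rule I)
  interpret Q: ring "R Quot I" by (rule I.quotient_is_ring)
  have sub: "I \<union> S \<subseteq> carrier R" using S I.a_subset by blast
  have IS: "ideal (Idl (I \<union> S)) R" by (rule genideal_ideal[OF sub])
  have I_le: "I \<subseteq> Idl (I \<union> S)" and S_le: "S \<subseteq> Idl (I \<union> S)"
    using genideal_self[OF sub] by auto
  have S_carr: "(+>) I ` S \<subseteq> carrier (R Quot I)"
    using S by (auto simp: carrier_Quot)
  show ?thesis
  proof
    assume "a \<in> Idl (I \<union> S)"
    moreover have "Idl (I \<union> S) \<subseteq> {r \<in> carrier R. I +> r \<in> Idl\<^bsub>R Quot I\<^esub> ((+>) I ` S)}"
    proof (rule genideal_minimal)
      have Qi: "ideal (Idl\<^bsub>R Quot I\<^esub> ((+>) I ` S)) (R Quot I)"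
        by (rule Q.genideal_ideal[OF S_carr])
      then show "ideal {r \<in> carrier R. I +> r \<in> Idl\<^bsub>R Quot I\<^esub> ((+>) I ` S)} R"
        by (rule ring_hom_ring.ideal_vimage[OF I.rcos_ring_hom_ring])
      have "I +> r \<in> Idl\<^bsub>R Quot I\<^esub> ((+>) I ` S)" if "r \<in> I" for r
      proof -
        have "I +> r = \<zero>\<^bsub>R Quot I\<^esub>"
          using a_coset_join2[OF _ _ that] I.Icarr[OF that] I.a_subgroup
          by (simp add: FactRing_def)
        then show ?thesis
          using additive_subgroup.zero_closed[OF ideal.axioms(1)[OF Qi]] by simp
      qed
      then show "I \<union> S \<subseteq> {r \<in> carrier R. I +> r \<in> Idl\<^bsub>R Quot I\<^esub> ((+>) I ` S)}"
        using Q.genideal_self[OF S_carr] sub by auto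
    qed
    ultimately show "I +> a \<in> Idl\<^bsub>R Quot I\<^esub> ((+>) I ` S)" by auto
  next
    assume *: "I +> a \<in> Idl\<^bsub>R Quot I\<^esub> ((+>) I ` S)"
    have "Idl\<^bsub>R Quot I\<^esub> ((+>) I ` S) \<subseteq> (+>) I ` (Idl (I \<union> S))"
      using S_le by (intro Q.genideal_minimal[OF ring_ideal_imp_quot_ideal[OF I IS]]) auto
    with * obtain b where b: "b \<in> Idl (I \<union> S)" "I +> a = I +> b" by auto
    then have b_carr: "b \<in> carrier R" using ideal.Icarr[OF IS] by auto
    have "a \<ominus> b \<in> I"
      using quotient_eq_iff_same_a_r_cos[OF I a b_carr] b(2) by simp
    then have "(a \<ominus> b) \<oplus> b \<in> Idl (I \<union> S)"
      using I_le b(1) additive_subgroup.a_closed[OF ideal.axioms(1)[OF IS]] by auto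
    moreover have "(a \<ominus> b) \<oplus> b = a"
      using a b_carr by algebra
    ultimately show "a \<in> Idl (I \<union> S)" by simp
  qed
qed

lemma (in noetherian_ring) noetherian_Quot:
  assumes I: "ideal I R"
  shows "noetherian_ring (R Quot I)"
proof -
  interpret I: ideal I R by (rule I)
  interpret Q: ring "R Quot I" by (rule I.quotient_is_ring)
  show ?thesis
  proof (rule Q.noetherian_ringI)
    fix J assume J: "ideal J (R Quot I)"
    let ?J = "{r \<in> carrier R. I +> r \<in> J}"
    have J': "ideal ?J R"
      by (rule ring_hom_ring.ideal_vimage[OF I.rcos_ring_hom_ring J])
    then obtain A where A: "A \<subseteq> carrier R" "finite A" "?J = Idl A"
      using finetely_gen by blast
    have A_J: "A \<subseteq> ?J" using genideal_self[OF A(1)] A(3) by simp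
    have "J = Idl\<^bsub>R Quot I\<^esub> ((+>) I ` A)"
    proof
      show "Idl\<^bsub>R Quot I\<^esub> ((+>) I ` A) \<subseteq> J"
        using A_J by (intro Q.genideal_minimal[OF J]) auto
      show "J \<subseteq> Idl\<^bsub>R Quot I\<^esub> ((+>) I ` A)"
      proof
        fix x assume x: "x \<in> J"
        then obtain r where r: "r \<in> carrier R" "x = I +> r"
          using ideal.Icarr[OF J] by (auto simp: carrier_Quot)
        then have "r \<in> Idl A" using x A(3) by auto
        then have "r \<in> Idl (I \<union> A)"
          using subset_Idl_subset[of "I \<union> A" A] A(1) I.a_subset by auto
        then show "x \<in> Idl\<^bsub>R Quot I\<^esub> ((+>) I ` A)"
          using rcos_in_genideal_iff[OF I A(1) r(1)] r(2) by simp
      qed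
    qed
    then show "\<exists>B\<subseteq>carrier (R Quot I). finite B \<and> J = Idl\<^bsub>R Quot I\<^esub> B"
      using A(1,2) by (intro exI[of _ "(+>) I ` A"]) (auto simp: carrier_Quot)
  qed
qed

section \<open>Krull dimension of quotients of polynomial rings\<close>

text \<open>A dimension count for families instead of sets: a repeated vector gives the relation
  \<open>r i - r j = 0\<close>, which has to be treated separately.\<close>

lemma (in vector_space) exists_linear_relation:
  assumes "finite I" "finite G" "card G < card I" and r: "\<And>i. i \<in> I \<Longrightarrow> r i \<in> span G"
  shows "\<exists>c. (\<exists>i\<in>I. c i \<noteq> 0) \<and> (\<Sum>i\<in>I. scale (c i) (r i)) = 0"
proof (cases "inj_on r I")
  case True
  have "dependent (r ` I)"
  proof (rule ccontr)
    assume "independent (r ` I)"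
    then have "card (r ` I) \<le> card G"
      using independent_span_bound[OF assms(2)] r by blast
    then show False using assms(3) card_image[OF True] by simp
  qed
  then obtain u where u: "\<exists>v\<in>r ` I. u v \<noteq> 0" "(\<Sum>v\<in>r ` I. scale (u v) v) = 0"
    using dependent_finite[of "r ` I"] assms(1) by auto
  then show ?thesis
    by (intro exI[of _ "\<lambda>i. u (r i)"]) (auto simp: sum.reindex[OF True])
next
  case False
  then obtain i j where ij: "i \<in> I" "j \<in> I" "i \<noteq> j" "r i = r j"
    by (auto simp: inj_on_def)
  define c where "c k = (if k = i then 1 else if k = j then - 1 else (0::'a))" for k
  have "(\<Sum>k\<in>I. scale (c k) (r k)) = (\<Sum>k\<in>{i,j}. scale (c k) (r k))"
    by (rule sum.mono_neutral_right) (use assms(1) ij in \<open>auto simp: c_def\<close>)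
  also have "\<dots> = 0" using ij by (simp add: c_def)
  finally show ?thesis using ij(1) by (intro exI[of _ c]) (auto simp: c_def)
qed

text \<open>Bounding each exponent separately, instead of the total degree, keeps the count a plain
  power, as the comparison in \<open>algebraically_dependent\<close> requires.\<close>

definition exponent_box :: "'v set \<Rightarrow> nat \<Rightarrow> ('v \<Rightarrow>\<^sub>0 nat) set" where
  "exponent_box W k = {m. keys m \<subseteq> W \<and> (\<forall>v. lookup m v \<le> k)}"

lemma exponent_box_card:
  assumes "finite W"
  shows "finite (exponent_box W k)" "card (exponent_box W k) \<le> (k + 1) ^ card W"
proof -
  let ?f = "\<lambda>m. restrict (lookup m) W"
  have inj: "inj_on ?f (exponent_box W k)"
  proof (rule inj_onI)
    fix m n assume mn: "m \<in> exponent_box W k" "n \<in> exponent_box W k" and eq: "?f m = ?f n"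
    show "m = n"
    proof (rule poly_mapping_eqI)
      fix v
      show "lookup m v = lookup n v"
      proof (cases "v \<in> W")
        case True
        then show ?thesis using fun_cong[OF eq, of v] by simp
      next
        case False
        then have "v \<notin> keys m" "v \<notin> keys n"
          using mn by (auto simp: exponent_box_def)
        then show ?thesis by (simp add: in_keys_iff)
      qed
    qed
  qed
  have sub: "?f ` exponent_box W k \<subseteq> PiE W (\<lambda>_. {..k})"
    by (auto simp: exponent_box_def)
  have fin: "finite (PiE W (\<lambda>_. {..k}))"
    using assms by (intro finite_PiE) auto
  show "finite (exponent_box W k)"
    using inj_on_finite[OF inj sub fin] .
  show "card (exponent_box W k) \<le> (k + 1) ^ card W"
    using card_inj_on_le[OF inj sub fin] by (simp add: card_PiE[OF assms])
qed

definition exponents_le :: "nat \<Rightarrow> ('v, 'k::field) mpoly \<Rightarrow> bool" where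
  "exponents_le k p \<longleftrightarrow> (\<forall>m\<in>keys p. \<forall>v. lookup m v \<le> k)"

lemma exponents_le_mono: "exponents_le k p \<Longrightarrow> k \<le> l \<Longrightarrow> exponents_le l p"
  unfolding exponents_le_def using le_trans by blast

lemma exponents_le_one: "exponents_le 0 1"
  by (simp add: exponents_le_def)

lemma exponents_le_mult:
  assumes "exponents_le k p" "exponents_le l q"
  shows "exponents_le (k + l) (p * q)"
  unfolding exponents_le_def
proof (intro ballI allI)
  fix m v assume "m \<in> keys (p * q)"
  then obtain a b where "m = a + b" "a \<in> keys p" "b \<in> keys q"
    using keys_mult[of p q] by blast
  then show "lookup m v \<le> k + l"
    using assms by (auto simp: exponents_le_def lookup_add intro: add_mono)
qed

lemma exponents_le_power: "exponents_le k p \<Longrightarrow> exponents_le (n * k) (p ^ n)"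
  by (induction n) (auto simp: exponents_le_one exponents_le_mult)

lemma exponents_le_prod:
  "(\<And>i. i \<in> A \<Longrightarrow> exponents_le k (f i)) \<Longrightarrow> exponents_le (card A * k) (prod f A)"
  by (induction A rule: infinite_finite_induct) (auto simp: exponents_le_one exponents_le_mult)

lemma exists_exponents_le: "\<exists>k. exponents_le k p"
proof -
  have "\<exists>k. \<forall>m\<in>A. \<forall>v. lookup m v \<le> k" if "finite A" for A :: "('v \<Rightarrow>\<^sub>0 nat) set"
    using that
  proof (induction A)
    case (insert m A)
    then obtain k where k: "\<forall>m\<in>A. \<forall>v. lookup m v \<le> k" by blast
    have "lookup m v \<le> exponent_degree m" for v
    proof (cases "v \<in> keys m")
      case True
      then show ?thesis unfolding exponent_degree_def by (intro member_le_sum) auto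
    qed (simp add: in_keys_iff)
    then show ?case
      using k by (intro exI[of _ "max k (exponent_degree m)"]) (auto simp: le_max_iff_disj)
  qed auto
  then show ?thesis unfolding exponents_le_def by (metis finite_keys)
qed

lemma in_span_exponent_box:
  assumes "p \<in> polys W" "exponents_le k p"
  shows "p \<in> mp.span (monomial ` exponent_box W k)"
proof -
  have "keys p \<subseteq> exponent_box W k"
    using assms by (auto simp: exponent_box_def polys_def exponents_le_def)
  then show ?thesis
    using poly_in_span_monomials[of p] mp.span_mono[OF image_mono] by blast
qed

text \<open>Counting: the number of products with all exponents at most \<open>N\<close> grows like
  the m-th power of \<open>N\<close>, while the space that contains them grows only like the power
  with exponent \<open>card W\<close>. The exponent functions are extensional, so distinct ones
  differ somewhere below \<open>m\<close>.\<close>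

lemma algebraically_dependent:
  assumes "finite W" "card W < m" and b: "\<And>i. i < m \<Longrightarrow> b i \<in> polys W"
  shows "\<exists>F c. finite F \<and> F \<noteq> {} \<and> F \<subseteq> PiE {..<m} (\<lambda>_. UNIV) \<and> (\<forall>u\<in>F. c u \<noteq> 0) \<and>
    (\<Sum>u\<in>F. scal (c u) (\<Prod>i<m. b i ^ u i)) = 0"
proof -
  define n where "n = card W"
  have "\<exists>k. \<forall>i<m. exponents_le k (b i)"
  proof -
    define k where "k i = (SOME k. exponents_le k (b i))" for i
    have "exponents_le (k i) (b i)" for i
      unfolding k_def by (rule someI_ex[OF exists_exponents_le])
    then have "\<forall>i<m. exponents_le (\<Sum>i<m. k i) (b i)"
      by (meson exponents_le_mono finite_lessThan lessThan_iff member_le_sum zero_le)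
    then show ?thesis by blast
  qed
  then obtain k where k: "\<And>i. i < m \<Longrightarrow> exponents_le k (b i)" by blast
  \<comment> \<open>Chosen so that the box has at most
    \<open>((m * k + 1) * (N + 1)) ^ n = N * (N + 1) ^ n\<close> elements, which is less than
    \<open>(N + 1) ^ Suc n\<close>.\<close>
  define N where "N = (m * k + 1) ^ n"
  define I where "I = PiE {..<m} (\<lambda>_. {..N})"
  define G :: "('a, 'b) mpoly set" where "G = monomial ` exponent_box W (m * (N * k))"
  have fin_I: "finite I" unfolding I_def by (intro finite_PiE) auto
  have card_I: "card I = (N + 1) ^ m" by (simp add: I_def card_PiE)
  have fin_G: "finite G" using exponent_box_card[OF assms(1)] by (simp add: G_def)
  have "card G \<le> card (exponent_box W (m * (N * k)))"
    unfolding G_def using exponent_box_card[OF assms(1)] by (intro card_image_le)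
  also have "\<dots> \<le> (m * (N * k) + 1) ^ n"
    using exponent_box_card[OF assms(1)] by (simp add: n_def)
  also have "\<dots> \<le> ((m * k + 1) * (N + 1)) ^ n"
    by (intro power_mono) (auto simp: algebra_simps)
  also have "\<dots> = N * (N + 1) ^ n"
    unfolding power_mult_distrib by (simp add: N_def)
  also have "\<dots> < (N + 1) * (N + 1) ^ n" by simp
  also have "\<dots> = (N + 1) ^ Suc n" by simp
  also have "\<dots> \<le> (N + 1) ^ m"
    using assms(2) by (intro power_increasing) (auto simp: n_def)
  finally have "card G < card I" by (simp add: card_I)
  moreover have "(\<Prod>i<m. b i ^ u i) \<in> mp.span G" if "u \<in> I" for u
  proof -
    have "exponents_le (N * k) (b i ^ u i)" if "i < m" for i
      using exponents_le_power[OF k[OF that], of "u i"] \<open>u \<in> I\<close> that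
      by (elim exponents_le_mono) (auto simp: I_def PiE_def Pi_def)
    then have "exponents_le (m * (N * k)) (\<Prod>i<m. b i ^ u i)"
      using exponents_le_prod[of "{..<m}" "N * k" "\<lambda>i. b i ^ u i"] by simp
    moreover have "(\<Prod>i<m. b i ^ u i) \<in> polys W" using b by (intro polys_prod polys_power) auto
    ultimately show ?thesis unfolding G_def by (intro in_span_exponent_box)
  qed
  ultimately obtain c where c: "\<exists>u\<in>I. c u \<noteq> 0" "(\<Sum>u\<in>I. scal (c u) (\<Prod>i<m. b i ^ u i)) = 0"
    using mp.exists_linear_relation[OF fin_I fin_G, of "\<lambda>u. \<Prod>i<m. b i ^ u i"] by blast
  define F where "F = {u\<in>I. c u \<noteq> 0}"
  have "(\<Sum>u\<in>F. scal (c u) (\<Prod>i<m. b i ^ u i)) = 0"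
    unfolding c(2)[symmetric] by (rule sum.mono_neutral_left) (use fin_I in \<open>auto simp: F_def\<close>)
  moreover have "F \<noteq> {}" "finite F" "F \<subseteq> PiE {..<m} (\<lambda>_. UNIV)"
    using c(1) fin_I by (auto simp: F_def) (auto simp: I_def PiE_def Pi_def extensional_def)
  ultimately show ?thesis
    by (intro exI[of _ F] exI[of _ c]) (auto simp: F_def)
qed

section \<open>Length of chains of primes\<close>

definition prime_pideal :: "'v set \<Rightarrow> ('v, 'k::field) mpoly set \<Rightarrow> bool" where
  "prime_pideal V P \<longleftrightarrow> pideal V P \<and> 1 \<notin> P \<and>
    (\<forall>p\<in>polys V. \<forall>q\<in>polys V. p * q \<in> P \<longrightarrow> p \<in> P \<or> q \<in> P)"

lemma prime_pideal_power: "prime_pideal V P \<Longrightarrow> p \<in> polys V \<Longrightarrow> p ^ n \<in> P \<Longrightarrow> p \<in> P"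
  by (induction n) (auto simp: prime_pideal_def)

lemma prime_pideal_prod:
  assumes "prime_pideal V P" "finite A" "\<And>i. i \<in> A \<Longrightarrow> f i \<in> polys V" "prod f A \<in> P"
  shows "\<exists>i\<in>A. f i \<in> P"
  using assms(2-4)
proof (induction A)
  case (insert a A)
  then have "f a \<in> P \<or> prod f A \<in> P"
    using assms(1) by (auto simp: prime_pideal_def intro!: polys_prod)
  then show ?case using insert by auto
qed (use assms(1) in \<open>auto simp: prime_pideal_def\<close>)

text \<open>Elements \<open>b i \<in> P (i + 1) - P i\<close> of a chain of primes are algebraically independent: dividing a
  polynomial relation by the lowest power of \<open>b j\<close> and passing to \<open>P (j + 1)\<close> leaves a nontrivial
  relation between the later ones.\<close>

lemma chain_algebraically_independent:
  assumes P: "\<And>i. i \<le> m \<Longrightarrow> prime_pideal V (P i)" "\<And>i. i < m \<Longrightarrow> P i \<subseteq> P (Suc i)"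
    and b: "\<And>i. i < m \<Longrightarrow> b i \<in> P (Suc i) - P i"
    and "j \<le> m" "finite F" "F \<noteq> {}" "inj_on (\<lambda>u. restrict u {j..<m}) F" "\<And>u. u \<in> F \<Longrightarrow> c u \<noteq> 0"
  shows "(\<Sum>u\<in>F. scal (c u) (\<Prod>i\<in>{j..<m}. b i ^ u i)) \<notin> P j"
  using assms(4-)
proof (induction j arbitrary: F rule: inc_induct)
  case base
  \<comment> \<open>Restriction to the empty interval identifies all functions, so injectivity
    leaves one term only. The sum is then a nonzero constant, which a prime cannot contain.\<close>
  then obtain u where F: "F = {u}"
    by (auto simp: inj_on_def)
  show ?case
  proof
    assume "(\<Sum>u\<in>F. scal (c u) (\<Prod>i\<in>{m..<m}. b i ^ u i)) \<in> P m"
    then have "scal (inverse (c u)) (scal (c u) 1) \<in> P m"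
      using P(1)[of m] by (intro pideal_scal[of V "P m" "scal (c u) 1"]) (auto simp: F prime_pideal_def)
    moreover have "c u \<noteq> 0" using base.prems(4) by (simp add: F)
    ultimately show False using P(1)[of m] by (simp add: prime_pideal_def)
  qed
next
  case (step j)
  have bp: "b i \<in> polys V" if "i < m" for i
    using b[OF that] P(1)[of "Suc i"] that by (auto simp: prime_pideal_def dest: pideal_carrier)
  define \<mu> where "\<mu> = Min ((\<lambda>u. u j) ` F)"
  define F1 where "F1 = {u\<in>F. u j = \<mu>}"
  have \<mu>_le: "\<mu> \<le> u j" if "u \<in> F" for u
    unfolding \<mu>_def using that step.prems(1) by simp
  have "\<mu> \<in> (\<lambda>u. u j) ` F"
    unfolding \<mu>_def using step.prems(1,2) by (intro Min_in) auto
  then have F1: "finite F1" "F1 \<noteq> {}" "F1 \<subseteq> F"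
    using step.prems(1) by (auto simp: F1_def)
  define R where "R u = (\<Prod>i\<in>{Suc j..<m}. b i ^ u i)" for u
  define S where "S = (\<Sum>u\<in>F. scal (c u) (b j ^ (u j - \<mu>) * R u))"
  \<comment> \<open>After division by \<open>b j ^ \<mu>\<close>, the terms in \<open>S1\<close> no
    longer contain \<open>b j\<close>, and the remaining ones add up to \<open>b j * S2\<close>,
    which vanishes modulo \<open>P (Suc j)\<close>.\<close>
  define S1 where "S1 = (\<Sum>u\<in>F1. scal (c u) (R u))"
  define S2 where "S2 = (\<Sum>u\<in>F - F1. scal (c u) (b j ^ (u j - \<mu> - 1) * R u))"
  have R: "R u \<in> polys V" for u unfolding R_def using bp by (intro polys_prod polys_power) auto
  have S_polys: "S \<in> polys V" "S2 \<in> polys V"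
    unfolding S_def S2_def using R bp[of j] step.hyps by (intro polys_sum polys_scal polys_mult polys_power; simp)+
  have "(\<Sum>u\<in>F. scal (c u) (\<Prod>i\<in>{j..<m}. b i ^ u i)) = b j ^ \<mu> * S"
    unfolding S_def sum_distrib_left
  proof (rule sum.cong[OF refl])
    fix u assume u: "u \<in> F"
    have "(\<Prod>i\<in>{j..<m}. b i ^ u i) = b j ^ u j * R u"
      unfolding R_def using step.hyps by (simp add: prod.atLeast_Suc_lessThan)
    also have "b j ^ u j = b j ^ \<mu> * b j ^ (u j - \<mu>)"
      using \<mu>_le[OF u] by (simp flip: power_add)
    finally show "scal (c u) (\<Prod>i\<in>{j..<m}. b i ^ u i) = b j ^ \<mu> * scal (c u) (b j ^ (u j - \<mu>) * R u)"
      by (simp add: mult.assoc)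
  qed
  moreover have "S = S1 + b j * S2"
  proof -
    have "S = (\<Sum>u\<in>F1. scal (c u) (b j ^ (u j - \<mu>) * R u)) + (\<Sum>u\<in>F - F1. scal (c u) (b j ^ (u j - \<mu>) * R u))"
      unfolding S_def using F1(3) step.prems(1) by (simp add: sum.subset_diff[of F1 F] add.commute)
    also have "(\<Sum>u\<in>F1. scal (c u) (b j ^ (u j - \<mu>) * R u)) = S1"
      unfolding S1_def by (intro sum.cong) (auto simp: F1_def)
    also have "(\<Sum>u\<in>F - F1. scal (c u) (b j ^ (u j - \<mu>) * R u)) = b j * S2"
      unfolding S2_def sum_distrib_left
    proof (rule sum.cong[OF refl])
      fix u assume "u \<in> F - F1"
      then have "u j - \<mu> = Suc (u j - \<mu> - 1)"
        using \<mu>_le[of u] by (auto simp: F1_def)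
      then have "b j ^ (u j - \<mu>) = b j * b j ^ (u j - \<mu> - 1)"
        by (metis power_Suc)
      then show "scal (c u) (b j ^ (u j - \<mu>) * R u) = b j * scal (c u) (b j ^ (u j - \<mu> - 1) * R u)"
        by (simp add: mult.assoc)
    qed
    finally show ?thesis .
  qed
  moreover have "S1 \<notin> P (Suc j)"
    unfolding S1_def R_def
  proof (rule step.IH)
    show "inj_on (\<lambda>u. restrict u {Suc j..<m}) F1"
    proof (rule inj_onI)
      fix u w assume ab: "u \<in> F1" "w \<in> F1" "restrict u {Suc j..<m} = restrict w {Suc j..<m}"
      have "u i = w i" if "i \<in> {j..<m}" for i
      proof (cases "i = j")
        case False
        then show ?thesis using fun_cong[OF ab(3), of i] that by auto
      qed (use ab in \<open>auto simp: F1_def\<close>)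
      then have "restrict u {j..<m} = restrict w {j..<m}" by auto
      then show "u = w" using inj_onD[OF step.prems(3), of u w] ab(1,2) F1(3) by blast
    qed
  qed (use F1 step.prems in auto)
  moreover have "b j * S2 \<in> P (Suc j)"
    using P(1)[of "Suc j"] b[of j] step.hyps S_polys by (auto simp: prime_pideal_def intro: pideal_mult_right)
  moreover have "S \<in> P (Suc j)" if "b j ^ \<mu> * S \<in> P j"
  proof -
    have "b j ^ \<mu> \<in> P j \<or> S \<in> P j"
      using that P(1)[of j] step.hyps S_polys bp[of j] by (auto simp: prime_pideal_def)
    moreover have "b j ^ \<mu> \<notin> P j"
      using prime_pideal_power[of V "P j" "b j"] P(1)[of j] step.hyps bp[of j] b[of j] by auto
    ultimately show ?thesis using P(2)[of j] step.hyps by auto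
  qed
  ultimately show ?case
    using pideal_diff[of V "P (Suc j)" S "b j * S2"] P(1)[of "Suc j"] step.hyps
    by (auto simp: prime_pideal_def)
qed

text \<open>Elements separating successive primes can be moved into \<open>polys W\<close> without
  leaving their classes modulo \<open>P 0\<close>. More than \<open>card W\<close> of them would
  satisfy a nontrivial relation, whose value 0 lies in \<open>P 0\<close>, against their
  independence along the chain.\<close>

lemma prime_chain_length_le:
  assumes P: "\<And>i. i \<le> m \<Longrightarrow> prime_pideal V (P i)" "\<And>i. i < m \<Longrightarrow> P i \<subset> P (Suc i)"
    and W: "finite W" "W \<subseteq> V" "\<And>p. p \<in> polys V \<Longrightarrow> \<exists>q\<in>polys W. p - q \<in> P 0"
  shows "m \<le> card W"
proof (rule ccontr)
  assume "\<not> m \<le> card W"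
  have P0: "P 0 \<subseteq> P i" if "i \<le> m" for i
    using that
  proof (induction i)
    case (Suc i)
    then show ?case using P(2)[of i] by auto
  qed auto
  have "\<exists>b. b \<in> polys W \<and> b \<in> P (Suc i) - P i" if im: "i < m" for i
  proof -
    obtain a where a: "a \<in> P (Suc i)" "a \<notin> P i" using P(2)[OF im] by blast
    have id: "pideal V (P i)" "pideal V (P (Suc i))" using P(1) im by (auto simp: prime_pideal_def)
    then obtain q where q: "q \<in> polys W" "a - q \<in> P 0" using W(3) a(1) pideal_carrier by metis
    then have "a - q \<in> P i" "a - q \<in> P (Suc i)" using P0[of i] P0[of "Suc i"] im by auto
    then have "q \<in> P (Suc i)" "q \<notin> P i"
      using pideal_diff[OF id(2) a(1), of "a - q"] pideal_add[OF id(1), of "a - q" q] a(2) by auto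
    then show ?thesis using q(1) by blast
  qed
  then obtain b where b: "\<And>i. i < m \<Longrightarrow> b i \<in> polys W \<and> b i \<in> P (Suc i) - P i" by metis
  obtain F c where F: "finite F" "F \<noteq> {}" "F \<subseteq> PiE {..<m} (\<lambda>_. UNIV)" "\<forall>u\<in>F. c u \<noteq> 0"
    "(\<Sum>u\<in>F. scal (c u) (\<Prod>i<m. b i ^ u i)) = 0"
    using algebraically_dependent[of W m b] W(1) b \<open>\<not> m \<le> card W\<close> by auto
  have "inj_on (\<lambda>u. restrict u {0..<m}) F"
    using F(3) by (intro inj_onI) (metis PiE_restrict lessThan_atLeast0 subsetD)
  then have "(\<Sum>u\<in>F. scal (c u) (\<Prod>i\<in>{0..<m}. b i ^ u i)) \<notin> P 0"
    using chain_algebraically_independent[of m V P b 0 F c] P b F by auto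
  moreover have "0 \<in> P 0" using P(1)[of 0] by (auto simp: prime_pideal_def pideal_def)
  ultimately show False using F(5) by (simp add: lessThan_atLeast0)
qed

text \<open>Monomials that involve a variable from \<open>B\<close> already lie in \<open>J\<close>;
  dropping them from \<open>p\<close> gives \<open>q\<close>.\<close>

lemma eliminate_variables:
  fixes J :: "('v, 'k::field) mpoly set"
  assumes J: "pideal V J" and B: "\<And>v. v \<in> B \<Longrightarrow> v \<in> V \<and> var v \<in> J" and p: "p \<in> polys V"
  shows "\<exists>q\<in>polys (V - B). p - q \<in> J"
proof -
  have "\<exists>q\<in>polys (V - B). monomial m - q \<in> J" if m: "keys m \<subseteq> V" for m
  proof (cases "keys m \<inter> B = {}")
    case True
    then show ?thesis using m J by (intro bexI[of _ "monomial m"]) (auto simp: pideal_def)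
  next
    case False
    then obtain v where v: "v \<in> B" "v \<in> keys m" by blast
    define m' where "m' = m - single v 1"
    have "m = single v 1 + m'"
      unfolding m'_def using v(2)
      by (intro poly_mapping_eqI) (auto simp: lookup_add lookup_minus lookup_single when_def in_keys_iff)
    then have "(monomial m :: ('v, 'k) mpoly) = var v * monomial m'" and "keys m' \<subseteq> V"
      using m by (auto simp: mpoly_var_eq_monomial keys_add_nat simp flip: monomial_add)
    then have "monomial m \<in> J"
      using B[OF v(1)] pideal_mult_right[OF J, of "var v" "monomial m'"] by simp
    then show ?thesis by (intro bexI[of _ 0]) auto
  qed
  then obtain q where q: "\<And>m. keys m \<subseteq> V \<Longrightarrow> q m \<in> polys (V - B) \<and> monomial m - q m \<in> J"
    by metis
  define r where "r = (\<Sum>m\<in>keys p. scal (lookup p m) (q m))"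
  have "p - r = (\<Sum>m\<in>keys p. scal (lookup p m) (monomial m - q m))"
    unfolding r_def by (subst poly_eq_sum_monomials[of p]) (simp add: mp.scale_right_diff_distrib sum_subtractf)
  moreover have "\<dots> \<in> J"
    using p q by (intro pideal_sum[OF J] pideal_scal[OF J]) (auto simp: polys_def)
  moreover have "r \<in> polys (V - B)"
    unfolding r_def
  proof (intro polys_sum polys_scal)
    fix m assume "m \<in> keys p"
    then have "keys m \<subseteq> V" using p by (auto simp: polys_def)
    then show "q m \<in> polys (V - B)" using q by blast
  qed
  ultimately show ?thesis by (metis (no_types))
qed

text \<open>A chain in the quotient pulls back to a chain of primes over \<open>I\<close>. Its
  lowest member contains \<open>k\<close> variables, and the other \<open>card V - k\<close>
  variables suffice modulo that member.\<close>

lemma prime_height_Quot_le: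
  assumes "finite V" and I: "pideal V I"
    and B: "\<And>P. prime_pideal V P \<Longrightarrow> I \<subseteq> P \<Longrightarrow> \<exists>B\<subseteq>V. card B = k \<and> var ` B \<subseteq> P"
  shows "prime_height (mpoly_ring K V Quot I) M \<le> enat (card V - k)"
  unfolding prime_height_def
proof (rule Sup_least, safe)
  fix m Q assume chain: "prime_chain (mpoly_ring K V Quot I) M m Q"
  let ?\<pi> = "(+>\<^bsub>mpoly_ring K V\<^esub>) I"
  interpret R: cring "mpoly_ring K V" by (rule cring_mpoly_ring)
  interpret I: ideal I "mpoly_ring K V" using I by (simp add: ideal_mpoly_ring_iff)
  interpret h: ring_hom_cring "mpoly_ring K V" "mpoly_ring K V Quot I" ?\<pi>
    by (rule I.rcos_ring_hom_cring[OF cring_mpoly_ring])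
  define P where "P i = {r \<in> carrier (mpoly_ring K V). ?\<pi> r \<in> Q i}" for i
  have Q: "primeideal (Q i) (mpoly_ring K V Quot I)" if "i \<le> m" for i
    using chain that by (auto simp: prime_chain_def)
  have P: "prime_pideal V (P i)" if "i \<le> m" for i
  proof -
    interpret Q: primeideal "Q i" "mpoly_ring K V Quot I" by (rule Q[OF that])
    have "ideal (P i) (mpoly_ring K V)"
      unfolding P_def by (rule ring_hom_ring.ideal_vimage[OF I.rcos_ring_hom_ring Q.is_ideal])
    moreover have "\<one>\<^bsub>mpoly_ring K V Quot I\<^esub> \<notin> Q i"
      using Q.one_imp_carrier Q.I_notcarr by auto
    moreover have "p \<in> P i \<or> q \<in> P i" if "p \<in> polys V" "q \<in> polys V" "p * q \<in> P i" for p q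
      using that h.hom_mult[of p q] Q.I_prime[of "?\<pi> p" "?\<pi> q"] h.hom_closed by (auto simp: P_def)
    ultimately show ?thesis
      using h.hom_one by (auto simp: prime_pideal_def P_def ideal_mpoly_ring_iff)
  qed
  have strict: "P i \<subset> P (Suc i)" if "i < m" for i
  proof -
    have "Q i \<subset> Q (Suc i)" using chain that by (auto simp: prime_chain_def)
    then obtain x where x: "x \<in> Q (Suc i)" "x \<notin> Q i" by blast
    then have "x \<in> carrier (mpoly_ring K V Quot I)"
      using Q[of "Suc i"] that ideal.Icarr[OF primeideal.axioms(1)] by auto
    then obtain r where "r \<in> carrier (mpoly_ring K V)" "x = ?\<pi> r"
      by (auto simp: R.carrier_Quot)
    then have "r \<in> P (Suc i) - P i" using x by (simp add: P_def)
    then show ?thesis using \<open>Q i \<subset> Q (Suc i)\<close> by (auto simp: P_def)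
  qed
  have "I \<subseteq> P 0"
  proof
    fix r assume r: "r \<in> I"
    have "?\<pi> r = \<zero>\<^bsub>mpoly_ring K V Quot I\<^esub>"
      using R.a_coset_join2[OF _ I.a_subgroup r] I.Icarr[OF r] by (simp add: FactRing_def)
    moreover have "ideal (Q 0) (mpoly_ring K V Quot I)" using Q[of 0] primeideal.axioms(1) by auto
    ultimately show "r \<in> P 0"
      using I.Icarr[OF r] additive_subgroup.zero_closed[OF ideal.axioms(1)] by (simp add: P_def)
  qed
  then obtain B where B: "B \<subseteq> V" "card B = k" "var ` B \<subseteq> P 0"
    using B[OF P[of 0]] by auto
  have "m \<le> card (V - B)"
  proof (rule prime_chain_length_le[of m V P])
    show "prime_pideal V (P i)" if "i \<le> m" for i by (rule P[OF that])
    show "P i \<subset> P (Suc i)" if "i < m" for i by (rule strict[OF that])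
    show "\<exists>q\<in>polys (V - B). p - q \<in> P 0" if "p \<in> polys V" for p
      using eliminate_variables[of V "P 0" B p] P[of 0] B that by (auto simp: prime_pideal_def)
  qed (use assms(1) in auto)
  then show "enat m \<le> enat (card V - k)"
    using B assms(1) by (simp add: card_Diff_subset finite_subset)
qed

section \<open>Zariski's lemma\<close>

text \<open>Maximality expressed as invertibility modulo \<open>N\<close>, the form in which
  Zariski's lemma consumes it.\<close>

definition maximal_pideal :: "'v set \<Rightarrow> ('v, 'k::field) mpoly set \<Rightarrow> bool" where
  "maximal_pideal V N \<longleftrightarrow> pideal V N \<and> 1 \<notin> N \<and>
    (\<forall>h\<in>polys V. h \<notin> N \<longrightarrow> (\<exists>t\<in>polys V. t * h - 1 \<in> N))"

lemma maximalideal_mpoly_ring_imp: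
  fixes K :: "'k::field itself" and N :: "('v, 'k) mpoly set"
  assumes "maximalideal N (mpoly_ring K V)"
  shows "maximal_pideal V N"
proof -
  interpret maximalideal N "mpoly_ring K V" by (rule assms)
  have N: "pideal V N" using is_ideal by (simp add: ideal_mpoly_ring_iff)
  have one: "1 \<notin> N" using one_imp_carrier I_notcarr by auto
  have "\<exists>t\<in>polys V. t * h - 1 \<in> N" if h: "h \<in> polys V" "h \<notin> N" for h
  proof -
    define J where "J = {n + t * h |n t. n \<in> N \<and> t \<in> polys V}"
    have J: "pideal V J"
      unfolding pideal_def
    proof (intro conjI ballI)
      show "J \<subseteq> polys V" using N h by (auto simp: J_def pideal_def)
      have "0 + 0 * h \<in> J" unfolding J_def using N by (blast intro: polys_zero mp.subspace_0 pideal_subspace)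
      then show "0 \<in> J" by simp
      fix p q assume "p \<in> J" "q \<in> J"
      then obtain n t n' t' where *: "p = n + t * h" "q = n' + t' * h" "n \<in> N" "n' \<in> N" "t \<in> polys V" "t' \<in> polys V"
        by (auto simp: J_def)
      then have "p + q = (n + n') + (t + t') * h" by (simp add: algebra_simps)
      then show "p + q \<in> J" unfolding J_def using * pideal_add[OF N] by blast
    next
      fix p q :: "('v, 'k) mpoly" assume p: "p \<in> polys V" and "q \<in> J"
      then obtain n t where *: "q = n + t * h" "n \<in> N" "t \<in> polys V"
        by (auto simp: J_def)
      then have "p * q = p * n + (p * t) * h" by (simp add: algebra_simps)
      then show "p * q \<in> J" unfolding J_def using * p pideal_mult_left[OF N] by blast
    qed
    have "N \<subseteq> J"
    proof
      fix n assume "n \<in> N"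
      then have "n + 0 * h \<in> J" unfolding J_def by blast
      then show "n \<in> J" by simp
    qed
    moreover have "h \<in> J"
    proof -
      have "0 + 1 * h \<in> J" unfolding J_def using N by (blast intro: polys_one mp.subspace_0 pideal_subspace)
      then show ?thesis by simp
    qed
    ultimately have "J = polys V"
      using I_maximal[of J] J h(2) by (auto simp: ideal_mpoly_ring_iff pideal_def)
    then have "1 \<in> J" by simp
    then obtain n t where nt: "1 = n + t * h" "n \<in> N" "t \<in> polys V" by (auto simp: J_def)
    then have "t * h - 1 = - n" by (simp add: algebra_simps)
    then have "t * h - 1 \<in> N" using pideal_uminus[OF N nt(2)] by simp
    then show ?thesis using nt(3) by blast
  qed
  then show ?thesis using N one by (simp add: maximal_pideal_def)
qed

text \<open>The determinant trick, carried out as elimination. The relations place a multiple of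
  each \<open>x g\<close> in \<open>h\<close> times the span of all of them; one generator after the
  other is solved for and substituted into the remaining relations. All multipliers that arise keep
  the form \<open>1 + h * b\<close>, which closes the induction.\<close>

lemma nakayama:
  assumes "U \<subseteq> V" and N: "pideal V N" and h: "h \<in> polys U" and "finite G"
    and x: "\<And>g. g \<in> G \<Longrightarrow> x g \<in> polys V"
    and b: "b \<in> polys U"
    and rel: "\<And>g. g \<in> G \<Longrightarrow> \<exists>a. (\<forall>g'. a g' \<in> polys U) \<and> (1 + h * b) * x g - (\<Sum>g'\<in>G. h * a g' * x g') \<in> N"
  shows "\<exists>b\<in>polys U. \<forall>g\<in>G. (1 + h * b) * x g \<in> N"
  using assms(4-)
proof (induction G arbitrary: b rule: finite_induct)
  case empty
  then show ?case by auto
next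
  case (insert s G)
  note add = pideal_add[OF N] and mult = pideal_mult_left[OF N]
  have UV: "p \<in> polys U \<Longrightarrow> p \<in> polys V" for p using polys_mono[OF assms(1)] by blast
  obtain a where a: "\<And>g'. a g' \<in> polys U"
    and as: "(1 + h * b) * x s - (\<Sum>g'\<in>insert s G. h * a g' * x g') \<in> N"
    using insert.prems(3)[of s] by blast
  \<comment> \<open>The multiplier of \<open>x s\<close> once the term with \<open>x s\<close> on
    the right-hand side has been moved to the left.\<close>
  define \<beta> where "\<beta> = 1 + h * (b - a s)"
  have \<beta>: "\<beta> \<in> polys U" unfolding \<beta>_def using h insert.prems(2) a by auto
  have s_rel: "\<beta> * x s - (\<Sum>g'\<in>G. h * a g' * x g') \<in> N"
    using as insert.hyps by (simp add: \<beta>_def algebra_simps)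
  define b' where "b' = b - a s + b + h * (b - a s) * b"
  have b': "b' \<in> polys U" unfolding b'_def using h insert.prems(2) a by (intro polys_add polys_diff polys_mult)
  have prod: "1 + h * b' = \<beta> * (1 + h * b)"
    by (simp add: b'_def \<beta>_def algebra_simps)
  have "\<exists>c\<in>polys U. \<forall>g\<in>G. (1 + h * c) * x g \<in> N"
  proof (rule insert.IH[OF _ b'])
    show "x g \<in> polys V" if "g \<in> G" for g using insert.prems(1) that by auto
    fix g assume g: "g \<in> G"
    obtain a' where a': "\<And>g'. a' g' \<in> polys U"
      and ag: "(1 + h * b) * x g - (\<Sum>g'\<in>insert s G. h * a' g' * x g') \<in> N"
      using insert.prems(3)[of g] g by blast
    have "\<beta> * ((1 + h * b) * x g - (\<Sum>g'\<in>insert s G. h * a' g' * x g'))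
        + (h * a' s) * (\<beta> * x s - (\<Sum>g'\<in>G. h * a g' * x g')) \<in> N"
      using ag s_rel \<beta> h a' UV by (intro add mult) auto
    also have "\<beta> * ((1 + h * b) * x g - (\<Sum>g'\<in>insert s G. h * a' g' * x g'))
        + (h * a' s) * (\<beta> * x s - (\<Sum>g'\<in>G. h * a g' * x g'))
      = (1 + h * b') * x g - (\<Sum>g'\<in>G. h * (\<beta> * a' g' + h * a' s * a g') * x g')"
      unfolding prod using insert.hyps
      by (simp add: algebra_simps sum_distrib_left sum.distrib)
    finally show "\<exists>c. (\<forall>g'. c g' \<in> polys U) \<and> (1 + h * b') * x g - (\<Sum>g'\<in>G. h * c g' * x g') \<in> N"
      using h a a' \<beta>
      by (intro exI[of _ "\<lambda>g'. \<beta> * a' g' + h * a' s * a g'"] conjI allI polys_add polys_mult)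
  qed
  then obtain c where c: "c \<in> polys U" "\<And>g. g \<in> G \<Longrightarrow> (1 + h * c) * x g \<in> N" by blast
  \<comment> \<open>Makes \<open>1 + h * d\<close> the product of \<open>1 + h * c\<close> and
    \<open>\<beta>\<close>: the first factor kills the other generators, and \<open>\<beta>\<close>
    rewrites \<open>x s\<close> in terms of them.\<close>
  define d where "d = c + (b - a s) + h * c * (b - a s)"
  have d: "d \<in> polys U" "1 + h * d = (1 + h * c) * \<beta>"
    unfolding d_def \<beta>_def using c(1) h a insert.prems(2)
    by (intro polys_add polys_diff polys_mult) (simp_all add: algebra_simps)
  have "(1 + h * d) * x g \<in> N" if "g \<in> G" for g
    using mult[OF c(2)[OF that] UV[OF \<beta>]] unfolding d(2) by (simp add: mult_ac)
  moreover have "(1 + h * d) * x s \<in> N"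
  proof -
    have hc: "1 + h * c \<in> polys V"
      using UV[of "1 + h * c"] h c(1) by auto
    have ha: "h * a g' \<in> polys V" for g'
      using UV[of "h * a g'"] h a by auto
    have "(1 + h * c) * (\<beta> * x s - (\<Sum>g'\<in>G. h * a g' * x g')) + (\<Sum>g'\<in>G. (h * a g') * ((1 + h * c) * x g')) \<in> N"
      by (rule add[OF mult[OF s_rel hc] pideal_sum[OF N mult[OF c(2) ha]]])
    also have "(1 + h * c) * (\<beta> * x s - (\<Sum>g'\<in>G. h * a g' * x g')) + (\<Sum>g'\<in>G. (h * a g') * ((1 + h * c) * x g'))
        = (1 + h * d) * x s"
    proof -
      have "(\<Sum>g'\<in>G. (h * a g') * ((1 + h * c) * x g')) = (1 + h * c) * (\<Sum>g'\<in>G. h * a g' * x g')"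
        by (simp add: sum_distrib_left mult_ac)
      then show ?thesis by (simp only: d(2) right_diff_distrib) (simp add: mult.assoc)
    qed
    finally show ?thesis .
  qed
  ultimately show ?case using d(1) by auto
qed

section \<open>Finiteness after inverting one element\<close>

lemma mpoly_var_power: "var w ^ k = monomial (single w k)"
proof (induction k)
  case (Suc k)
  then show ?case
    by (simp add: mpoly_var_eq_monomial flip: monomial_add single_add)
qed simp

lemma polys_insert_decomposition:
  assumes "p \<in> polys (insert w U)"
  shows "\<exists>n c. (\<forall>i. c i \<in> polys U) \<and> p = (\<Sum>i\<le>n. c i * var w ^ i)"
proof (intro exI conjI allI)
  let ?e = "\<lambda>m. lookup m w"
  let ?n = "Max (insert 0 (?e ` keys p))"
  let ?c = "\<lambda>i. \<Sum>m\<in>{m \<in> keys p. ?e m = i}.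
    scal (lookup p m) (monomial (m - single w i))"
  show "?c i \<in> polys U" for i
  proof (intro polys_sum polys_scal)
    fix m assume m: "m \<in> {m \<in> keys p. ?e m = i}"
    then have "keys m \<subseteq> insert w U" using assms by (auto simp: polys_def)
    moreover have "keys (m - single w i) \<subseteq> keys m - {w}"
      using m by (auto simp: in_keys_iff lookup_minus lookup_single when_def)
    ultimately show "monomial (m - single w i) \<in> polys U" by auto
  qed
  have "p = (\<Sum>m\<in>keys p. scal (lookup p m) (monomial m))"
    by (rule poly_eq_sum_monomials)
  also have "\<dots> = (\<Sum>i\<le>?n. \<Sum>m\<in>{m \<in> keys p. ?e m = i}. scal (lookup p m) (monomial m))"
    by (rule sum.group[symmetric]) auto
  also have "\<dots> = (\<Sum>i\<le>?n. ?c i * var w ^ i)"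
    unfolding sum_distrib_right
  proof (intro sum.cong refl)
    fix i m assume "m \<in> {m \<in> keys p. ?e m = i}"
    then have "m = (m - single w i) + single w i"
      by (intro poly_mapping_eqI) (auto simp: lookup_add lookup_minus lookup_single when_def)
    then have "(monomial m :: ('a, 'b) mpoly) = monomial (m - single w i) * var w ^ i"
      by (metis monomial_add mpoly_var_power)
    then show "scal (lookup p m) (monomial m) =
        scal (lookup p m) (monomial (m - single w i)) * var w ^ i"
      by simp
  qed
  finally show "p = (\<Sum>i\<le>?n. ?c i * var w ^ i)" .
qed

lemma polys_empty: "p \<in> polys {} \<Longrightarrow> p = scal (lookup p 0) 1"
proof (rule poly_mapping_eqI)
  fix m assume "p \<in> polys {}"
  then have "m \<in> keys p \<Longrightarrow> m = 0" by (auto simp: polys_def)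
  then show "lookup p m = lookup (scal (lookup p 0) 1) m"
    by (auto simp: lookup_scal lookup_one when_def in_keys_iff)
qed

text \<open>After multiplication by a power of \<open>c\<close>, the product of the leading coefficients, everything
  becomes a \<open>polys U\<close>-combination of finitely many monomials modulo \<open>N\<close>.\<close>

lemma finite_after_localization:
  fixes N :: "('v, 'k::field) mpoly set"
  assumes "finite V" "U \<subseteq> V" and N: "pideal V N"
    and indep: "polys U \<inter> N \<subseteq> {0}"
    and dep: "\<And>w. w \<in> V - U \<Longrightarrow> \<not> polys (insert w U) \<inter> N \<subseteq> {0}"
  obtains c Bx where "c \<in> polys U" "c \<noteq> 0" "finite Bx" "0 \<in> Bx"
    "\<And>m. m \<in> Bx \<Longrightarrow> keys m \<subseteq> V"
    "\<And>f. f \<in> polys V \<Longrightarrow>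
      \<exists>k a. (\<forall>m. a m \<in> polys U) \<and> c ^ k * f - (\<Sum>m\<in>Bx. a m * monomial m) \<in> N"
proof -
  note add = pideal_add[OF N] and mult = pideal_mult_left[OF N]
  have UV: "p \<in> polys U \<Longrightarrow> p \<in> polys V" for p using polys_mono[OF assms(2)] by blast
  define rel where "rel w D e a \<longleftrightarrow> e \<in> polys U \<and> e \<noteq> 0 \<and> (\<forall>i. a i \<in> polys U) \<and>
      e * var w ^ D - (\<Sum>i<D. a i * var w ^ i) \<in> N" for w D e and a :: "nat \<Rightarrow> ('v, 'k) mpoly"
  have "\<exists>D e a. rel w D e a" if w: "w \<in> V - U" for w
  proof -
    obtain p where p: "p \<in> polys (insert w U)" "p \<in> N" "p \<noteq> 0" using dep[OF w] by blast
    obtain n c where c: "\<And>i. c i \<in> polys U" "p = (\<Sum>i\<le>n. c i * var w ^ i)"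
      using polys_insert_decomposition[OF p(1)] by blast
    \<comment> \<open>The degree of \<open>p\<close> in \<open>w\<close>. The coefficient at this
      degree becomes \<open>e w\<close>, which has to be inverted to make the relation
      monic.\<close>
    define D where "D = Max {i. i \<le> n \<and> c i \<noteq> 0}"
    have ne: "{i. i \<le> n \<and> c i \<noteq> 0} \<noteq> {}"
    proof
      assume "{i. i \<le> n \<and> c i \<noteq> 0} = {}"
      then have "p = 0" unfolding c(2) by (intro sum.neutral) auto
      then show False using p(3) by simp
    qed
    have D: "D \<le> n" "c D \<noteq> 0" using Max_in[OF _ ne] by (auto simp: D_def)
    have "c i = 0" if "D < i" "i \<le> n" for i
    proof (rule ccontr)
      assume "c i \<noteq> 0"
      then have "i \<le> D" unfolding D_def using that(2) by (intro Max_ge) auto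
      then show False using that(1) by simp
    qed
    then have "p = (\<Sum>i\<le>D. c i * var w ^ i)"
      unfolding c(2) using D(1) by (intro sum.mono_neutral_right) (auto simp: not_le)
    also have "\<dots> = c D * var w ^ D - (\<Sum>i<D. (- c i) * var w ^ i)"
      by (simp add: sum_negf lessThan_Suc_atMost[symmetric])
    finally show ?thesis
      unfolding rel_def using p(2) D(2) c(1) polys_uminus[OF c(1)]
      by (intro exI[of _ D] exI[of _ "c D"] exI[of _ "\<lambda>i. - c i"]) auto
  qed
  then obtain D e a where "\<And>w. w \<in> V - U \<Longrightarrow> rel w (D w) (e w) (a w)"
    by metis
  then have e: "\<And>w. w \<in> V - U \<Longrightarrow> e w \<in> polys U \<and> e w \<noteq> 0"
    and a: "\<And>w i. w \<in> V - U \<Longrightarrow> a w i \<in> polys U"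
    and rel: "\<And>w. w \<in> V - U \<Longrightarrow> e w * var w ^ D w - (\<Sum>i<D w. a w i * var w ^ i) \<in> N"
    unfolding rel_def by blast+
  have fin_U: "finite U" using assms(1,2) finite_subset by blast
  \<comment> \<open>With degree 0 the nonzero \<open>e w\<close> itself would lie in
    \<open>polys U \<inter> N\<close>. Positive degrees ensure that the exponent 0 belongs to
    \<open>Bx\<close>.\<close>
  have D_pos: "D w > 0" if w: "w \<in> V - U" for w
  proof (rule ccontr)
    assume "\<not> D w > 0"
    then have "e w \<in> N" using rel[OF w] by simp
    then show False using e[OF w] indep by blast
  qed
  define c where "c = (\<Prod>w\<in>V - U. e w)"
  have cU: "c \<in> polys U" unfolding c_def using e by (intro polys_prod) auto
  have "c \<noteq> 0"
  proof -
    have "(\<Prod>w\<in>A. e w) \<noteq> 0" if "finite A" "A \<subseteq> V - U" for A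
      using that
    proof (induction A)
      case (insert w A)
      have "(\<Prod>w\<in>A. e w) \<in> polys U" using insert.prems e by (intro polys_prod) blast
      then show ?case
        using insert polys_no_zero_divisors[OF fin_U, of "e w" "\<Prod>w\<in>A. e w"] e[of w] by auto
    qed simp
    then show ?thesis using assms(1) by (auto simp: c_def)
  qed
  \<comment> \<open>Higher powers of an outside variable \<open>w\<close> can be rewritten by
    \<open>rel\<close> at the price of a factor \<open>e w\<close>, so only exponents below
    \<open>D w\<close> remain.\<close>
  define Bx where "Bx = {m. keys m \<subseteq> V - U \<and> (\<forall>w\<in>V - U. lookup m w < D w)}"
  have "Bx \<subseteq> exponent_box (V - U) (\<Sum>w\<in>V - U. D w)"
  proof
    fix m assume m: "m \<in> Bx"
    have "lookup m v \<le> (\<Sum>w\<in>V - U. D w)" for v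
    proof (cases "v \<in> V - U")
      case True
      then have "lookup m v \<le> D v" using m by (auto simp: Bx_def intro: less_imp_le)
      also have "\<dots> \<le> (\<Sum>w\<in>V - U. D w)" using True assms(1) by (intro member_le_sum) auto
      finally show ?thesis .
    next
      case False
      then have "lookup m v = 0" using m by (auto simp: Bx_def in_keys_iff)
      then show ?thesis by simp
    qed
    then show "m \<in> exponent_box (V - U) (\<Sum>w\<in>V - U. D w)"
      using m by (auto simp: exponent_box_def Bx_def)
  qed
  then have fin_Bx: "finite Bx"
    using exponent_box_card(1)[of "V - U"] assms(1) by (metis finite_Diff finite_subset)
  have Bx0: "0 \<in> Bx" using D_pos by (simp add: Bx_def)
  have Bx_V: "keys m \<subseteq> V" if "m \<in> Bx" for m using that by (auto simp: Bx_def)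
  define M where "M = {f. \<exists>a. (\<forall>m. a m \<in> polys U) \<and> f - (\<Sum>m\<in>Bx. a m * monomial m) \<in> N}"
  have M_add: "f + g \<in> M" if fg: "f \<in> M" "g \<in> M" for f g
  proof -
    obtain a b where *: "\<And>m. a m \<in> polys U" "\<And>m. b m \<in> polys U"
      "f - (\<Sum>m\<in>Bx. a m * monomial m) \<in> N" "g - (\<Sum>m\<in>Bx. b m * monomial m) \<in> N"
      using fg unfolding M_def by blast
    have "f + g - (\<Sum>m\<in>Bx. (a m + b m) * monomial m) \<in> N"
      using add[OF *(3,4)] by (simp add: algebra_simps sum.distrib)
    then show ?thesis unfolding M_def using * by (intro CollectI exI[of _ "\<lambda>m. a m + b m"]) auto
  qed
  have M_mult: "q * f \<in> M" if f: "f \<in> M" "q \<in> polys U" for f q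
  proof -
    obtain a where *: "\<And>m. a m \<in> polys U" "f - (\<Sum>m\<in>Bx. a m * monomial m) \<in> N"
      using f unfolding M_def by blast
    have "q * f - (\<Sum>m\<in>Bx. (q * a m) * monomial m) \<in> N"
      using mult[OF *(2) UV[OF f(2)]] by (simp add: algebra_simps sum_distrib_left)
    then show ?thesis unfolding M_def using * f(2) by (intro CollectI exI[of _ "\<lambda>m. q * a m"]) auto
  qed
  have M_N: "N \<subseteq> M"
    unfolding M_def by (auto intro!: exI[of _ "\<lambda>_. 0"])
  then have M_0: "0 \<in> M" using N by (auto simp: pideal_def)
  have M_sum: "(\<And>i. i \<in> A \<Longrightarrow> f i \<in> M) \<Longrightarrow> sum f A \<in> M" for f and A :: "nat set"
    by (induction A rule: infinite_finite_induct) (auto simp: M_0 intro: M_add)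
  have M_sum': "(\<And>i. i \<in> A \<Longrightarrow> f i \<in> M) \<Longrightarrow> sum f A \<in> M" for f and A :: "('v \<Rightarrow>\<^sub>0 nat) set"
    by (induction A rule: infinite_finite_induct) (auto simp: M_0 intro: M_add)
  have M_Bx: "monomial m \<in> M" if "m \<in> Bx" for m
  proof -
    have "(\<Sum>n\<in>Bx. (if n = m then 1 else 0) * monomial n) = (monomial m :: ('v, 'k) mpoly)"
      using that fin_Bx by (simp add: if_distrib[of "\<lambda>x. x * _"] cong: if_cong)
    then show ?thesis
      unfolding M_def using N by (intro CollectI exI[of _ "\<lambda>n. if n = m then 1 else 0"]) (auto simp: pideal_def)
  qed
  \<comment> \<open>Multiplication by one outside variable costs one factor \<open>c\<close>. Inside
    the box the product is again in the box; at its boundary \<open>e w\<close> is split off from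
    \<open>c\<close>, so that \<open>rel\<close> applies.\<close>
  have step_Bx: "c * (var w * monomial m) \<in> M" if w: "w \<in> V - U" and m: "m \<in> Bx" for w m
  proof (cases "Suc (lookup m w) < D w")
    case True
    have "m + single w 1 \<in> Bx"
      using m w True by (auto simp: Bx_def keys_add_nat lookup_add lookup_single when_def)
    then have "c * monomial (m + single w 1) \<in> M" by (intro M_mult M_Bx cU)
    then show ?thesis
      by (simp add: monomial_add mpoly_var_eq_monomial mult.commute)
  next
    case False
    then have Dw: "D w = Suc (lookup m w)"
    proof -
      have "lookup m w < D w" using m w by (simp add: Bx_def)
      then show ?thesis using False by linarith
    qed
    define m' where "m' = m - single w (lookup m w)"
    have m_eq: "m = m' + single w (lookup m w)"
      unfolding m'_def by (intro poly_mapping_eqI) (auto simp: lookup_add lookup_minus lookup_single when_def)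
    have m'_keys: "keys m' \<subseteq> V - U"
    proof -
      have "keys m' \<subseteq> keys m"
        by (subst m_eq) (simp add: keys_add_nat)
      then show ?thesis using m by (auto simp: Bx_def)
    qed
    define e' where "e' = (\<Prod>w\<in>V - U - {w}. e w)"
    have c_eq: "c = e' * e w"
      unfolding c_def e'_def using assms(1) w by (simp add: prod.remove[of "V - U" w] mult.commute)
    have e'U: "e' \<in> polys U" unfolding e'_def using e by (intro polys_prod) auto
    have vm: "var w * monomial m = monomial m' * var w ^ D w"
      by (subst m_eq) (simp add: Dw monomial_add mult_ac flip: mpoly_var_power)
    have "(\<Sum>i<D w. (e' * a w i) * (monomial m' * var w ^ i)) \<in> M"
    proof (rule M_sum, rule M_mult)
      fix i assume i: "i \<in> {..<D w}"
      have "m' + single w i \<in> Bx"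
        using m m'_keys w i by (auto simp: Bx_def keys_add_nat lookup_add lookup_single when_def m'_def lookup_minus
          split: if_splits)
      then show "monomial m' * var w ^ i \<in> M"
        using M_Bx by (simp add: mpoly_var_power flip: monomial_add)
      show "e' * a w i \<in> polys U" using e'U a[OF w] by auto
    qed
    moreover have "(e' * monomial m') * (e w * var w ^ D w - (\<Sum>i<D w. a w i * var w ^ i)) \<in> N"
    proof (intro mult rel[OF w] polys_mult UV[OF e'U])
      show "monomial m' \<in> polys V" using m'_keys by auto
    qed
    ultimately have "(\<Sum>i<D w. (e' * a w i) * (monomial m' * var w ^ i)) +
        (e' * monomial m') * (e w * var w ^ D w - (\<Sum>i<D w. a w i * var w ^ i)) \<in> M"
      using M_N by (intro M_add) auto
    also have "(\<Sum>i<D w. (e' * a w i) * (monomial m' * var w ^ i)) +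
        (e' * monomial m') * (e w * var w ^ D w - (\<Sum>i<D w. a w i * var w ^ i))
      = c * (var w * monomial m)"
      unfolding vm c_eq by (simp add: algebra_simps sum_distrib_left)
    finally show ?thesis .
  qed
  have step: "c * (var w * f) \<in> M" if w: "w \<in> V - U" and f: "f \<in> M" for w f
  proof -
    obtain b where b: "\<And>m. b m \<in> polys U" "f - (\<Sum>m\<in>Bx. b m * monomial m) \<in> N"
      using f unfolding M_def by blast
    have "(\<Sum>m\<in>Bx. b m * (c * (var w * monomial m))) +
        (c * var w) * (f - (\<Sum>m\<in>Bx. b m * monomial m)) \<in> M"
    proof (rule M_add)
      show "(\<Sum>m\<in>Bx. b m * (c * (var w * monomial m))) \<in> M"
        using b step_Bx[OF w] by (intro M_sum' M_mult[of "c * (var w * monomial _)"]) auto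
      have "(c * var w) * (f - (\<Sum>m\<in>Bx. b m * monomial m)) \<in> N"
        using b UV[OF cU] w by (intro mult) auto
      then show "(c * var w) * (f - (\<Sum>m\<in>Bx. b m * monomial m)) \<in> M" using M_N by blast
    qed
    also have "(\<Sum>m\<in>Bx. b m * (c * (var w * monomial m))) +
        (c * var w) * (f - (\<Sum>m\<in>Bx. b m * monomial m)) = c * (var w * f)"
      by (simp add: algebra_simps sum_distrib_left)
    finally show ?thesis .
  qed
  have mono: "\<exists>k. c ^ k * monomial m \<in> M" if "keys m \<subseteq> V" for m
    using that
  proof (induction m rule: monomial_induct)
    case zero
    then show ?case using M_Bx[OF Bx0] by (intro exI[of _ 0]) simp
  next
    case (add m v)
    then obtain k where k: "c ^ k * monomial m \<in> M" by blast
    show ?case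
    proof (cases "v \<in> U")
      case True
      then have "var v * (c ^ k * monomial m) \<in> M" using M_mult[OF k] by simp
      then show ?thesis
        by (intro exI[of _ k]) (simp add: monomial_add mpoly_var_eq_monomial mult_ac)
    next
      case False
      then have "c * (var v * (c ^ k * monomial m)) \<in> M" using step[OF _ k] add.hyps by auto
      then show ?thesis
        by (intro exI[of _ "Suc k"]) (simp add: monomial_add mpoly_var_eq_monomial mult_ac)
    qed
  qed
  have "\<exists>k. c ^ k * f \<in> M" if f: "f \<in> polys V" for f
  proof -
    have "\<exists>k. \<forall>m\<in>A. c ^ k * monomial m \<in> M" if "finite A" "\<forall>m\<in>A. keys m \<subseteq> V" for A
      using that
    proof (induction A)
      case (insert m A)
      then obtain k l where kl: "\<forall>m\<in>A. c ^ k * monomial m \<in> M" "c ^ l * monomial m \<in> M"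
        using mono[of m] by auto
      have "c ^ (k + l) * monomial n \<in> M" if n: "n \<in> insert m A" for n
      proof -
        have "c ^ l \<in> polys U" "c ^ k \<in> polys U" using cU by auto
        then have "c ^ l * (c ^ k * monomial n) \<in> M \<or> c ^ k * (c ^ l * monomial n) \<in> M"
          using n kl M_mult[of "c ^ k * monomial n"] M_mult[of "c ^ l * monomial n"] by auto
        then show ?thesis by (auto simp: power_add mult_ac)
      qed
      then show ?case by blast
    qed auto
    from this[of "keys f"] obtain k where k: "\<forall>m\<in>keys f. c ^ k * monomial m \<in> M"
      using f by (auto simp: polys_def)
    have "(\<Sum>m\<in>keys f. scal (lookup f m) 1 * (c ^ k * monomial m)) \<in> M"
      using k by (intro M_sum' M_mult[of "c ^ k * monomial _"]) auto
    also have "(\<Sum>m\<in>keys f. scal (lookup f m) 1 * (c ^ k * monomial m)) = c ^ k * f"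
      by (subst (3) poly_eq_sum_monomials[of f]) (simp add: sum_distrib_left)
    finally show ?thesis by blast
  qed
  then show ?thesis
    using that[OF cU \<open>c \<noteq> 0\<close> fin_Bx Bx0 Bx_V] unfolding M_def by simp
qed

text \<open>Given \<open>u \<in> U\<close>, the element \<open>h = 1 - var u * c\<close> is nonzero
  in \<open>polys U\<close> and thus has an inverse \<open>t\<close> modulo \<open>N\<close>. Up to
  powers of \<open>c\<close>, multiplication by \<open>t\<close> preserves the span of
  \<open>Bx\<close>, so a multiple of each monomial of \<open>Bx\<close> lies in \<open>h\<close>
  times this span. By \<open>nakayama\<close>, applied to the monomial 1, some
  \<open>1 + h * b\<close> is in \<open>N\<close>, hence equal to 0 by independence. Then
  \<open>h\<close> is a unit although it is not constant.\<close>

lemma maximal_pideal_no_independent: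
  fixes N :: "('v, 'k::field) mpoly set"
  assumes "finite V" "U \<subseteq> V" and max: "maximal_pideal V N"
    and indep: "polys U \<inter> N \<subseteq> {0}"
    and dep: "\<And>w. w \<in> V - U \<Longrightarrow> \<not> polys (insert w U) \<inter> N \<subseteq> {0}"
  shows "U = {}"
proof (rule ccontr)
  assume "U \<noteq> {}"
  then obtain u where u: "u \<in> U" by blast
  have fin_U: "finite U" using assms(1,2) finite_subset by blast
  have N: "pideal V N" using max by (simp add: maximal_pideal_def)
  have UV: "p \<in> polys U \<Longrightarrow> p \<in> polys V" for p using polys_mono[OF assms(2)] by blast
  obtain c Bx where c: "c \<in> polys U" "c \<noteq> 0" and Bx: "finite Bx" "0 \<in> Bx" "\<And>m. m \<in> Bx \<Longrightarrow> keys m \<subseteq> V"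
    and fin: "\<And>f. f \<in> polys V \<Longrightarrow> \<exists>k a. (\<forall>m. a m \<in> polys U) \<and> c ^ k * f - (\<Sum>m\<in>Bx. a m * monomial m) \<in> N"
  proof (rule finite_after_localization[OF assms(1,2) N indep dep])
    fix c :: "('v, 'k) mpoly" and Bx
    assume "c \<in> polys U" "c \<noteq> 0" "finite Bx" "0 \<in> Bx"
      "\<And>m. m \<in> Bx \<Longrightarrow> keys m \<subseteq> V"
      "\<And>f. f \<in> polys V \<Longrightarrow> \<exists>k a. (\<forall>m. a m \<in> polys U) \<and> c ^ k * f - (\<Sum>m\<in>Bx. a m * monomial m) \<in> N"
    then show thesis by (rule that)
  qed
  define p where "p = var u * c"
  have p: "p \<in> polys U" "p \<noteq> 0"
    using u c polys_no_zero_divisors[OF fin_U, of "var u" c]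
    by (auto simp: p_def mpoly_var_eq_monomial)
  have p_keys: "m \<noteq> 0" if m: "m \<in> keys p" for m
  proof -
    obtain n where "m = single u 1 + n"
      using m keys_mult[of "var u" c] by (auto simp: p_def mpoly_var_def)
    then have "lookup m u \<noteq> 0" by (simp add: lookup_add)
    then show ?thesis by auto
  qed
  obtain m0 where m0: "m0 \<in> keys p" using p(2) by (metis keys_eq_empty ex_in_conv)
  \<comment> \<open>The choice makes \<open>c\<close> invertible modulo \<open>h\<close>, so that
    denominators are harmless there; the factor \<open>var u\<close> makes \<open>h\<close>
    nonconstant even if \<open>c\<close> is constant.\<close>
  define h where "h = 1 - p"
  have h: "h \<in> polys U" using p by (auto simp: h_def)
  have m0_h: "m0 \<in> keys h"
    using m0 p_keys[OF m0] by (simp add: h_def in_keys_iff lookup_minus lookup_one when_def)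
  then have "h \<noteq> 0" by auto
  then have "h \<notin> N" using indep h by blast
  then obtain t where t: "t \<in> polys V" "t * h - 1 \<in> N"
    using max UV[OF h] by (auto simp: maximal_pideal_def)
  define S where "S k f \<longleftrightarrow> (\<exists>a. (\<forall>n. a n \<in> polys U) \<and>
      c ^ k * f - (\<Sum>n\<in>Bx. a n * monomial n) \<in> N)" for k f
  have S_ex: "\<exists>k. S k f" if "f \<in> polys V" for f
    unfolding S_def by (rule fin[OF that])
  have S_raise: "S j f" if ij: "i \<le> j" and Si: "S i f" for i j f
  proof -
    obtain a where a: "\<And>n. a n \<in> polys U" "c ^ i * f - (\<Sum>n\<in>Bx. a n * monomial n) \<in> N"
      using Si unfolding S_def by blast
    have "c ^ (j - i) * (c ^ i * f - (\<Sum>n\<in>Bx. a n * monomial n)) \<in> N"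
      using pideal_mult_left[OF N a(2)] UV c(1) by auto
    also have "c ^ (j - i) * (c ^ i * f - (\<Sum>n\<in>Bx. a n * monomial n)) =
      c ^ (j - i) * c ^ i * f - (\<Sum>n\<in>Bx. (c ^ (j - i) * a n) * monomial n)"
      by (simp add: right_diff_distrib sum_distrib_left mult.assoc)
    also have "c ^ (j - i) * c ^ i = c ^ j" using ij by (simp flip: power_add)
    finally show ?thesis
      unfolding S_def using a(1) c(1) by (intro exI[of _ "\<lambda>n. c ^ (j - i) * a n"]) auto
  qed
  have "\<exists>k. \<forall>m\<in>A. S k (t * monomial m)" if "finite A" "A \<subseteq> Bx" for A
    using that
  proof (induction A)
    case (insert m A)
    then obtain k where k: "\<forall>m\<in>A. S k (t * monomial m)" by auto
    have "t * monomial m \<in> polys V" using t(1) Bx(3)[of m] insert.prems by auto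
    then obtain l where l: "S l (t * monomial m)" using S_ex by blast
    show ?case
      using S_raise[of k "max k l"] S_raise[of l "max k l"] k l by (intro exI[of _ "max k l"]) auto
  qed auto
  from this[OF Bx(1) order.refl] obtain k where k: "\<And>m. m \<in> Bx \<Longrightarrow> S k (t * monomial m)"
    by blast
  \<comment> \<open>Since \<open>p\<close> is congruent to 1 modulo \<open>h\<close>, the common
    denominator turns into a multiplier of the form needed by \<open>nakayama\<close>.\<close>
  have "\<exists>b\<in>polys U. p ^ k = 1 + h * b"
  proof (induction k)
    case 0
    show ?case by (intro bexI[of _ 0]) auto
  next
    case (Suc k)
    then obtain b where "b \<in> polys U" "p ^ k = 1 + h * b" by blast
    moreover from this have "p ^ Suc k = p * (1 + h * b)" by simp
    moreover have "p * (1 + h * b) = 1 + h * (p * b - 1)" by (simp add: h_def algebra_simps)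
    ultimately have "p ^ Suc k = 1 + h * (p * b - 1)" by simp
    then show ?case using \<open>b \<in> polys U\<close> p by (intro bexI[of _ "p * b - 1"]) auto
  qed
  then obtain b where b: "b \<in> polys U" "p ^ k = 1 + h * b" by blast
  have "\<exists>b\<in>polys U. \<forall>m\<in>Bx. (1 + h * b) * monomial m \<in> N"
  proof (rule nakayama[OF assms(2) N h Bx(1) _ b(1)])
    show "monomial m \<in> polys V" if "m \<in> Bx" for m using Bx(3)[OF that] by simp
    fix m assume m: "m \<in> Bx"
    obtain a where a: "\<And>n. a n \<in> polys U" "c ^ k * (t * monomial m) - (\<Sum>n\<in>Bx. a n * monomial n) \<in> N"
      using k[OF m] unfolding S_def by blast
    \<comment> \<open>Completes the power \<open>c ^ k\<close>, which clears the denominators, to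
      \<open>p ^ k\<close>.\<close>
    define x :: "('v, 'k) mpoly" where "x = var u ^ k"
    have x: "x \<in> polys U" "x \<in> polys V" using u assms(2) unfolding x_def by (intro polys_power; auto)+
    have "(x * h) * (c ^ k * (t * monomial m) - (\<Sum>n\<in>Bx. a n * monomial n))
        - (x * c ^ k * monomial m) * (t * h - 1) \<in> N"
    proof (intro pideal_diff[OF N] pideal_mult_left[OF N a(2)] pideal_mult_left[OF N t(2)])
      show "x * h \<in> polys V" using x(2) UV[OF h] by auto
      have "monomial m \<in> polys V" using Bx(3)[OF m] by simp
      then show "x * c ^ k * monomial m \<in> polys V"
        using x(2) UV[OF c(1)] by (intro polys_mult polys_power)
    qed
    also have "(x * h) * (c ^ k * (t * monomial m) - (\<Sum>n\<in>Bx. a n * monomial n))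
        - (x * c ^ k * monomial m) * (t * h - 1)
      = x * c ^ k * monomial m - (\<Sum>n\<in>Bx. h * (x * a n) * monomial n)"
      by (simp add: algebra_simps sum_distrib_left)
    also have "x * c ^ k = 1 + h * b"
      unfolding b(2)[symmetric] by (simp add: x_def p_def power_mult_distrib)
    finally show "\<exists>a. (\<forall>n. a n \<in> polys U) \<and>
        (1 + h * b) * monomial m - (\<Sum>n\<in>Bx. h * a n * monomial n) \<in> N"
      using x a(1) by (intro exI[of _ "\<lambda>n. x * a n"]) auto
  qed
  then obtain b where b: "b \<in> polys U" "1 + h * b \<in> N"
    using Bx(2) by force
  moreover have "1 + h * b \<in> polys U" using h b(1) by auto
  ultimately have "1 + h * b = 0" using indep by blast
  then have "h * (- b) = 1" by (simp add: add_eq_0_iff2)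
  then have "keys h \<subseteq> {0}" using keys_unit[OF fin_U h] b(1) by blast
  then show False using m0_h p_keys[OF m0] by auto
qed

text \<open>The quotient field has finite dimension over the coefficients. A maximal set of
  variables independent modulo \<open>N\<close> must be empty, and in
  \<open>finite_after_localization\<close> for the empty set both \<open>c\<close> and the
  coefficients are constants, so the power of \<open>c\<close> can be divided out.\<close>

lemma zariski:
  fixes N :: "('v, 'k::field) mpoly set"
  assumes "finite V" and max: "maximal_pideal V N"
  shows "\<exists>G. finite G \<and> (\<forall>f\<in>polys V. \<exists>s\<in>mp.span G. f - s \<in> N)"
proof -
  have N: "pideal V N" using max by (simp add: maximal_pideal_def)
  have indep: "polys {} \<inter> N \<subseteq> {0}"
  proof
    fix p assume p: "p \<in> polys {} \<inter> N"
    then have eq: "p = scal (lookup p 0) 1" by (intro polys_empty) auto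
    have "lookup p 0 = 0"
    proof (rule ccontr)
      assume nz: "lookup p 0 \<noteq> 0"
      have "scal (inverse (lookup p 0)) p \<in> N" using p pideal_scal[OF N] by blast
      also have "scal (inverse (lookup p 0)) p = 1"
        using nz by (subst eq) (simp add: mp.scale_scale)
      finally show False using max by (simp add: maximal_pideal_def)
    qed
    then show "p \<in> {0}" using eq by simp
  qed
  have "finite {U. U \<subseteq> V \<and> polys U \<inter> N \<subseteq> {0}}" using assms(1) by simp
  then obtain U where U: "U \<subseteq> V" "polys U \<inter> N \<subseteq> {0}"
    and U_max: "\<And>W. W \<subseteq> V \<Longrightarrow> polys W \<inter> N \<subseteq> {0} \<Longrightarrow> U \<subseteq> W \<Longrightarrow> U = W"
    using finite_has_maximal2[of "{U. U \<subseteq> V \<and> polys U \<inter> N \<subseteq> {0}}" "{}"] indep by auto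
  have dep: "\<not> polys (insert w U) \<inter> N \<subseteq> {0}" if "w \<in> V - U" for w
    using U_max[of "insert w U"] that U(1) by blast
  then have "U = {}" using maximal_pideal_no_independent[OF assms(1) U(1) max U(2)] by blast
  then have dep': "\<not> polys (insert w {}) \<inter> N \<subseteq> {0}" if "w \<in> V - {}" for w
    using dep that by simp
  obtain c Bx where c: "c \<in> polys {}" "c \<noteq> 0" and Bx: "finite Bx" "0 \<in> Bx"
      "\<And>m. m \<in> Bx \<Longrightarrow> keys m \<subseteq> V"
    and fin: "\<And>f. f \<in> polys V \<Longrightarrow> \<exists>k a. (\<forall>m. a m \<in> polys {}) \<and> c ^ k * f - (\<Sum>m\<in>Bx. a m * monomial m) \<in> N"
  proof (rule finite_after_localization[OF assms(1) empty_subsetI N indep dep'])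
    fix c :: "('v, 'k) mpoly" and Bx
    assume "c \<in> polys {}" "c \<noteq> 0" "finite Bx" "0 \<in> Bx"
      "\<And>m. m \<in> Bx \<Longrightarrow> keys m \<subseteq> V"
      "\<And>f. f \<in> polys V \<Longrightarrow> \<exists>k a. (\<forall>m. a m \<in> polys {}) \<and> c ^ k * f - (\<Sum>m\<in>Bx. a m * monomial m) \<in> N"
    then show thesis by (rule that)
  qed
  have c_eq: "c = scal (lookup c 0) 1" by (rule polys_empty[OF c(1)])
  define d where "d = lookup c 0"
  have d: "c = scal d 1" "d \<noteq> 0" using c_eq c(2) by (auto simp: d_def)
  have ck: "c ^ k = scal (d ^ k) 1" for k
    unfolding d(1) by (induction k) (simp_all add: mult.commute)
  have "\<exists>s\<in>mp.span (monomial ` Bx). f - s \<in> N" if f: "f \<in> polys V" for f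
  proof -
    obtain k a where a: "\<And>m. a m \<in> polys {}" "c ^ k * f - (\<Sum>m\<in>Bx. a m * monomial m) \<in> N"
      using fin[OF f] by blast
    define s where "s = scal (inverse (d ^ k)) (\<Sum>m\<in>Bx. a m * monomial m)"
    have "a m * monomial m \<in> mp.span (monomial ` Bx)" if "m \<in> Bx" for m
    proof -
      have "a m * monomial m = scal (lookup (a m) 0) (monomial m)"
        by (subst polys_empty[OF a(1)]) simp
      then show ?thesis using mp.span_scale[OF mp.span_base[OF imageI[OF that]]] by simp
    qed
    then have s: "s \<in> mp.span (monomial ` Bx)"
      unfolding s_def by (intro mp.span_scale mp.span_sum) auto
    have "scal (inverse (d ^ k)) (c ^ k * f - (\<Sum>m\<in>Bx. a m * monomial m)) = f - s"
      using d(2) by (simp add: s_def ck mp.scale_right_diff_distrib)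
    then show ?thesis using s pideal_scal[OF N a(2)] by metis
  qed
  then show ?thesis using Bx by (intro exI[of _ "monomial ` Bx"]) auto
qed

text \<open>One more power of \<open>\<theta>\<close> than there are spanning vectors forces a
  linear relation modulo \<open>N\<close>; division by its top nonzero coefficient makes it monic.
  Degree 0 is impossible because 1 is not in \<open>N\<close>. These relations supply the elements
  \<open>theta_poly v\<close>.\<close>

lemma algebraic_modulo_maximal:
  assumes "finite V" and max: "maximal_pideal V N" and \<theta>: "\<theta> \<in> polys V"
  shows "\<exists>D c. 0 < D \<and> \<theta> ^ D + (\<Sum>i<D. scal (c i) (\<theta> ^ i)) \<in> N"
proof -
  have N: "pideal V N" using max by (simp add: maximal_pideal_def)
  obtain G where G: "finite G" "\<And>f. f \<in> polys V \<Longrightarrow> \<exists>s\<in>mp.span G. f - s \<in> N"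
    using zariski[OF assms(1) max] by blast
  have "\<forall>i. \<exists>s. s \<in> mp.span G \<and> \<theta> ^ i - s \<in> N" using G(2)[of "\<theta> ^ _"] \<theta> by blast
  then obtain s where s: "\<And>i. s i \<in> mp.span G" "\<And>i. \<theta> ^ i - s i \<in> N" by metis
  obtain c where c: "\<exists>i\<in>{..card G}. c i \<noteq> 0" "(\<Sum>i\<in>{..card G}. scal (c i) (s i)) = 0"
    using mp.exists_linear_relation[of "{..card G}" G s] G(1) s(1) by auto
  define n where "n = card G"
  have "(\<Sum>i\<le>n. scal (c i) (\<theta> ^ i - s i)) \<in> N"
    using s(2) by (intro pideal_sum[OF N] pideal_scal[OF N])
  then have sum_N: "(\<Sum>i\<le>n. scal (c i) (\<theta> ^ i)) \<in> N"
    using c(2) by (simp add: n_def mp.scale_right_diff_distrib sum_subtractf)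
  define D where "D = Max {i. i \<le> n \<and> c i \<noteq> 0}"
  have ne: "{i. i \<le> n \<and> c i \<noteq> 0} \<noteq> {}" using c(1) by (auto simp: n_def)
  have D: "D \<le> n" "c D \<noteq> 0" using Max_in[OF _ ne] by (auto simp: D_def)
  have "c i = 0" if "D < i" "i \<le> n" for i
  proof (rule ccontr)
    assume "c i \<noteq> 0"
    then have "i \<le> D" unfolding D_def using that(2) by (intro Max_ge) auto
    then show False using that(1) by simp
  qed
  then have "(\<Sum>i\<le>n. scal (c i) (\<theta> ^ i)) = (\<Sum>i\<le>D. scal (c i) (\<theta> ^ i))"
    using D(1) by (intro sum.mono_neutral_right) (auto simp: not_le)
  then have "scal (inverse (c D)) (\<Sum>i\<le>D. scal (c i) (\<theta> ^ i)) \<in> N"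
    using sum_N pideal_scal[OF N] by simp
  also have "scal (inverse (c D)) (\<Sum>i\<le>D. scal (c i) (\<theta> ^ i)) =
      \<theta> ^ D + (\<Sum>i<D. scal (inverse (c D) * c i) (\<theta> ^ i))"
    using D(2) by (simp add: lessThan_Suc_atMost[symmetric] mp.scale_right_distrib mp.scale_sum_right mp.scale_scale)
  finally have *: "\<theta> ^ D + (\<Sum>i<D. scal (inverse (c D) * c i) (\<theta> ^ i)) \<in> N" .
  moreover have "D > 0"
  proof (rule ccontr)
    assume "\<not> D > 0"
    then show False using * max by (simp add: maximal_pideal_def)
  qed
  ultimately show ?thesis by (intro exI[of _ D] exI[of _ "\<lambda>i. inverse (c D) * c i"]) auto
qed

section \<open>Bases of the polynomial ring\<close>

lemma (in vector_space) span_Int_disjoint: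
  assumes "independent B" "B1 \<subseteq> B" "B2 \<subseteq> B" "B1 \<inter> B2 = {}" "x \<in> span B1" "x \<in> span B2"
  shows "x = 0"
proof -
  have "representation B x = representation B1 x" "representation B x = representation B2 x"
    using assms by (auto intro: representation_extend)
  then have "representation B x b = 0" for b
    using representation_ne_zero[of B1 x b] representation_ne_zero[of B2 x b] assms(4) by auto
  moreover have "x \<in> span B" using assms(2,5) span_mono by blast
  ultimately show ?thesis
    using sum_nonzero_representation_eq[OF assms(1), of x] by simp
qed

lemma span_mult_image: "p \<in> mp.span B \<Longrightarrow> q * p \<in> mp.span ((*) q ` B)"
proof (induction rule: mp.span_induct_alt)
  case (step c p p')
  have "q * (scal c p + p') = scal c (q * p) + q * p'" by (simp add: distrib_left)
  then show ?case using step by (auto intro!: mp.span_add mp.span_scale intro: mp.span_base)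
qed (simp add: mp.span_zero)

text \<open>Total degree, unlike the bound in \<open>exponent_box\<close>, goes up by exactly one
  under multiplication by any variable.\<close>

definition monos_le :: "'v set \<Rightarrow> nat \<Rightarrow> ('v \<Rightarrow>\<^sub>0 nat) set" where
  "monos_le V n = {m. keys m \<subseteq> V \<and> exponent_degree m \<le> n}"

lemma finite_monos_le: "finite V \<Longrightarrow> finite (monos_le V n)"
proof (rule finite_subset)
  show "monos_le V n \<subseteq> exponent_box V n"
  proof
    fix m assume m: "m \<in> monos_le V n"
    have "lookup m v \<le> n" for v
    proof (cases "v \<in> keys m")
      case True
      then have "lookup m v \<le> exponent_degree m"
        unfolding exponent_degree_def by (intro member_le_sum) auto
      then show ?thesis using m by (simp add: monos_le_def)
    qed (simp add: in_keys_iff)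
    then show "m \<in> exponent_box V n" using m by (simp add: monos_le_def exponent_box_def)
  qed
qed (rule exponent_box_card)

text \<open>A family indexed by the monomials whose members of degree at most \<open>n\<close> span all polynomials of
  degree at most \<open>n\<close> is a basis, since there are exactly as many of them as monomials.\<close>

lemma basis_of_spanning_family:
  fixes \<Psi> :: "('v \<Rightarrow>\<^sub>0 nat) \<Rightarrow> ('v, 'k::field) mpoly"
  assumes "finite V" and one: "\<Psi> 0 = 1"
    and var: "\<And>v m. v \<in> V \<Longrightarrow> keys m \<subseteq> V \<Longrightarrow>
      var v * \<Psi> m \<in> mp.span (\<Psi> ` monos_le V (Suc (exponent_degree m)))"
  shows "inj_on \<Psi> {m. keys m \<subseteq> V}"
    and "mp.independent (\<Psi> ` {m. keys m \<subseteq> V})"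
    and "polys V \<subseteq> mp.span (\<Psi> ` {m. keys m \<subseteq> V})"
proof -
  have mono_span: "monomial m \<in> mp.span (\<Psi> ` monos_le V (exponent_degree m))"
    if "keys m \<subseteq> V" for m
    using that
  proof (induction m rule: monomial_induct)
    case zero
    have "\<Psi> 0 \<in> mp.span (\<Psi> ` monos_le V (exponent_degree 0))"
      by (intro mp.span_base imageI) (simp add: monos_le_def)
    then show ?case by (simp add: one)
  next
    case (add m v)
    have "var v * monomial m \<in> mp.span ((*) (var v) ` \<Psi> ` monos_le V (exponent_degree m))"
      using add.IH by (rule span_mult_image)
    also have "\<dots> \<subseteq> mp.span (\<Psi> ` monos_le V (Suc (exponent_degree m)))"
    proof (rule mp.span_minimal)
      show "(*) (var v) ` \<Psi> ` monos_le V (exponent_degree m) \<subseteq>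
          mp.span (\<Psi> ` monos_le V (Suc (exponent_degree m)))"
      proof safe
        fix n assume n: "n \<in> monos_le V (exponent_degree m)"
        then have "var v * \<Psi> n \<in> mp.span (\<Psi> ` monos_le V (Suc (exponent_degree n)))"
          using var add.hyps by (auto simp: monos_le_def)
        also have "\<dots> \<subseteq> mp.span (\<Psi> ` monos_le V (Suc (exponent_degree m)))"
          using n by (intro mp.span_mono image_mono) (auto simp: monos_le_def)
        finally show "var v * \<Psi> n \<in> mp.span (\<Psi> ` monos_le V (Suc (exponent_degree m)))" .
      qed
    qed simp
    finally show ?case
      by (simp add: monomial_add mpoly_var_eq_monomial exponent_degree_add mult.commute)
  qed
  have sub: "monomial ` monos_le V n \<subseteq> mp.span (\<Psi> ` monos_le V n)" for n
  proof safe
    fix m assume m: "m \<in> monos_le V n"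
    then have "monomial m \<in> mp.span (\<Psi> ` monos_le V (exponent_degree m))"
      using mono_span by (simp add: monos_le_def)
    also have "\<dots> \<subseteq> mp.span (\<Psi> ` monos_le V n)"
      using m by (intro mp.span_mono image_mono) (auto simp: monos_le_def)
    finally show "monomial m \<in> mp.span (\<Psi> ` monos_le V n)" .
  qed
  \<comment> \<open>A finite set spanning the members of degree at most \<open>n\<close> also spans
    the monomials of that degree and cannot be smaller. A coincidence or a dependence among the
    members would produce a smaller one, which gives both \<open>inj\<close> and
    \<open>ind\<close>.\<close>
  have bound: "card (monos_le V n) \<le> card B"
    if "finite B" "\<Psi> ` monos_le V n \<subseteq> mp.span B" for n B
  proof -
    have "monomial ` monos_le V n \<subseteq> mp.span B"
      using sub[of n] mp.span_minimal[OF that(2)] by blast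
    moreover have "mp.independent (monomial ` monos_le V n :: ('v, 'k) mpoly set)"
      by (rule mp.independent_mono[OF independent_monomials]) auto
    ultimately have "card (monomial ` monos_le V n :: ('v, 'k) mpoly set) \<le> card B"
      using mp.independent_span_bound[OF that(1)] by blast
    then show ?thesis
      by (subst (asm) card_image) (auto simp: inj_on_def)
  qed
  have fin: "finite (monos_le V n)" for n using finite_monos_le[OF assms(1)] .
  have inj: "inj_on \<Psi> (monos_le V n)" for n
  proof (rule eq_card_imp_inj_on[OF fin])
    show "card (\<Psi> ` monos_le V n) = card (monos_le V n)"
      using bound[of "\<Psi> ` monos_le V n" n] card_image_le[OF fin, of \<Psi> n] fin
      by (simp add: mp.span_superset le_antisym)
  qed
  have ind: "mp.independent (\<Psi> ` monos_le V n)" for n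
  proof
    assume "mp.dependent (\<Psi> ` monos_le V n)"
    then obtain a where a: "a \<in> \<Psi> ` monos_le V n" "a \<in> mp.span (\<Psi> ` monos_le V n - {a})"
      unfolding mp.dependent_def by blast
    then have "\<Psi> ` monos_le V n \<subseteq> mp.span (\<Psi> ` monos_le V n - {a})"
      by (metis DiffI mp.span_base singletonD subsetI)
    then have "card (monos_le V n) \<le> card (\<Psi> ` monos_le V n - {a})"
      by (intro bound) (simp_all add: fin)
    also have "\<dots> < card (\<Psi> ` monos_le V n)"
      using a(1) by (intro card_Diff1_less) (simp_all add: fin)
    also have "\<dots> \<le> card (monos_le V n)" by (rule card_image_le[OF fin])
    finally show False by simp
  qed
  show "inj_on \<Psi> {m. keys m \<subseteq> V}"
  proof (rule inj_onI)
    fix m n assume mn: "m \<in> {m. keys m \<subseteq> V}" "n \<in> {m. keys m \<subseteq> V}" "\<Psi> m = \<Psi> n"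
    then show "m = n"
      using inj_onD[OF inj[of "max (exponent_degree m) (exponent_degree n)"], of m n]
      by (auto simp: monos_le_def)
  qed
  show "mp.independent (\<Psi> ` {m. keys m \<subseteq> V})"
  proof
    assume "mp.dependent (\<Psi> ` {m. keys m \<subseteq> V})"
    then obtain t u where t: "finite t" "t \<subseteq> \<Psi> ` {m. keys m \<subseteq> V}"
      "(\<Sum>p\<in>t. scal (u p) p) = 0" "\<exists>p\<in>t. u p \<noteq> 0"
      unfolding mp.dependent_explicit by blast
    then obtain A where A: "A \<subseteq> {m. keys m \<subseteq> V}" "finite A" "t = \<Psi> ` A"
      by (meson finite_subset_image)
    have "A \<subseteq> monos_le V (\<Sum>m\<in>A. exponent_degree m)"
    proof
      fix m assume m: "m \<in> A"
      then have "exponent_degree m \<le> (\<Sum>m\<in>A. exponent_degree m)"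
        using A(2) by (intro member_le_sum) auto
      then show "m \<in> monos_le V (\<Sum>m\<in>A. exponent_degree m)"
        using A(1) m by (auto simp: monos_le_def)
    qed
    then have "mp.dependent (\<Psi> ` monos_le V (\<Sum>m\<in>A. exponent_degree m))"
      unfolding mp.dependent_explicit using t A(3) by blast
    then show False using ind by blast
  qed
  show "polys V \<subseteq> mp.span (\<Psi> ` {m. keys m \<subseteq> V})"
  proof
    fix p :: "('v, 'k) mpoly" assume p: "p \<in> polys V"
    have "monomial ` keys p \<subseteq> mp.span (\<Psi> ` {m. keys m \<subseteq> V})"
    proof safe
      fix m assume "m \<in> keys p"
      then have "monomial m \<in> mp.span (\<Psi> ` monos_le V (exponent_degree m))"
        using p mono_span by (auto simp: polys_def)
      also have "\<dots> \<subseteq> mp.span (\<Psi> ` {m. keys m \<subseteq> V})"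
        by (intro mp.span_mono image_mono) (auto simp: monos_le_def)
      finally show "monomial m \<in> mp.span (\<Psi> ` {m. keys m \<subseteq> V})" .
    qed
    then show "p \<in> mp.span (\<Psi> ` {m. keys m \<subseteq> V})"
      using poly_in_span_monomials[of p] mp.span_minimal[OF _ mp.subspace_span] by blast
  qed
qed

section \<open>Regular sequences\<close>

text \<open>The vertices \<open>x i\<close> and \<open>z i\<close> are those of $e_1 \cap X^{i+1}$ and $e_2 \cap X^{d-i}$, and \<open>S\<close> is the
  set of all $|e \cap e_1|$ for edges \<open>e\<close>.\<close>

locale staircase =
  fixes V :: "'v set" and x z :: "nat \<Rightarrow> 'v" and d :: nat and S :: "nat set"
  assumes d_pos: "0 < d"
    and inj_x: "inj_on x {..<d}" and inj_z: "inj_on z {..<d}"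
    and disj: "x ` {..<d} \<inter> z ` {..<d} = {}"
    and V_eq: "V = x ` {..<d} \<union> z ` {..<d}"
    and S_le: "\<And>s. s \<in> S \<Longrightarrow> s \<le> d"
begin

definition "nonbase = V - {x 0, z 0}"

definition generator :: "nat \<Rightarrow> ('v, 'k::field) mpoly" where
  "generator s = (\<Prod>i<s. var (x i)) * (\<Prod>i<d - s. var (z i))"

definition base :: "'v \<Rightarrow> 'v" where
  "base v = (if v \<in> x ` {..<d} then x 0 else z 0)"

text \<open>The continuation of the sequence by \<open>v\<close> itself beyond \<open>d\<close> only serves to make the basis below
  infinite in both base variables.\<close>

definition corner :: "'v \<Rightarrow> nat \<Rightarrow> 'v" where
  "corner v i = (if i < d then (if v = x 0 then x i else z i) else v)"

definition theta :: "'v \<Rightarrow> ('v, 'k::field) mpoly" where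
  "theta v = var v - var (base v)"

lemma finite_V: "finite V"
  by (simp add: V_eq)

lemma xz_V: "x 0 \<in> V" "z 0 \<in> V" "x 0 \<noteq> z 0"
  using d_pos disj by (auto simp: V_eq)

lemma base_in: "base v \<in> {x 0, z 0}"
  by (simp add: base_def)

lemma corner_in: "b \<in> {x 0, z 0} \<Longrightarrow> corner b i \<in> V"
  using xz_V by (auto simp: corner_def V_eq)

lemma base_corner:
  assumes "b \<in> {x 0, z 0}"
  shows "base (corner b i) = b"
proof -
  have "z j \<notin> x ` {..<d}" if "j < d" for j using disj that by blast
  then show ?thesis
    using assms d_pos xz_V(3) by (auto simp: base_def corner_def)
qed

lemma card_V: "card V = 2 * d"
  unfolding V_eq using inj_x inj_z disj by (subst card_Un_disjoint) (auto simp: card_image)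

lemma card_nonbase: "card nonbase = 2 * d - 2"
  using xz_V finite_V by (simp add: nonbase_def card_Diff_subset card_V)

lemma theta_polys: "v \<in> V \<Longrightarrow> theta v \<in> polys V"
  using base_in[of v] xz_V unfolding theta_def by (intro polys_diff) auto

end

text \<open>The maximal ideal is abstracted away: monic polynomials of any positive degrees in the
  differences work equally well, and the ideal only enters when \<open>D\<close> and
  \<open>c\<close> are chosen.\<close>

locale staircase_system = staircase V x z d S
  for V :: "'v set" and x z d S +
  fixes D :: "'v \<Rightarrow> nat" and c :: "'v \<Rightarrow> nat \<Rightarrow> 'k::field"
  assumes D_pos: "\<And>v. v \<in> nonbase \<Longrightarrow> 0 < D v"
begin

definition theta_poly :: "'v \<Rightarrow> ('v, 'k) mpoly" where
  "theta_poly v = theta v ^ D v + (\<Sum>i<D v. scal (c v i) (theta v ^ i))"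

text \<open>For a nonbase vertex this is the basis of expansions in powers of
  \<open>theta_poly v\<close>, with quotient and remainder of \<open>k\<close> packed into one
  index. As \<open>theta_poly v\<close> is monic, the factor has degree \<open>k\<close> in
  \<open>theta v\<close>, so ordinary exponent vectors can index the basis and degrees match those
  of monomials.\<close>

definition factor :: "'v \<Rightarrow> nat \<Rightarrow> ('v, 'k) mpoly" where
  "factor v k = (if v \<in> nonbase then theta v ^ (k mod D v) * theta_poly v ^ (k div D v) else (\<Prod>i<k. var (corner v i)))"

definition basis_elem :: "('v \<Rightarrow>\<^sub>0 nat) \<Rightarrow> ('v, 'k) mpoly" where
  "basis_elem m = (\<Prod>v\<in>V. factor v (lookup m v))"

definition exponents :: "('v \<Rightarrow>\<^sub>0 nat) set" where
  "exponents = {m. keys m \<subseteq> V}"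

text \<open>Multiplication by a variable sends a basis element to a combination of basis elements whose
  exponents are larger in this sense, so that it preserves the ideals spanned by basis elements.\<close>

definition below :: "('v \<Rightarrow>\<^sub>0 nat) \<Rightarrow> ('v \<Rightarrow>\<^sub>0 nat) \<Rightarrow> bool" where
  "below m n \<longleftrightarrow> (\<forall>b\<in>{x 0, z 0}. lookup m b \<le> lookup n b) \<and>
    (\<forall>v\<in>nonbase. lookup m v div D v \<le> lookup n v div D v)"

text \<open>The degree bound serves the proof that the family is a basis, the relation
  \<open>below\<close> the proof that certain spans are ideals.\<close>

definition above :: "('v \<Rightarrow>\<^sub>0 nat) \<Rightarrow> ('v \<Rightarrow>\<^sub>0 nat) set" where
  "above m = {n. keys n \<subseteq> V \<and> exponent_degree n \<le> Suc (exponent_degree m) \<and> below m n}"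

section \<open>Multiplication by variables in the new basis\<close>

lemma factor_0 [simp]: "factor v 0 = 1"
  by (simp add: factor_def)

lemma theta_poly_polys: "v \<in> V \<Longrightarrow> theta_poly v \<in> polys V"
  unfolding theta_poly_def using theta_polys by (intro polys_add polys_sum polys_scal polys_power)

lemma factor_polys: "v \<in> V \<Longrightarrow> factor v k \<in> polys V"
proof (cases "v \<in> nonbase")
  case False
  moreover assume "v \<in> V"
  ultimately have "v \<in> {x 0, z 0}" by (auto simp: nonbase_def)
  then show ?thesis
    using False corner_in by (auto simp: factor_def intro!: polys_prod)
qed (auto simp: factor_def intro!: polys_mult polys_power theta_polys theta_poly_polys)

lemma basis_elem_polys: "basis_elem m \<in> polys V"
  unfolding basis_elem_def using factor_polys by (intro polys_prod)

lemma basis_elem_0: "basis_elem 0 = 1"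
  by (simp add: basis_elem_def)

lemma basis_elem_split: "v \<in> V \<Longrightarrow> basis_elem m = factor v (lookup m v) * (\<Prod>w\<in>V - {v}. factor w (lookup m w))"
  unfolding basis_elem_def by (rule prod.remove[OF finite_V])

lemma basis_elem_update:
  assumes "v \<in> V"
  shows "basis_elem (Poly_Mapping.update v i m) = factor v i * (\<Prod>w\<in>V - {v}. factor w (lookup m w))"
proof -
  have "(\<Prod>w\<in>V - {v}. factor w (lookup (Poly_Mapping.update v i m) w)) =
      (\<Prod>w\<in>V - {v}. factor w (lookup m w))"
    by (intro prod.cong) (auto simp: lookup_update)
  then show ?thesis
    using basis_elem_split[OF assms, of "Poly_Mapping.update v i m"] by (simp add: lookup_update)
qed

lemma update_above:
  assumes m: "m \<in> exponents" and v: "v \<in> V" and "i \<le> Suc (lookup m v)"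
    and "v \<in> nonbase \<Longrightarrow> lookup m v div D v \<le> i div D v"
    and "v \<notin> nonbase \<Longrightarrow> lookup m v \<le> i"
  shows "Poly_Mapping.update v i m \<in> above m"
proof -
  have keys: "keys (Poly_Mapping.update v i m) \<subseteq> V"
    using m v by (auto simp: exponents_def keys_update split: if_splits)
  have "(\<Sum>w\<in>V - {v}. lookup (Poly_Mapping.update v i m) w) = (\<Sum>w\<in>V - {v}. lookup m w)"
    by (intro sum.cong) (auto simp: lookup_update)
  then have "exponent_degree (Poly_Mapping.update v i m) = i + (\<Sum>w\<in>V - {v}. lookup m w)"
    using exponent_degree_superset[OF finite_V keys] finite_V v
    by (simp add: sum.remove[of V v] lookup_update[of v i m v])
  also have "\<dots> \<le> Suc (lookup m v + (\<Sum>w\<in>V - {v}. lookup m w))"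
    using assms(3) by simp
  also have "\<dots> = Suc (exponent_degree m)"
    using exponent_degree_superset[OF finite_V, of m] m finite_V v
    by (simp add: sum.remove[of V v] exponents_def)
  finally show ?thesis
    using keys assms(4,5) by (auto simp: above_def below_def lookup_update nonbase_def)
qed

text \<open>If the remainder of \<open>k\<close> can still grow, the product is the next factor.
  Otherwise \<open>theta v ^ D v\<close> is replaced by \<open>theta_poly v\<close> minus lower
  powers, which gives the next factor and factors with the same quotient: remainders may drop,
  quotients do not.\<close>

lemma theta_factor:
  assumes v: "v \<in> nonbase"
  shows "theta v * factor v k \<in> mp.span (factor v ` {i. i \<le> Suc k \<and> k div D v \<le> i div D v})"
proof -
  let ?B = "factor v ` {i. i \<le> Suc k \<and> k div D v \<le> i div D v}"
  define q r where "q = k div D v" and "r = k mod D v"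
  have D: "0 < D v" using D_pos[OF v] .
  have k: "k = q * D v + r" "r < D v" using D by (auto simp: q_def r_def)
  have factor: "factor v (q' * D v + r') = theta v ^ r' * theta_poly v ^ q'" if "r' < D v" for q' r'
    using that v by (simp add: factor_def)
  have Suc_in: "factor v (Suc k) \<in> mp.span ?B"
    by (intro mp.span_base imageI) (simp add: div_le_mono)
  show ?thesis
  proof (cases "Suc r < D v")
    case True
    have "theta v * factor v k = factor v (q * D v + Suc r)"
      using factor[OF True, of q] factor[OF k(2), of q] k(1) by (simp add: mult_ac)
    then show ?thesis using Suc_in k(1) by simp
  next
    case False
    then have Dv: "D v = Suc r" using k(2) by simp
    have "theta v * factor v k = theta v ^ D v * theta_poly v ^ q"
      using factor[OF k(2), of q] k(1) by (simp add: Dv mult_ac)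
    also have "\<dots> = theta_poly v ^ Suc q - (\<Sum>i<D v. scal (c v i) (theta v ^ i * theta_poly v ^ q))"
      by (simp add: theta_poly_def algebra_simps sum_distrib_left sum_distrib_right)
    also have "theta_poly v ^ Suc q = factor v (Suc k)"
      using factor[OF D, of "Suc q"] k(1) Dv by (simp add: algebra_simps)
    also have "(\<Sum>i<D v. scal (c v i) (theta v ^ i * theta_poly v ^ q)) = (\<Sum>i<D v. scal (c v i) (factor v (q * D v + i)))"
      by (intro sum.cong) (simp_all add: factor)
    also have "factor v (Suc k) - \<dots> \<in> mp.span ?B"
    proof (intro mp.span_diff Suc_in mp.span_sum mp.span_scale mp.span_base imageI)
      fix i assume i: "i \<in> {..<D v}"
      then have "(q * D v + i) div D v = q" by simp
      then show "q * D v + i \<in> {i. i \<le> Suc k \<and> k div D v \<le> i div D v}"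
        using k(1) Dv i unfolding q_def[symmetric] mem_Collect_eq lessThan_iff
        by (intro conjI) linarith+
    qed
    finally show ?thesis .
  qed
qed

lemma theta_basis_elem:
  assumes v: "v \<in> nonbase" and m: "m \<in> exponents"
  shows "theta v * basis_elem m \<in> mp.span (basis_elem ` above m)"
proof -
  let ?k = "lookup m v"
  let ?R = "\<Prod>w\<in>V - {v}. factor w (lookup m w)"
  have vV: "v \<in> V" using v by (simp add: nonbase_def)
  have "theta v * basis_elem m = ?R * (theta v * factor v ?k)"
    by (simp add: basis_elem_split[OF vV, of m] mult_ac)
  also have "\<dots> \<in> mp.span ((*) ?R ` factor v ` {i. i \<le> Suc ?k \<and> ?k div D v \<le> i div D v})"
    by (rule span_mult_image[OF theta_factor[OF v]])
  also have "\<dots> \<subseteq> mp.span (basis_elem ` above m)"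
  proof (rule mp.span_mono, safe)
    fix i assume "i \<le> Suc ?k" "?k div D v \<le> i div D v"
    then have "Poly_Mapping.update v i m \<in> above m" by (intro update_above m vV) (use v in auto)
    moreover have "?R * factor v i = basis_elem (Poly_Mapping.update v i m)"
      by (simp add: basis_elem_update[OF vV] mult.commute)
    ultimately show "?R * factor v i \<in> basis_elem ` above m" by blast
  qed
  finally show ?thesis .
qed

text \<open>Write \<open>var b\<close> as \<open>var ?w - theta ?w\<close> for the next corner
  \<open>?w\<close>. The first part lengthens the initial product, the second is covered by
  \<open>theta_basis_elem\<close>. If the corner is \<open>b\<close> itself, which happens at
  exponent 0 and from \<open>d\<close> on, the difference is 0.\<close>

lemma base_var_basis_elem:
  assumes b: "b \<in> {x 0, z 0}" and m: "m \<in> exponents"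
  shows "var b * basis_elem m \<in> mp.span (basis_elem ` above m)"
proof -
  let ?k = "lookup m b"
  let ?w = "corner b ?k"
  have bV: "b \<in> V" "b \<notin> nonbase" using b xz_V by (auto simp: nonbase_def)
  have "var b * basis_elem m = var ?w * basis_elem m - theta ?w * basis_elem m"
    by (simp add: theta_def base_corner[OF b] left_diff_distrib)
  also have "var ?w * basis_elem m = basis_elem (Poly_Mapping.update b (Suc ?k) m)"
    using bV by (simp add: basis_elem_split[OF bV(1), of m] basis_elem_update[OF bV(1)] factor_def mult_ac)
  also have "basis_elem (Poly_Mapping.update b (Suc ?k) m) - theta ?w * basis_elem m \<in> mp.span (basis_elem ` above m)"
  proof (rule mp.span_diff)
    show "basis_elem (Poly_Mapping.update b (Suc ?k) m) \<in> mp.span (basis_elem ` above m)"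
      by (intro mp.span_base imageI update_above m bV) (use bV in auto)
    show "theta ?w * basis_elem m \<in> mp.span (basis_elem ` above m)"
    proof (cases "?w \<in> nonbase")
      case True
      then show ?thesis by (rule theta_basis_elem[OF _ m])
    next
      case False
      then have w: "?w \<in> {x 0, z 0}" using corner_in[OF b] by (auto simp: nonbase_def)
      then have "base ?w = ?w"
        using d_pos xz_V(3) disj by (auto simp: base_def)
      then have "theta ?w = (0 :: ('v, 'k) mpoly)" by (simp add: theta_def)
      then show ?thesis by (simp add: mp.span_zero)
    qed
  qed
  finally show ?thesis .
qed

lemma var_basis_elem:
  assumes v: "v \<in> V" and m: "m \<in> exponents"
  shows "var v * basis_elem m \<in> mp.span (basis_elem ` above m)"
proof (cases "v \<in> nonbase")
  case True
  have "var v * basis_elem m = theta v * basis_elem m + var (base v) * basis_elem m"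
    by (simp add: theta_def algebra_simps)
  then show ?thesis
    using theta_basis_elem[OF True m] base_var_basis_elem[OF base_in m] by (simp add: mp.span_add)
next
  case False
  then show ?thesis using v by (intro base_var_basis_elem m) (auto simp: nonbase_def)
qed

lemma basis_elem_basis: "inj_on basis_elem exponents" "mp.independent (basis_elem ` exponents)" "polys V \<subseteq> mp.span (basis_elem ` exponents)"
proof -
  have "var v * basis_elem m \<in> mp.span (basis_elem ` monos_le V (Suc (exponent_degree m)))"
    if "v \<in> V" "keys m \<subseteq> V" for v m
  proof -
    have "var v * basis_elem m \<in> mp.span (basis_elem ` above m)" using that by (intro var_basis_elem) (auto simp: exponents_def)
    also have "\<dots> \<subseteq> mp.span (basis_elem ` monos_le V (Suc (exponent_degree m)))"
      by (intro mp.span_mono image_mono) (auto simp: above_def monos_le_def)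
    finally show ?thesis .
  qed
  note * = basis_of_spanning_family[OF finite_V basis_elem_0 this, folded exponents_def]
  show "inj_on basis_elem exponents" "mp.independent (basis_elem ` exponents)" "polys V \<subseteq> mp.span (basis_elem ` exponents)"
    using * by auto
qed

text \<open>The indices of basis elements that visibly contain a generator: some
  \<open>generator s\<close> inside the two initial products, or a factor
  \<open>theta_poly v\<close> with \<open>v \<in> A\<close>.\<close>

definition up_set :: "'v set \<Rightarrow> ('v \<Rightarrow>\<^sub>0 nat) set" where
  "up_set A = {m \<in> exponents. (\<exists>s\<in>S. s \<le> lookup m (x 0) \<and> d - s \<le> lookup m (z 0)) \<or>
    (\<exists>v\<in>A. D v \<le> lookup m v)}"

definition ideal_span :: "'v set \<Rightarrow> ('v, 'k) mpoly set" where
  "ideal_span A = mp.span (basis_elem ` up_set A)"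

text \<open>The bound \<open>D v \<le> lookup m v\<close> says that the quotient by
  \<open>D v\<close> is at least 1. Exponents of nonbase vertices may decrease in
  \<open>above m\<close> but their quotients may not, which is why \<open>below\<close> compares
  quotients there.\<close>

lemma up_set_above:
  assumes A: "A \<subseteq> nonbase" and m: "m \<in> up_set A" and n: "n \<in> above m"
  shows "n \<in> up_set A"
proof -
  have "D v \<le> lookup n v" if v: "v \<in> A" "D v \<le> lookup m v" for v
  proof -
    have "1 \<le> lookup m v div D v"
      using v A D_pos by (auto simp: Suc_le_eq div_greater_zero_iff)
    also have "\<dots> \<le> lookup n v div D v"
      using n A v by (auto simp: above_def below_def)
    finally show ?thesis by (metis Suc_le_eq div_greater_zero_iff One_nat_def)
  qed
  moreover have "lookup m (x 0) \<le> lookup n (x 0)"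
    "lookup m (z 0) \<le> lookup n (z 0)"
    using n by (auto simp: above_def below_def)
  moreover have "n \<in> exponents" using n by (simp add: above_def exponents_def)
  ultimately show ?thesis
    using m unfolding up_set_def by (blast intro: order_trans)
qed

lemma ideal_span_pideal:
  assumes A: "A \<subseteq> nonbase"
  shows "pideal V (ideal_span A)"
proof (rule pidealI)
  show "mp.subspace (ideal_span A)" by (simp add: ideal_span_def)
  show "ideal_span A \<subseteq> polys V"
    unfolding ideal_span_def using basis_elem_polys by (intro mp.span_minimal subspace_polys) auto
  fix v p assume v: "v \<in> V" and "p \<in> ideal_span A"
  then have "var v * p \<in> mp.span ((*) (var v) ` basis_elem ` up_set A)"
    unfolding ideal_span_def by (intro span_mult_image)
  also have "\<dots> \<subseteq> ideal_span A"
    unfolding ideal_span_def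
  proof (rule mp.span_minimal, safe)
    fix m assume m: "m \<in> up_set A"
    then have "var v * basis_elem m \<in> mp.span (basis_elem ` above m)"
      using v by (intro var_basis_elem) (auto simp: up_set_def)
    also have "\<dots> \<subseteq> mp.span (basis_elem ` up_set A)"
      using up_set_above[OF A m] by (intro mp.span_mono image_mono) auto
    finally show "var v * basis_elem m \<in> mp.span (basis_elem ` up_set A)" .
  qed
  finally show "var v * p \<in> ideal_span A" .
qed

lemma basis_elem_single:
  assumes "v \<in> V"
  shows "basis_elem (single v k) = factor v k"
proof -
  have "(\<Prod>w\<in>V - {v}. factor w (lookup (single v k) w)) = 1"
    by (intro prod.neutral) (auto simp: lookup_single when_def)
  then show ?thesis by (simp add: basis_elem_split[OF assms])
qed

lemma theta_poly_eq_basis_elem: "v \<in> nonbase \<Longrightarrow> theta_poly v = basis_elem (single v (D v))"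
  using D_pos[of v] basis_elem_single[of v "D v"] by (auto simp: nonbase_def factor_def)

lemma factor_corner: "factor (x 0) a = (\<Prod>i<a. var (corner (x 0) i))"
  "factor (z 0) a = (\<Prod>i<a. var (corner (z 0) i))"
  by (simp_all add: factor_def nonbase_def)

lemma generator_eq:
  assumes "s \<le> d"
  shows "generator s = factor (x 0) s * factor (z 0) (d - s)"
proof -
  have "(\<Prod>i<s. var (x i)) = factor (x 0) s"
    unfolding factor_corner using assms by (intro prod.cong) (auto simp: corner_def)
  moreover have "(\<Prod>i<d - s. var (z i)) = factor (z 0) (d - s)"
    unfolding factor_corner using assms xz_V(3) by (intro prod.cong) (auto simp: corner_def)
  ultimately show ?thesis by (simp add: generator_def)
qed

lemma basis_elem_split2:
  "basis_elem m = factor (x 0) (lookup m (x 0)) * factor (z 0) (lookup m (z 0)) *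
    (\<Prod>v\<in>nonbase. factor v (lookup m v))"
proof -
  have "V - {x 0} - {z 0} = nonbase" by (auto simp: nonbase_def)
  then show ?thesis
    using basis_elem_split[OF xz_V(1), of m] finite_V xz_V
    by (simp add: prod.remove[of "V - {x 0}" "z 0"] mult.assoc)
qed

lemma factor_dvd:
  assumes "b \<in> {x 0, z 0}" "k \<le> l"
  shows "\<exists>q\<in>polys V. factor b l = factor b k * q"
proof (intro bexI)
  have "{..<l} = {..<k} \<union> {k..<l}" using assms(2) by auto
  then show "factor b l = factor b k * (\<Prod>i\<in>{k..<l}. var (corner b i))"
    using assms(1) unfolding factor_def nonbase_def
    by (auto simp: prod.union_disjoint ivl_disj_int)
  show "(\<Prod>i\<in>{k..<l}. var (corner b i)) \<in> polys V"
    using corner_in[OF assms(1)] by (intro polys_prod) auto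
qed

text \<open>Each generator is itself a basis element with index in \<open>up_set A\<close>, and each
  basis element indexed there has a generator as a factor. Because \<open>s \<le> d\<close>, only
  corners before the artificial continuation enter \<open>generator s\<close>.\<close>

lemma ideal_span_eq_genideal:
  fixes K :: "'k itself"
  assumes A: "A \<subseteq> nonbase"
  shows "Idl\<^bsub>mpoly_ring K V\<^esub> (generator ` S \<union> theta_poly ` A) = ideal_span A"
proof
  let ?G = "generator ` S \<union> theta_poly ` A"
  have gen_basis_elem: "generator s = basis_elem (single (x 0) s + single (z 0) (d - s))"
    if "s \<in> S" for s
  proof -
    have "(\<Prod>v\<in>nonbase. factor v (lookup (single (x 0) s + single (z 0) (d - s)) v)) = 1"
      by (intro prod.neutral) (auto simp: nonbase_def lookup_add lookup_single when_def)
    then show ?thesis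
      using xz_V(3) by (simp add: basis_elem_split2 generator_eq[OF S_le[OF that]] lookup_add lookup_single when_def)
  qed
  have "?G \<subseteq> ideal_span A"
  proof safe
    fix s assume s: "s \<in> S"
    have "single (x 0) s + single (z 0) (d - s) \<in> up_set A"
      using s xz_V by (auto simp: up_set_def exponents_def keys_add_nat lookup_add lookup_single when_def split: if_splits)
    then show "generator s \<in> ideal_span A" unfolding ideal_span_def gen_basis_elem[OF s] by (intro mp.span_base imageI)
  next
    fix v assume v: "v \<in> A"
    then have "single v (D v) \<in> exponents" "D v \<le> lookup (single v (D v)) v"
      using A by (auto simp: exponents_def nonbase_def)
    then have "single v (D v) \<in> up_set A"
      using v unfolding up_set_def by blast
    then show "theta_poly v \<in> ideal_span A" using theta_poly_eq_basis_elem[of v] v A by (auto simp: ideal_span_def intro: mp.span_base)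
  qed
  then show "Idl\<^bsub>mpoly_ring K V\<^esub> ?G \<subseteq> ideal_span A" by (rule genideal_mpoly_minimal[OF ideal_span_pideal[OF A]])
  have G_polys: "?G \<subseteq> polys V" using \<open>?G \<subseteq> ideal_span A\<close> ideal_span_pideal[OF A] by (auto simp: pideal_def)
  note I = pideal_genideal[OF G_polys, of K] and sub = genideal_mpoly_subset[OF G_polys, of K]
  show "ideal_span A \<subseteq> Idl\<^bsub>mpoly_ring K V\<^esub> ?G"
    unfolding ideal_span_def
  proof (rule mp.span_minimal[OF _ pideal_subspace[OF I]], safe)
    fix m assume m: "m \<in> up_set A"
    let ?l = "lookup m"
    consider s where "s \<in> S" "s \<le> ?l (x 0)" "d - s \<le> ?l (z 0)" | v where "v \<in> A" "D v \<le> ?l v"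
      using m by (auto simp: up_set_def)
    then show "basis_elem m \<in> Idl\<^bsub>mpoly_ring K V\<^esub> ?G"
    proof cases
      case 1
      obtain q q' where q: "q \<in> polys V" "factor (x 0) (?l (x 0)) = factor (x 0) s * q"
        "q' \<in> polys V" "factor (z 0) (?l (z 0)) = factor (z 0) (d - s) * q'"
        using factor_dvd[of "x 0" s] factor_dvd[of "z 0" "d - s"] 1 by blast
      have "basis_elem m = (q * q' * (\<Prod>v\<in>nonbase. factor v (?l v))) * generator s"
        unfolding basis_elem_split2 q generator_eq[OF S_le[OF 1(1)]] by (simp add: mult_ac)
      moreover have "q * q' * (\<Prod>v\<in>nonbase. factor v (?l v)) \<in> polys V"
        using q factor_polys by (intro polys_mult polys_prod) (auto simp: nonbase_def)
      ultimately show ?thesis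
        using pideal_mult_left[OF I, of "generator s"] sub 1(1) by auto
    next
      case 2
      then have v: "v \<in> nonbase" "v \<in> V" using A by (auto simp: nonbase_def)
      have "?l v div D v = Suc (?l v div D v - 1)"
        using 2(2) D_pos[OF v(1)] by (simp add: Suc_leI div_greater_zero_iff)
      then have "factor v (?l v) = (theta v ^ (?l v mod D v) * theta_poly v ^ (?l v div D v - 1)) * theta_poly v"
        using v by (metis factor_def power_Suc2 mult.assoc)
      then have "basis_elem m = (theta v ^ (?l v mod D v) * theta_poly v ^ (?l v div D v - 1) * (\<Prod>w\<in>V - {v}. factor w (?l w))) * theta_poly v"
        by (simp add: basis_elem_split[OF v(2)] mult_ac)
      moreover have "theta v ^ (?l v mod D v) * theta_poly v ^ (?l v div D v - 1) * (\<Prod>w\<in>V - {v}. factor w (?l w)) \<in> polys V"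
        using v theta_polys theta_poly_polys factor_polys by (intro polys_mult polys_power polys_prod) auto
      ultimately show ?thesis
        using pideal_mult_left[OF I, of "theta_poly v"] sub 2(1) by auto
    qed
  qed
qed

section \<open>Regularity of the monic polynomials\<close>

lemma theta_poly_basis_elem:
  assumes v: "v \<in> nonbase"
  shows "theta_poly v * basis_elem m = basis_elem (m + single v (D v))"
proof -
  have vV: "v \<in> V" using v by (simp add: nonbase_def)
  have "factor v (lookup m v + D v) = theta_poly v * factor v (lookup m v)"
    using v D_pos[OF v] by (simp add: factor_def mult_ac)
  moreover have "(\<Prod>w\<in>V - {v}. factor w (lookup (m + single v (D v)) w)) =
      (\<Prod>w\<in>V - {v}. factor w (lookup m w))"
    by (intro prod.cong) (auto simp: lookup_add lookup_single when_def)
  ultimately show ?thesis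
    by (simp add: basis_elem_split[OF vV] lookup_add mult.assoc)
qed

text \<open>Split \<open>a\<close> into its parts inside and outside \<open>up_set A\<close>.
  Multiplication by \<open>theta_poly v\<close> only raises the exponent at \<open>v\<close>, and
  \<open>v\<close> is not in \<open>A\<close>, so indices outside stay outside. The product with the
  outside part then lies in the spans of two disjoint parts of a basis and is 0, and
  \<open>theta_poly v\<close> can be cancelled.\<close>

lemma theta_poly_regular:
  assumes A: "A \<subseteq> nonbase" and v: "v \<in> nonbase - A" and a: "a \<in> polys V" and fa: "theta_poly v * a \<in> ideal_span A"
  shows "a \<in> ideal_span A"
proof -
  let ?\<sigma> = "\<lambda>m. m + single v (D v)"
  have vW: "v \<in> nonbase" "v \<in> V" using v by (auto simp: nonbase_def)
  have TM: "up_set A \<subseteq> exponents" by (auto simp: up_set_def)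
  have \<sigma>: "?\<sigma> m \<in> exponents - up_set A" if "m \<in> exponents - up_set A" for m
  proof -
    have "lookup (?\<sigma> m) w = lookup m w" if "w \<noteq> v" for w
      using that by (simp add: lookup_add lookup_single when_def)
    moreover have "x 0 \<noteq> v" "z 0 \<noteq> v" "\<And>w. w \<in> A \<Longrightarrow> w \<noteq> v" using v by (auto simp: nonbase_def)
    ultimately show ?thesis using that vW by (auto simp: up_set_def exponents_def keys_add_nat split: if_splits)
  qed
  have "basis_elem ` exponents = basis_elem ` up_set A \<union> basis_elem ` (exponents - up_set A)" using TM by auto
  then obtain a1 a2 where a12: "a = a1 + a2" "a1 \<in> mp.span (basis_elem ` up_set A)" "a2 \<in> mp.span (basis_elem ` (exponents - up_set A))"
    using a basis_elem_basis(3) by (auto simp: mp.span_Un)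
  have "theta_poly v * a1 \<in> ideal_span A"
    using a12(2) pideal_mult_left[OF ideal_span_pideal[OF A] _ theta_poly_polys[OF vW(2)]] by (simp add: ideal_span_def)
  then have "theta_poly v * a - theta_poly v * a1 \<in> ideal_span A"
    by (rule pideal_diff[OF ideal_span_pideal[OF A] fa])
  then have "theta_poly v * a2 \<in> ideal_span A" by (simp add: a12(1) distrib_left)
  moreover have "theta_poly v * a2 \<in> mp.span (basis_elem ` (exponents - up_set A))"
  proof -
    have "theta_poly v * a2 \<in> mp.span ((*) (theta_poly v) ` basis_elem ` (exponents - up_set A))" by (rule span_mult_image[OF a12(3)])
    also have "\<dots> \<subseteq> mp.span (basis_elem ` (exponents - up_set A))"
    proof (rule mp.span_mono, rule subsetI)
      fix p assume "p \<in> (*) (theta_poly v) ` basis_elem ` (exponents - up_set A)"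
      then obtain m where "m \<in> exponents - up_set A" "p = theta_poly v * basis_elem m" by blast
      then show "p \<in> basis_elem ` (exponents - up_set A)" using \<sigma>[of m] theta_poly_basis_elem[OF vW(1), of m] by auto
    qed
    finally show ?thesis .
  qed
  moreover have "basis_elem ` up_set A \<inter> basis_elem ` (exponents - up_set A) = {}"
    using inj_on_image_Int[OF basis_elem_basis(1) TM, of "exponents - up_set A"] by auto
  ultimately have "theta_poly v * a2 = 0"
    using TM by (intro mp.span_Int_disjoint[OF basis_elem_basis(2), of "basis_elem ` up_set A" "basis_elem ` (exponents - up_set A)"])
      (auto simp: ideal_span_def)
  moreover have "theta_poly v \<noteq> 0"
  proof
    assume "theta_poly v = 0"
    moreover have "single v (D v) \<in> exponents" using vW by (simp add: exponents_def)
    ultimately have "0 \<in> basis_elem ` exponents" using theta_poly_eq_basis_elem[OF vW(1)] by (metis imageI)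
    then show False using basis_elem_basis(2) mp.dependent_zero by blast
  qed
  moreover have "a2 \<in> polys V"
  proof -
    have "mp.span (basis_elem ` (exponents - up_set A)) \<subseteq> polys V"
      using basis_elem_polys by (intro mp.span_minimal subspace_polys) auto
    then show ?thesis using a12(3) by blast
  qed
  ultimately have "a2 = 0"
    using polys_no_zero_divisors[OF finite_V theta_poly_polys[OF vW(2)]] by blast
  then show ?thesis using a12 by (simp add: ideal_span_def)
qed

end

context staircase
begin

lemma generator_polys: "s \<in> S \<Longrightarrow> generator s \<in> polys V"
  unfolding generator_def using S_le[of s]
  by (intro polys_mult polys_prod) (auto simp: V_eq)

text \<open>The sequence runs through all nonbase vertices in arbitrary order, and the vertices
  before position \<open>i\<close> form the set \<open>A\<close> of
  \<open>theta_poly_regular\<close>. Keeping \<open>I\<close> among the generators prepares the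
  passage to the quotient by \<open>I\<close>.\<close>

lemma exists_regular_sequence:
  fixes N :: "('v, 'k::field) mpoly set" and K :: "'k itself"
  assumes N: "maximal_pideal V N" and I: "I = Idl\<^bsub>mpoly_ring K V\<^esub> (generator ` S)"
  shows "\<exists>fs. length fs = 2 * d - 2 \<and> set fs \<subseteq> N \<and>
    (\<forall>i<length fs. \<forall>a\<in>polys V. fs ! i * a \<in> Idl\<^bsub>mpoly_ring K V\<^esub> (I \<union> set (take i fs)) \<longrightarrow>
      a \<in> Idl\<^bsub>mpoly_ring K V\<^esub> (I \<union> set (take i fs)))"
proof -
  have WV: "nonbase \<subseteq> V" by (auto simp: nonbase_def)
  have "\<forall>v\<in>nonbase. \<exists>D c. 0 < D \<and> theta v ^ D + (\<Sum>i<D. scal (c i) (theta v ^ i)) \<in> N"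
    using algebraic_modulo_maximal[OF finite_V N] theta_polys WV by blast
  then obtain D c where "\<forall>v\<in>nonbase. 0 < D v \<and> theta v ^ D v + (\<Sum>i<D v. scal (c v i) (theta v ^ i)) \<in> N"
    unfolding bchoice_iff by (elim exE)
  then have Dc: "\<And>v. v \<in> nonbase \<Longrightarrow> 0 < D v"
    "\<And>v. v \<in> nonbase \<Longrightarrow> theta v ^ D v + (\<Sum>i<D v. scal (c v i) (theta v ^ i)) \<in> N"
    by (simp_all)
  interpret staircase_system V x z d S D c
    by unfold_locales (rule Dc(1))
  obtain vs where vs: "set vs = nonbase" "distinct vs"
    using finite_distinct_list finite_V WV finite_subset by metis
  \<comment> \<open>The ideal \<open>I\<close> and its set of generators produce the same ideal once
    further elements are added, so each ideal in the regularity test is spanned by basis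
    elements.\<close>
  have Idl_ideal_span: "Idl\<^bsub>mpoly_ring K V\<^esub> (I \<union> theta_poly ` A) = ideal_span A" if A: "A \<subseteq> nonbase" for A
  proof -
    have G: "generator ` S \<subseteq> polys V" "generator ` S \<union> theta_poly ` A \<subseteq> polys V"
      using generator_polys theta_poly_polys A WV by auto
    have ideal_span: "pideal V (ideal_span A)" by (rule ideal_span_pideal[OF A])
    have gen: "generator ` S \<union> theta_poly ` A \<subseteq> ideal_span A"
      using genideal_mpoly_subset[OF G(2), of K] ideal_span_eq_genideal[OF A, of K] by simp
    have IJ: "I \<union> theta_poly ` A \<subseteq> ideal_span A"
      unfolding I using genideal_mpoly_minimal[OF ideal_span, of "generator ` S" K] gen by auto
    then have IP: "I \<union> theta_poly ` A \<subseteq> polys V" using ideal_span by (auto simp: pideal_def)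
    show ?thesis
    proof
      show "Idl\<^bsub>mpoly_ring K V\<^esub> (I \<union> theta_poly ` A) \<subseteq> ideal_span A" by (rule genideal_mpoly_minimal[OF ideal_span IJ])
      have "generator ` S \<union> theta_poly ` A \<subseteq> Idl\<^bsub>mpoly_ring K V\<^esub> (I \<union> theta_poly ` A)"
        using genideal_mpoly_subset[OF IP, of K] genideal_mpoly_subset[OF G(1), of K] by (auto simp: I)
      then show "ideal_span A \<subseteq> Idl\<^bsub>mpoly_ring K V\<^esub> (I \<union> theta_poly ` A)"
        unfolding ideal_span_eq_genideal[OF A, of K, symmetric]
        by (rule genideal_mpoly_minimal[OF pideal_genideal[OF IP]])
    qed
  qed
  show ?thesis
  proof (intro exI[of _ "map theta_poly vs"] conjI allI impI ballI)
    show "length (map theta_poly vs) = 2 * d - 2"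
      using vs card_nonbase distinct_card[OF vs(2)] by simp
    show "set (map theta_poly vs) \<subseteq> N" using Dc(2) vs(1) by (auto simp: theta_poly_def)
    fix i and a :: "('v, 'k) mpoly"
    assume i: "i < length (map theta_poly vs)" and a: "a \<in> polys V"
    have take: "set (take i (map theta_poly vs)) = theta_poly ` set (take i vs)" by (simp add: take_map)
    have sub: "set (take i vs) \<subseteq> nonbase" using vs(1) set_take_subset by metis
    have "vs ! i \<notin> set (take i vs)"
      using vs(2) i by (auto simp: in_set_conv_nth nth_eq_iff_index_eq)
    moreover assume "map theta_poly vs ! i * a \<in> Idl\<^bsub>mpoly_ring K V\<^esub> (I \<union> set (take i (map theta_poly vs)))"
    ultimately have "a \<in> ideal_span (set (take i vs))"
      using theta_poly_regular[OF sub, of "vs ! i" a] i a vs(1) nth_mem[of i vs] unfolding take Idl_ideal_span[OF sub] by auto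
    then show "a \<in> Idl\<^bsub>mpoly_ring K V\<^esub> (I \<union> set (take i (map theta_poly vs)))"
      unfolding take Idl_ideal_span[OF sub] .
  qed
qed

end

section \<open>The Cohen--Macaulay property\<close>

lemma (in ring) maximalideal_vimage_Quot:
  assumes I: "ideal I R" and M: "maximalideal M (R Quot I)"
  shows "maximalideal {r \<in> carrier R. I +> r \<in> M} R" and "I \<subseteq> {r \<in> carrier R. I +> r \<in> M}"
proof -
  interpret I: ideal I R by (rule I)
  interpret M: maximalideal M "R Quot I" by (rule M)
  let ?N = "{r \<in> carrier R. I +> r \<in> M}"
  have N: "ideal ?N R"
    by (rule ring_hom_ring.ideal_vimage[OF I.rcos_ring_hom_ring M.is_ideal])
  show I_N: "I \<subseteq> ?N"
  proof
    fix r assume r: "r \<in> I"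
    then have "I +> r = \<zero>\<^bsub>R Quot I\<^esub>"
      using a_coset_join2[OF _ I.a_subgroup r] I.Icarr[OF r] by (simp add: FactRing_def)
    then show "r \<in> ?N"
      using I.Icarr[OF r] additive_subgroup.zero_closed[OF ideal.axioms(1)[OF M.is_ideal]] by simp
  qed
  show "maximalideal ?N R"
  proof (rule maximalidealI[OF N])
    show "carrier R \<noteq> ?N"
    proof
      assume eq: "carrier R = ?N"
      have "M = carrier (R Quot I)"
      proof
        show "M \<subseteq> carrier (R Quot I)" using M.a_subset .
        show "carrier (R Quot I) \<subseteq> M" unfolding carrier_Quot using eq by blast
      qed
      then show False using M.I_notcarr by simp
    qed
    fix J assume J: "ideal J R" "?N \<subseteq> J" "J \<subseteq> carrier R"
    have MJ: "M \<subseteq> (+>) I ` J"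
    proof
      fix y assume y: "y \<in> M"
      then obtain r where "r \<in> carrier R" "y = I +> r"
        using M.a_subset by (auto simp: carrier_Quot)
      then show "y \<in> (+>) I ` J" using y J(2) by auto
    qed
    have JI: "ideal ((+>) I ` J) (R Quot I)" by (rule ring_ideal_imp_quot_ideal[OF I J(1)])
    have "(+>) I ` J = M \<or> (+>) I ` J = carrier (R Quot I)"
      using M.I_maximal[OF JI MJ] J(3) by (auto simp: carrier_Quot)
    then show "J = ?N \<or> J = carrier R"
    proof
      assume "(+>) I ` J = M"
      then show ?thesis using J by auto
    next
      assume eq: "(+>) I ` J = carrier (R Quot I)"
      have "r \<in> J" if r: "r \<in> carrier R" for r
      proof -
        have "I +> r \<in> (+>) I ` J" using eq r by (simp add: carrier_Quot)
        then obtain j where j: "j \<in> J" "I +> r = I +> j" by blast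
        then have jc: "j \<in> carrier R" using J(3) by auto
        have "r \<ominus> j \<in> I" using quotient_eq_iff_same_a_r_cos[OF I r jc] j(2) by simp
        then have "(r \<ominus> j) \<oplus> j \<in> J"
          using I_N J(2) j(1) additive_subgroup.a_closed[OF ideal.axioms(1)[OF J(1)]] by auto
        moreover have "(r \<ominus> j) \<oplus> j = r" using r jc by algebra
        ultimately show ?thesis by simp
      qed
      then show ?thesis using J(3) by auto
    qed
  qed
qed

context staircase
begin

text \<open>The inequalities \<open>2 * d - 2\<close> \<le> depth \<le> height \<le>
  \<open>card V - 2\<close> close up because \<open>card V = 2 * d\<close>. The regular sequence
  depends on the maximal ideal and is found after pulling that ideal back to the polynomial
  ring.\<close>

lemma cohen_macaulay_Quot:
  fixes K :: "'k::field itself"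
  assumes "0 \<in> S" "d \<in> S"
  defines "I \<equiv> Idl\<^bsub>mpoly_ring K V\<^esub> (generator ` S)"
  shows "cohen_macaulay_ring (mpoly_ring K V Quot I)"
proof -
  let ?R = "mpoly_ring K V"
  let ?A = "?R Quot I"
  let ?\<pi> = "(+>\<^bsub>?R\<^esub>) I"
  have gen: "generator ` S \<subseteq> polys V" using generator_polys by auto
  have I: "pideal V I" unfolding I_def by (rule pideal_genideal[OF gen])
  have gen_I: "generator s \<in> I" if "s \<in> S" for s
    using genideal_mpoly_subset[OF gen, of K] that by (auto simp: I_def)
  interpret R: cring ?R by (rule cring_mpoly_ring)
  have I_ideal: "ideal I ?R" using I by (simp add: ideal_mpoly_ring_iff)
  interpret I: ideal I ?R by (rule I_ideal)
  interpret A: cring ?A by (rule I.quotient_is_cring[OF cring_mpoly_ring])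
  interpret h: ring_hom_cring ?R ?A ?\<pi>
    by (rule I.rcos_ring_hom_cring[OF cring_mpoly_ring])
  have "ideal_depth ?A M = prime_height ?A M" if M: "maximalideal M ?A" for M
  proof -
    interpret M: maximalideal M ?A by (rule M)
    have prime_M: "primeideal M ?A" by (rule A.maximalideal_prime[OF M])
    define N where "N = {r \<in> carrier ?R. ?\<pi> r \<in> M}"
    have N: "maximal_pideal V N"
      unfolding N_def by (rule maximalideal_mpoly_ring_imp[OF R.maximalideal_vimage_Quot(1)[OF I_ideal M]])
    obtain fs where fs: "length fs = 2 * d - 2" "set fs \<subseteq> N"
      and reg: "\<And>i a. i < length fs \<Longrightarrow> a \<in> polys V \<Longrightarrow> fs ! i * a \<in> Idl\<^bsub>?R\<^esub> (I \<union> set (take i fs)) \<Longrightarrow>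
        a \<in> Idl\<^bsub>?R\<^esub> (I \<union> set (take i fs))"
      using exists_regular_sequence[OF N I_def[THEN meta_eq_to_obj_eq]] by blast
    have fs_carr: "set fs \<subseteq> carrier ?R" using fs(2) by (auto simp: N_def)
    have fs_M: "set (map ?\<pi> fs) \<subseteq> M" using fs(2) by (auto simp: N_def)
    have "regular_sequence ?A (map ?\<pi> fs)"
      unfolding regular_sequence_def
    proof (intro conjI allI impI ballI)
      show "set (map ?\<pi> fs) \<subseteq> carrier ?A" using fs_M M.a_subset by blast
      have "Idl\<^bsub>?A\<^esub> (set (map ?\<pi> fs)) \<subseteq> M" by (rule A.genideal_minimal[OF M.is_ideal fs_M])
      then show "Idl\<^bsub>?A\<^esub> (set (map ?\<pi> fs)) \<noteq> carrier ?A"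
        using M.I_notcarr M.a_subset by blast
      fix i y assume i: "i < length (map ?\<pi> fs)" and y: "y \<in> carrier ?A"
        and prod: "map ?\<pi> fs ! i \<otimes>\<^bsub>?A\<^esub> y \<in> Idl\<^bsub>?A\<^esub> (set (take i (map ?\<pi> fs)))"
      obtain a where a: "a \<in> carrier ?R" "y = ?\<pi> a" using y by (auto simp: R.carrier_Quot)
      have take: "set (take i (map ?\<pi> fs)) = ?\<pi> ` set (take i fs)" by (simp add: take_map)
      have sub: "set (take i fs) \<subseteq> carrier ?R" using fs_carr set_take_subset by fast
      have fi: "fs ! i \<in> carrier ?R" using fs_carr i by auto
      have "?\<pi> (fs ! i * a) \<in> Idl\<^bsub>?A\<^esub> (?\<pi> ` set (take i fs))"
        using prod h.hom_mult[OF fi a(1)] i unfolding take a(2) by simp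
      moreover have "fs ! i * a \<in> carrier ?R" using R.m_closed[OF fi a(1)] by simp
      ultimately have "fs ! i * a \<in> Idl\<^bsub>?R\<^esub> (I \<union> set (take i fs))"
        using R.rcos_in_genideal_iff[OF I_ideal sub] by blast
      then have "a \<in> Idl\<^bsub>?R\<^esub> (I \<union> set (take i fs))" using reg[of i a] i a(1) by simp
      then show "y \<in> Idl\<^bsub>?A\<^esub> (set (take i (map ?\<pi> fs)))"
        unfolding take a(2) using R.rcos_in_genideal_iff[OF I_ideal sub a(1)] by blast
    qed
    then have "enat (2 * d - 2) \<le> ideal_depth ?A M"
      unfolding ideal_depth_def using fs(1) fs_M by (intro Sup_upper) (force intro!: exI[of _ "map ?\<pi> fs"])
    moreover have "ideal_depth ?A M \<le> prime_height ?A M"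
      by (rule A.ideal_depth_le_prime_height[OF prime_M])
    moreover have "prime_height ?A M \<le> enat (card V - 2)"
    proof (rule prime_height_Quot_le[OF finite_V I])
      fix P assume P: "prime_pideal V P" "I \<subseteq> P"
      \<comment> \<open>These are \<open>generator d\<close> and \<open>generator 0\<close>, the
        monomials of the two edges in the partition.\<close>
      have "(\<Prod>i<d. var (x i)) \<in> P" "(\<Prod>i<d. var (z i)) \<in> P"
        using gen_I[OF assms(2)] gen_I[OF assms(1)] P(2) by (auto simp: generator_def)
      then obtain a b where ab: "a < d" "var (x a) \<in> P" "b < d" "var (z b) \<in> P"
        using prime_pideal_prod[OF P(1), of "{..<d}" "\<lambda>i. var (x i)"]
          prime_pideal_prod[OF P(1), of "{..<d}" "\<lambda>i. var (z i)"] by (auto simp: V_eq)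
      moreover have "x a \<noteq> z b" using ab disj by blast
      ultimately show "\<exists>B\<subseteq>V. card B = 2 \<and> var ` B \<subseteq> P"
        by (intro exI[of _ "{x a, z b}"]) (auto simp: V_eq)
    qed
    ultimately show ?thesis by (simp add: card_V)
  qed
  moreover have "noetherian_ring ?A"
    by (rule noetherian_ring.noetherian_Quot[OF noetherian_mpoly_ring[OF finite_V] I_ideal])
  ultimately show ?thesis
    using A.cring_axioms by (simp add: cohen_macaulay_ring_def)
qed

end

section \<open>Linear quotients\<close>

lemma exists_add_iff: "(\<exists>t. m = n + t) \<longleftrightarrow> (\<forall>v. lookup n v \<le> (lookup m v :: nat))"
proof
  assume *: "\<forall>v. lookup n v \<le> lookup m v"
  show "\<exists>t. m = n + t"
    by (intro exI[of _ "m - n"] poly_mapping_eqI) (simp add: lookup_add lookup_minus *)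
qed (auto simp: lookup_add)

lemma exists_add_single_iff: "(\<exists>t. m = single v 1 + t) \<longleftrightarrow> 1 \<le> (lookup m v :: nat)"
  unfolding exists_add_iff by (auto simp: lookup_single when_def)

lemma exponent_degree_eq_0: "exponent_degree m = 0 \<Longrightarrow> m = 0"
  by (intro poly_mapping_eqI) (auto simp: exponent_degree_def in_keys_iff)

lemma keys_mult_monomial:
  "keys (p * monomial u) = (\<lambda>m. m + u) ` keys p"
proof
  show "keys (p * monomial u) \<subseteq> (\<lambda>m. m + u) ` keys p"
    using keys_mult[of p "monomial u"] by auto
  show "(\<lambda>m. m + u) ` keys p \<subseteq> keys (p * monomial u)"
  proof safe
    fix m assume m: "m \<in> keys p"
    have "p * monomial u = (\<Sum>n\<in>keys p. scal (lookup p n) (monomial (n + u)))"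
      by (subst poly_eq_sum_monomials[of p]) (simp add: sum_distrib_right monomial_add)
    then have "lookup (p * monomial u) (m + u) =
        (\<Sum>n\<in>keys p. if n = m then lookup p n else 0)"
      by (auto simp: lookup_sum lookup_scal mpoly_monomial_def lookup_single when_def
        if_distrib[of "(*) _"] cong: if_cong)
    then show "m + u \<in> keys (p * monomial u)"
      using m by (simp add: in_keys_iff)
  qed
qed

text \<open>Membership in a monomial ideal is decided exponent by exponent, which reduces colon
  ideals and minimality of generators to divisibility of monomials.\<close>

lemma monomial_ideal_eq:
  assumes "\<And>n. n \<in> M \<Longrightarrow> keys n \<subseteq> V"
  shows "Idl\<^bsub>mpoly_ring K V\<^esub> (monomial ` M) =
    {p \<in> polys V. \<forall>m\<in>keys p. \<exists>n\<in>M. \<exists>t. m = n + t}" (is "?I = ?J")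
proof
  have M: "monomial ` M \<subseteq> polys V" using assms by auto
  show "?I \<subseteq> ?J"
  proof (rule genideal_mpoly_minimal[OF pidealI])
    show "mp.subspace ?J"
    proof (unfold mp.subspace_def, intro conjI ballI allI)
      fix p q assume "p \<in> ?J" "q \<in> ?J"
      then show "p + q \<in> ?J" using keys_add[of p q] by blast
    next
      fix c p assume "p \<in> ?J"
      then show "scal c p \<in> ?J" using keys_scal[of c p] by blast
    qed simp
    fix v p assume v: "v \<in> V" and p: "p \<in> ?J"
    have "\<exists>n\<in>M. \<exists>t. m = n + t" if "m \<in> keys (var v * p)" for m
    proof -
      have "m \<in> (\<lambda>m. m + single v 1) ` keys p"
        using that keys_mult_monomial[of p "single v 1"]
        by (simp add: mpoly_var_eq_monomial mult.commute)
      then obtain m' where m': "m = m' + single v 1" "m' \<in> keys p" by blast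
      then obtain n t where "n \<in> M" "m' = n + t" using p by blast
      then show ?thesis using m'(1) by (auto simp: add.assoc intro!: bexI[of _ n])
    qed
    then show "var v * p \<in> ?J" using v p by auto
  next
    have "\<exists>n'\<in>M. \<exists>t. n = n' + t" if "n \<in> M" for n
      by (rule bexI[OF _ that], rule exI[of _ 0]) simp
    then show "monomial ` M \<subseteq> ?J" using assms by auto
  qed auto
  show "?J \<subseteq> ?I"
  proof
    fix p assume p: "p \<in> ?J"
    have "(\<Sum>m\<in>keys p. scal (lookup p m) (monomial m)) \<in> ?I"
    proof (intro pideal_sum[OF pideal_genideal[OF M]] pideal_scal[OF pideal_genideal[OF M]])
      fix m assume m: "m \<in> keys p"
      then obtain n t where nt: "n \<in> M" "m = n + t" using p by blast
      have "keys m \<subseteq> V" using p m by (auto simp: polys_def)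
      then have "keys t \<subseteq> V" unfolding nt(2) keys_add_nat by blast
      then have t: "monomial t \<in> polys V" by simp
      have n: "monomial n \<in> ?I" using genideal_mpoly_subset[OF M, of K] nt(1) by blast
      show "monomial m \<in> ?I"
        unfolding nt(2) monomial_add by (rule pideal_mult_right[OF pideal_genideal[OF M] n t])
    qed
    then show "p \<in> ?I" using poly_eq_sum_monomials[of p] by simp
  qed
qed

lemma set_take_strictly_sorted:
  assumes "sorted_wrt (<) (xs :: 'a::linorder list)" "i < length xs"
  shows "set (take i xs) = {p \<in> set xs. p < xs ! i}"
proof (rule Set.set_eqI, rule iffI)
  fix p assume "p \<in> set (take i xs)"
  then obtain j where "j < i" "p = xs ! j" by (auto simp: in_set_conv_nth)
  then show "p \<in> {p \<in> set xs. p < xs ! i}"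
    using sorted_wrt_nth_less[OF assms(1), of j i] assms(2) by auto
next
  fix p assume p: "p \<in> {p \<in> set xs. p < xs ! i}"
  then obtain j where j: "j < length xs" "p = xs ! j" by (auto simp: in_set_conv_nth)
  have "j < i"
  proof (rule ccontr)
    assume "\<not> j < i"
    then have "xs ! i \<le> xs ! j"
      using sorted_wrt_nth_less[OF assms(1), of i j] j(1) by (cases "i = j") auto
    then show False using p j(2) by auto
  qed
  then show "p \<in> set (take i xs)" using j assms(2) by (auto simp: in_set_conv_nth)
qed

context staircase
begin

section \<open>Minimal vertex covers as cells of a Ferrers diagram\<close>

definition edge :: "nat \<Rightarrow> 'v set" where
  "edge s = x ` {..<s} \<union> z ` {..<d - s}"

text \<open>Below \<open>d\<close>, the vertex \<open>x a\<close> is in \<open>edge s\<close> iff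
  \<open>a < s\<close>, and \<open>z b\<close> is in it iff \<open>b < d - s\<close>, so the cells
  are the pairs whose two vertices meet every edge. Both conditions favour small indices, which
  makes the diagram closed downwards.\<close>

definition diagram :: "(nat \<times> nat) set" where
  "diagram = {(a, b). a < d \<and> b < d \<and> (\<forall>s\<in>S. a < s \<or> b < d - s)}"

definition cover_exp :: "nat \<times> nat \<Rightarrow> ('v \<Rightarrow>\<^sub>0 nat)" where
  "cover_exp p = single (x (fst p)) 1 + single (z (snd p)) 1"

lemma diagram_down: "(a, b) \<in> diagram \<Longrightarrow> a' \<le> a \<Longrightarrow> b' \<le> b \<Longrightarrow> (a', b') \<in> diagram"
  by (fastforce simp: diagram_def)

lemma finite_diagram: "finite diagram"
  by (rule finite_subset[of _ "{..<d} \<times> {..<d}"]) (auto simp: diagram_def)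

lemma x_neq_z: "a < d \<Longrightarrow> b < d \<Longrightarrow> x a \<noteq> z b"
  using disj by blast

lemma x_eq_iff: "a < d \<Longrightarrow> b < d \<Longrightarrow> x a = x b \<longleftrightarrow> a = b"
  using inj_x by (auto simp: inj_on_def)

lemma z_eq_iff: "a < d \<Longrightarrow> b < d \<Longrightarrow> z a = z b \<longleftrightarrow> a = b"
  using inj_z by (auto simp: inj_on_def)

lemma vertex_cover_pair:
  assumes "(a, b) \<in> diagram"
  shows "vertex_cover V (edge ` S) {x a, z b}"
  using assms unfolding vertex_cover_def edge_def diagram_def by (fastforce simp: V_eq)

text \<open>A cover meets \<open>edge d\<close>, which consists of all \<open>x\<close>, and
  \<open>edge 0\<close>, which consists of all \<open>z\<close>. Its vertices of least index on the
  two sides already cover, because edges are initial segments on both sides. A proper subset of such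
  a pair misses \<open>edge d\<close> or \<open>edge 0\<close>.\<close>

lemma minimal_vertex_cover_iff:
  assumes "0 \<in> S" "d \<in> S"
  shows "minimal_vertex_cover V (edge ` S) C \<longleftrightarrow> (\<exists>(a, b)\<in>diagram. C = {x a, z b})"
proof
  assume C: "minimal_vertex_cover V (edge ` S) C"
  then have cover: "\<And>s. s \<in> S \<Longrightarrow> C \<inter> edge s \<noteq> {}"
    by (auto simp: minimal_vertex_cover_def vertex_cover_def)
  have "\<exists>a. a < d \<and> x a \<in> C" "\<exists>b. b < d \<and> z b \<in> C"
    using cover[OF assms(2)] cover[OF assms(1)] by (auto simp: edge_def)
  then obtain a b where a: "a < d" "x a \<in> C" "\<And>i. i < d \<Longrightarrow> x i \<in> C \<Longrightarrow> a \<le> i"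
    and b: "b < d" "z b \<in> C" "\<And>i. i < d \<Longrightarrow> z i \<in> C \<Longrightarrow> b \<le> i"
    using exists_least_iff[of "\<lambda>a. a < d \<and> x a \<in> C"] exists_least_iff[of "\<lambda>b. b < d \<and> z b \<in> C"]
    by (metis not_le)
  have "a < s \<or> b < d - s" if s: "s \<in> S" for s
  proof -
    obtain v where "v \<in> C" "v \<in> edge s" using cover[OF s] by blast
    then consider i where "i < s" "x i \<in> C" | i where "i < d - s" "z i \<in> C"
      by (auto simp: edge_def)
    then show ?thesis
    proof cases
      case 1
      then show ?thesis using a(3)[of i] S_le[OF s] by auto
    next
      case 2
      then have "i < d" by simp
      then show ?thesis using b(3)[of i] 2 by auto
    qed
  qed
  then have ab: "(a, b) \<in> diagram" using a b by (auto simp: diagram_def)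
  have "\<not> {x a, z b} \<subset> C"
    using C vertex_cover_pair[OF ab] by (auto simp: minimal_vertex_cover_def)
  then have "C = {x a, z b}" using a b by auto
  then show "\<exists>(a, b)\<in>diagram. C = {x a, z b}" using ab by blast
next
  assume "\<exists>(a, b)\<in>diagram. C = {x a, z b}"
  then obtain a b where ab: "(a, b) \<in> diagram" and C: "C = {x a, z b}" by blast
  have ab_d: "a < d" "b < d" using ab by (auto simp: diagram_def)
  have "\<not> vertex_cover V (edge ` S) D" if D: "D \<subset> C" for D
  proof
    assume cover: "vertex_cover V (edge ` S) D"
    have "D \<inter> edge d \<noteq> {}" "D \<inter> edge 0 \<noteq> {}"
      using cover assms by (auto simp: vertex_cover_def)
    then obtain i j where "i < d" "x i \<in> D" "j < d" "z j \<in> D" by (auto simp: edge_def)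
    then have "x a \<in> D" "z b \<in> D"
      using D C ab_d x_neq_z[of i b] x_neq_z[of a j] by auto
    then show False using D C by auto
  qed
  then show "minimal_vertex_cover V (edge ` S) C"
    using vertex_cover_pair[OF ab] C by (simp add: minimal_vertex_cover_def)
qed

lemma cover_exp_lookup:
  assumes "p \<in> diagram"
  shows "lookup (cover_exp p) v = (if v = x (fst p) \<or> v = z (snd p) then 1 else 0)"
  using assms x_neq_z[of "fst p" "snd p"]
  by (auto simp: cover_exp_def lookup_add lookup_single when_def diagram_def)

lemma cover_exp_keys: "p \<in> diagram \<Longrightarrow> keys (cover_exp p) \<subseteq> V"
  by (auto simp: cover_exp_def keys_add_nat V_eq diagram_def)

lemma cover_exp_degree: "exponent_degree (cover_exp p) = 2"
  by (simp add: cover_exp_def exponent_degree_add)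

lemma cover_exp_inj: "inj_on cover_exp diagram"
proof (rule inj_onI)
  fix p q assume pq: "p \<in> diagram" "q \<in> diagram" "cover_exp p = cover_exp q"
  have eq: "(v = x (fst p) \<or> v = z (snd p)) = (v = x (fst q) \<or> v = z (snd q))" for v
    using cover_exp_lookup[OF pq(1), of v] cover_exp_lookup[OF pq(2), of v] pq(3)
    by (metis zero_neq_one)
  have d: "fst p < d" "snd p < d" "fst q < d" "snd q < d" using pq by (auto simp: diagram_def)
  have "fst p = fst q" using eq[of "x (fst p)"] d by (simp add: x_neq_z x_eq_iff)
  moreover have "snd p = snd q" using eq[of "z (snd p)"] x_neq_z[of "fst q" "snd p"] d by (auto simp: z_eq_iff)
  ultimately show "p = q" by (rule prod_eqI)
qed

lemma alexander_dual_eq: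
  fixes K :: "'k::field itself"
  assumes "0 \<in> S" "d \<in> S"
  shows "alexander_dual K V (edge ` S) = Idl\<^bsub>mpoly_ring K V\<^esub> (monomial ` cover_exp ` diagram)"
proof -
  let ?pr = "\<lambda>p. \<Prod>v\<in>{x (fst p), z (snd p)}. var v :: ('v, 'k) mpoly"
  have "?pr p = monomial (cover_exp p)" if "p \<in> diagram" for p
    using that x_neq_z[of "fst p" "snd p"]
    by (auto simp: cover_exp_def monomial_add mpoly_var_eq_monomial diagram_def)
  then have "?pr ` diagram = monomial ` cover_exp ` diagram"
    unfolding image_image by (rule image_cong[OF refl])
  moreover have "{\<Prod>v\<in>C. var v | C. minimal_vertex_cover V (edge ` S) C} = ?pr ` diagram"
  proof (rule Set.set_eqI)
    fix u :: "('v, 'k) mpoly"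
    have "u \<in> {\<Prod>v\<in>C. var v | C. minimal_vertex_cover V (edge ` S) C} \<longleftrightarrow>
        (\<exists>C. u = (\<Prod>v\<in>C. var v) \<and> (\<exists>p\<in>diagram. C = {x (fst p), z (snd p)}))"
      unfolding minimal_vertex_cover_iff[OF assms] case_prod_unfold by simp
    also have "\<dots> \<longleftrightarrow> u \<in> ?pr ` diagram" by blast
    finally show "u \<in> {\<Prod>v\<in>C. var v | C. minimal_vertex_cover V (edge ` S) C} \<longleftrightarrow> u \<in> ?pr ` diagram" .
  qed
  ultimately have "{\<Prod>v\<in>C. var v | C. minimal_vertex_cover V (edge ` S) C} =
      (monomial ` cover_exp ` diagram :: ('v, 'k) mpoly set)"
    by simp
  then show ?thesis by (simp only: alexander_dual_def)
qed

text \<open>The colon ideal on the level of exponents. A lexicographically earlier cell has a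
  smaller first entry \<open>a'\<close>, so that \<open>x a'\<close> must come from
  \<open>m\<close>, or the same first entry and a smaller second one, so that \<open>z b'\<close>
  must. Conversely, replacing one coordinate by a smaller one stays in the diagram and gives an
  earlier cell.\<close>

lemma colon_condition:
  assumes p: "(a, b) \<in> diagram"
  shows "(\<exists>q\<in>{q \<in> diagram. q < (a, b)}. \<exists>t. m + cover_exp (a, b) = cover_exp q + t) \<longleftrightarrow>
    (\<exists>v\<in>x ` {..<a} \<union> z ` {..<b}. \<exists>t. m = single v 1 + t)"
proof
  have ab: "a < d" "b < d" using p by (auto simp: diagram_def)
  assume "\<exists>q\<in>{q \<in> diagram. q < (a, b)}. \<exists>t. m + cover_exp (a, b) = cover_exp q + t"
  then obtain a' b' where q: "(a', b') \<in> diagram" "(a', b') < (a, b)"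
    and le: "\<And>v. lookup (cover_exp (a', b')) v \<le> lookup (m + cover_exp (a, b)) v"
    unfolding exists_add_iff by fastforce
  have ab': "a' < d" "b' < d" using q by (auto simp: diagram_def)
  consider "a' < a" | "a' = a" "b' < b" using q(2) by (auto simp: less_prod_def le_less)
  then show "\<exists>v\<in>x ` {..<a} \<union> z ` {..<b}. \<exists>t. m = single v 1 + t"
  proof cases
    case 1
    then have "1 \<le> lookup m (x a')"
      using le[of "x a'"] ab ab' by (simp add: lookup_add cover_exp_lookup p q x_eq_iff x_neq_z)
    then show ?thesis unfolding exists_add_single_iff using 1 by blast
  next
    case 2
    then have "1 \<le> lookup m (z b')"
      using le[of "z b'"] ab ab' x_neq_z[of a b'] cover_exp_lookup[OF p, of "z b'"]
        cover_exp_lookup[OF q(1), of "z b'"]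
      by (simp add: lookup_add z_eq_iff)
    then show ?thesis unfolding exists_add_single_iff using 2 by blast
  qed
next
  assume "\<exists>v\<in>x ` {..<a} \<union> z ` {..<b}. \<exists>t. m = single v 1 + t"
  then consider i t where "i < a" "m = single (x i) 1 + t"
    | j t where "j < b" "m = single (z j) 1 + t" by blast
  then show "\<exists>q\<in>{q \<in> diagram. q < (a, b)}. \<exists>t. m + cover_exp (a, b) = cover_exp q + t"
  proof cases
    case 1
    have "m + cover_exp (a, b) = cover_exp (i, b) + (t + single (x a) 1)"
      unfolding 1(2) by (simp add: cover_exp_def add_ac)
    then show ?thesis
      using diagram_down[OF p, of i b] 1(1) by (intro bexI[of _ "(i, b)"]) auto
  next
    case 2
    have "m + cover_exp (a, b) = cover_exp (a, j) + (t + single (z b) 1)"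
      unfolding 2(2) by (simp add: cover_exp_def add_ac)
    then show ?thesis
      using diagram_down[OF p, of a j] 2(1) by (intro bexI[of _ "(a, j)"]) auto
  qed
qed

lemma linear_quotients_alexander_dual:
  fixes K :: "'k::field itself"
  assumes "0 \<in> S" "d \<in> S"
  shows "linear_quotients K V (alexander_dual K V (edge ` S))"
proof -
  let ?R = "mpoly_ring K V"
  define ps where "ps = sorted_list_of_set diagram"
  have ps: "set ps = diagram" "distinct ps" "sorted_wrt (<) ps"
    using finite_diagram by (simp_all add: ps_def)
  define ms where "ms = map cover_exp ps"
  define us :: "('v, 'k) mpoly list" where "us = map monomial ms"
  have set_us: "set us = monomial ` cover_exp ` diagram"
    by (simp add: us_def ms_def ps image_image)
  have Idl_eq: "Idl\<^bsub>?R\<^esub> (monomial ` cover_exp ` Q) =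
      {p \<in> polys V. \<forall>m\<in>keys p. \<exists>q\<in>Q. \<exists>t. m = cover_exp q + t}" if "Q \<subseteq> diagram" for Q
    by (subst monomial_ideal_eq) (use cover_exp_keys that in auto)
  have "distinct ms" using ps cover_exp_inj by (simp add: ms_def distinct_map)
  moreover have "sorted (map exponent_degree ms)"
    by (auto simp: ms_def cover_exp_degree sorted_wrt_iff_nth_less)
  moreover have "minimal_generating_set ?R (alexander_dual K V (edge ` S)) (set us)"
    unfolding minimal_generating_set_def alexander_dual_eq[OF assms] set_us
  proof (intro conjI allI impI)
    show "monomial ` cover_exp ` diagram \<subseteq> carrier ?R"
      using cover_exp_keys by auto
    fix T :: "('v, 'k) mpoly set" assume T: "T \<subset> monomial ` cover_exp ` diagram"
    define Q where "Q = {q \<in> diagram. monomial (cover_exp q) \<in> T}"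
    have T_eq: "T = monomial ` cover_exp ` Q" using T by (auto simp: Q_def)
    obtain p where p: "p \<in> diagram" "monomial (cover_exp p) \<notin> T" using T by blast
    show "Idl\<^bsub>?R\<^esub> T \<noteq> Idl\<^bsub>?R\<^esub> (monomial ` cover_exp ` diagram)"
    proof
      assume eq: "Idl\<^bsub>?R\<^esub> T = Idl\<^bsub>?R\<^esub> (monomial ` cover_exp ` diagram)"
      have "monomial (cover_exp p) \<in> Idl\<^bsub>?R\<^esub> (monomial ` cover_exp ` diagram)"
        using p(1) cover_exp_keys by (intro subsetD[OF genideal_mpoly_subset]) auto
      then have "monomial (cover_exp p) \<in> Idl\<^bsub>?R\<^esub> (monomial ` cover_exp ` Q)"
        using eq T_eq by simp
      then obtain q t where q: "q \<in> Q" "cover_exp p = cover_exp q + t"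
        using Idl_eq[of Q] by (auto simp: Q_def)
      \<comment> \<open>All generators have degree 2, so one can divide another only if they are
        equal; this is what makes the system minimal.\<close>
      then have "exponent_degree t = 0"
        using cover_exp_degree[of p] cover_exp_degree[of q] by (simp add: exponent_degree_add)
      then have "cover_exp p = cover_exp q" using q(2) exponent_degree_eq_0[of t] by simp
      then show False using p(2) q(1) by (simp add: Q_def)
    qed
  qed simp
  moreover have "\<exists>L\<subseteq>carrier ?R. (\<forall>f\<in>L. linear_form f) \<and>
      colon_ideal ?R (Idl\<^bsub>?R\<^esub> (set (take i us))) (us ! i) = Idl\<^bsub>?R\<^esub> L" if i: "i < length us" for i
  proof -
    have i': "i < length ps" using i by (simp add: us_def ms_def)
    obtain a b where ab: "ps ! i = (a, b)" by force
    have p: "(a, b) \<in> diagram" using nth_mem[OF i'] by (simp add: ab ps)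
    have "set (take i us) = monomial ` cover_exp ` set (take i ps)"
      by (simp add: us_def ms_def take_map image_image)
    then have take: "set (take i us) = monomial ` cover_exp ` {q \<in> diagram. q < (a, b)}"
      using set_take_strictly_sorted[OF ps(3) i'] by (simp add: ab ps)
    have ui: "us ! i = monomial (cover_exp (a, b))"
      using i' by (simp add: us_def ms_def ab)
    define X where "X = x ` {..<a} \<union> z ` {..<b}"
    define L :: "('v, 'k) mpoly set" where "L = var ` X"
    have X: "X \<subseteq> V" using p by (auto simp: X_def V_eq diagram_def)
    have L_eq: "L = monomial ` (\<lambda>v. single v 1) ` X"
      by (simp add: L_def mpoly_var_eq_monomial image_image)
    have "colon_ideal ?R (Idl\<^bsub>?R\<^esub> (set (take i us))) (us ! i) = Idl\<^bsub>?R\<^esub> L"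
    proof -
      have "Idl\<^bsub>?R\<^esub> L = {f \<in> polys V. \<forall>m\<in>keys f. \<exists>v\<in>X. \<exists>t. m = single v 1 + t}"
        unfolding L_eq using X by (subst monomial_ideal_eq) auto
      also have "\<dots> = {f \<in> polys V. \<forall>m\<in>keys f.
          \<exists>q\<in>{q \<in> diagram. q < (a, b)}. \<exists>t. m + cover_exp (a, b) = cover_exp q + t}"
        unfolding colon_condition[OF p] X_def ..
      also have "\<dots> = {f \<in> polys V. f * monomial (cover_exp (a, b)) \<in>
          Idl\<^bsub>?R\<^esub> (monomial ` cover_exp ` {q \<in> diagram. q < (a, b)})}"
        using cover_exp_keys[OF p] by (subst Idl_eq) (auto simp: keys_mult_monomial intro!: polys_mult)
      also have "\<dots> = colon_ideal ?R (Idl\<^bsub>?R\<^esub> (set (take i us))) (us ! i)"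
        by (simp add: colon_ideal_def take ui)
      finally show ?thesis ..
    qed
    moreover have "L \<subseteq> carrier ?R" using X by (auto simp: L_def)
    moreover have "\<forall>f\<in>L. linear_form f" by (simp add: L_eq linear_form_def)
    ultimately show ?thesis by blast
  qed
  ultimately show ?thesis
    unfolding linear_quotients_def Let_def us_def by blast
qed

end

section \<open>Admissible clutters of height two\<close>

text \<open>Height 2 leaves two classes \<open>F 1\<close> and \<open>F 2\<close>, both of them
  edges. Every edge turns out to meet each class \<open>X l\<close> in exactly one vertex, and a
  monotone map into \<open>{1..2}\<close> is a single jump: the vertices come from
  \<open>F 1\<close> up to some class \<open>s\<close> and from \<open>F 2\<close>
  afterwards.\<close>

lemma staircase_of_admissible:
  fixes K :: "'k::field itself" and V :: "'v set"
  assumes clutter: "clutter V E" and unif: "uniform_clutter E" and adm: "admissible_clutter K V E"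
    and height: "ideal_height (mpoly_ring K V) (edge_ideal K V E) = 2"
  obtains x z d S where "staircase V x z d S" "0 \<in> S" "d \<in> S" "E = staircase.edge x z d ` S"
proof -
  obtain g d X F where g: "ideal_height (mpoly_ring K V) (edge_ideal K V E) = enat g" and d: "d > 0"
    and X: "indexed_partition V d X" and F: "indexed_partition V g F"
    and FE: "\<forall>i\<in>{1..g}. F i \<in> E" and adm_E: "\<forall>e\<in>E. admissible_set V d X g F e"
    using adm unfolding admissible_clutter_def by blast
  have "enat g = enat 2" using g height by (simp add: numeral_eq_enat)
  then have g2: "g = 2" by simp
  have fin_V: "finite V" using clutter by (simp add: clutter_def)
  have part: "W = (\<Union>i\<in>{1..n}. Y i)"
      "\<And>i j. i \<in> {1..n} \<Longrightarrow> j \<in> {1..n} \<Longrightarrow> i \<noteq> j \<Longrightarrow> Y i \<inter> Y j = {}"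
      "\<And>i. i \<in> {1..n} \<Longrightarrow> Y i \<noteq> {}"
    if "indexed_partition W n Y" for W :: "'v set" and n Y
  proof -
    have p: "partition_on W (Y ` {1..n})" and inj: "inj_on Y {1..n}"
      using that by (auto simp: indexed_partition_def)
    show "W = (\<Union>i\<in>{1..n}. Y i)" by (rule partition_onD1[OF p])
    show "Y i \<noteq> {}" if "i \<in> {1..n}" for i
      using partition_onD3[OF p] that by (metis imageI)
    show "Y i \<inter> Y j = {}" if ij: "i \<in> {1..n}" "j \<in> {1..n}" "i \<noteq> j" for i j
      using disjointD[OF partition_onD2[OF p], of "Y i" "Y j"] ij inj_onD[OF inj, of i j] by blast
  qed
  note XV = part(1)[OF X] and X_disj = part(2)[OF X] and X_ne = part(3)[OF X]
  have "V = (\<Union>i\<in>{1..2}. F i)" and "\<And>i j. i \<in> {1..2} \<Longrightarrow> j \<in> {1..2} \<Longrightarrow> i \<noteq> j \<Longrightarrow> F i \<inter> F j = {}"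
    using part(1,2)[OF F] unfolding g2 by blast+
  moreover have "{1..2} = {1, 2::nat}" by auto
  ultimately have FV: "V = F 1 \<union> F 2" and F_disj: "F 1 \<inter> F 2 = {}" by auto
  have F1: "F 1 \<in> E" and F2: "F 2 \<in> E" using FE by (auto simp: g2)
  define k where "k = card (F 1)"
  have k: "card e = k" if "e \<in> E" for e
    using unif that F1 unfolding uniform_clutter_def k_def by blast
  have meets: "{i \<in> {1..d}. e \<inter> X i \<noteq> {}} = {1..k}" and le1: "\<And>i. i \<in> {1..d} \<Longrightarrow> card (e \<inter> X i) \<le> 1"
    and eV: "e \<subseteq> V" if "e \<in> E" for e
    using adm_E that k[OF that] unfolding admissible_set_def by auto
  \<comment> \<open>A vertex of the last class lies in \<open>F 1\<close> or \<open>F 2\<close>, so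
    that edge reaches \<open>X d\<close>; by uniformity all edges then meet all \<open>d\<close>
    classes.\<close>
  have kd: "k = d"
  proof -
    have dd: "d \<in> {1..d}" using d by simp
    then obtain v where v: "v \<in> X d" using X_ne by blast
    then have "v \<in> V" using XV dd by blast
    then have "F 1 \<inter> X d \<noteq> {} \<or> F 2 \<inter> X d \<noteq> {}" using FV v by blast
    then have "d \<in> {1..k}" using meets[OF F1] meets[OF F2] dd by blast
    moreover from this have "k \<in> {1..k}" using d by simp
    then have "k \<in> {1..d}" using meets[OF F1] by blast
    ultimately show ?thesis by simp
  qed
  have sing: "\<exists>v. e \<inter> X i = {v}" if "e \<in> E" "i \<in> {1..d}" for e i
  proof -
    have "e \<inter> X i \<noteq> {}" using meets[OF that(1)] that(2) unfolding kd by blast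
    moreover have "finite (e \<inter> X i)" using eV[OF that(1)] fin_V finite_subset by blast
    ultimately have "card (e \<inter> X i) = 1" using le1[OF that] card_gt_0_iff[of "e \<inter> X i"] by linarith
    then show ?thesis by (rule card_1_singletonE) blast
  qed
  \<comment> \<open>Classes are numbered from 1, vertices from 0. Reading \<open>F 2\<close>
    backwards turns the final classes of an edge into an initial segment of
    \<open>z\<close>.\<close>
  define x where "x a = the_elem (F 1 \<inter> X (Suc a))" for a
  define z where "z b = the_elem (F 2 \<inter> X (d - b))" for b
  have x: "F 1 \<inter> X (Suc a) = {x a}" if "a < d" for a
  proof -
    have "Suc a \<in> {1..d}" using that by simp
    then obtain v where "F 1 \<inter> X (Suc a) = {v}" using sing[OF F1] by blast
    then show ?thesis by (simp add: x_def)
  qed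
  have z: "F 2 \<inter> X (d - b) = {z b}" if "b < d" for b
  proof -
    have "d - b \<in> {1..d}" using that by auto
    then obtain v where "F 2 \<inter> X (d - b) = {v}" using sing[OF F2] by blast
    then show ?thesis by (simp add: z_def)
  qed
  have F1_eq: "F 1 = x ` {..<d}"
  proof
    show "x ` {..<d} \<subseteq> F 1" using x by auto
    show "F 1 \<subseteq> x ` {..<d}"
    proof
      fix v assume v: "v \<in> F 1"
      then obtain i where i: "i \<in> {1..d}" "v \<in> X i" using FV XV by blast
      then have "i - 1 < d" "Suc (i - 1) = i" by auto
      then have "v = x (i - 1)" using x[of "i - 1"] i v by auto
      then show "v \<in> x ` {..<d}" using \<open>i - 1 < d\<close> by blast
    qed
  qed
  have F2_eq: "F 2 = z ` {..<d}"
  proof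
    show "z ` {..<d} \<subseteq> F 2" using z by auto
    show "F 2 \<subseteq> z ` {..<d}"
    proof
      fix v assume v: "v \<in> F 2"
      then obtain i where i: "i \<in> {1..d}" "v \<in> X i" using FV XV by blast
      then have "d - i < d" "d - (d - i) = i" by auto
      then have "v = z (d - i)" using z[of "d - i"] i v by auto
      then show "v \<in> z ` {..<d}" using \<open>d - i < d\<close> by blast
    qed
  qed
  define S where "S = {s. s \<le> d \<and> x ` {..<s} \<union> z ` {..<d - s} \<in> E}"
  have stair: "staircase V x z d S"
  proof
    show "0 < d" by (rule d)
    show "inj_on x {..<d}"
    proof (rule inj_onI)
      fix a b assume ab: "a \<in> {..<d}" "b \<in> {..<d}" "x a = x b"
      then have "X (Suc a) \<inter> X (Suc b) \<noteq> {}" using x[of a] x[of b] by auto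
      then show "a = b" using X_disj[of "Suc a" "Suc b"] ab by auto
    qed
    show "inj_on z {..<d}"
    proof (rule inj_onI)
      fix a b assume ab: "a \<in> {..<d}" "b \<in> {..<d}" "z a = z b"
      then have "X (d - a) \<inter> X (d - b) \<noteq> {}" using z[of a] z[of b] by auto
      moreover have "d - a \<in> {1..d}" "d - b \<in> {1..d}" using ab by auto
      ultimately have "d - a = d - b" using X_disj[of "d - a" "d - b"] by blast
      then show "a = b" using ab by auto
    qed
    show "x ` {..<d} \<inter> z ` {..<d} = {}" using F_disj unfolding F1_eq F2_eq .
    show "V = x ` {..<d} \<union> z ` {..<d}" using FV unfolding F1_eq F2_eq .
    show "s \<le> d" if "s \<in> S" for s using that by (simp add: S_def)
  qed
  \<comment> \<open>The value 0 belongs to the edge \<open>F 2\<close> and \<open>d\<close> to the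
    edge \<open>F 1\<close>.\<close>
  have S0: "0 \<in> S" "d \<in> S" using F1 F2 unfolding S_def F1_eq F2_eq by auto
  have "e \<in> staircase.edge x z d ` S" if e: "e \<in> E" for e
  proof -
    have "card e = d" using k[OF e] kd by simp
    then obtain j where j: "\<forall>l\<in>{1..d}. j l \<in> {1..2} \<and> e \<inter> X l \<subseteq> F (j l)" and mono: "mono_on {1..d} j"
      using adm_E e unfolding admissible_set_def g2 by auto
    \<comment> \<open>The last class in which \<open>e\<close> takes its vertex from
      \<open>F 1\<close>; the inserted 0 covers an edge without such a class.\<close>
    define s where "s = Max (insert 0 {l \<in> {1..d}. j l = 1})"
    have "s \<in> insert 0 {l \<in> {1..d}. j l = 1}" unfolding s_def by (rule Max_in) auto
    then have s: "s = 0 \<or> (s \<in> {1..d} \<and> j s = 1)" by auto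
    have low: "j l = 1" if l: "l \<in> {1..d}" "l \<le> s" for l
    proof -
      have sd: "s \<in> {1..d}" "j s = 1" using s l by auto
      then have "j l \<le> 1" using mono_onD[OF mono l(1) sd(1) l(2)] by simp
      then show ?thesis using j l(1) by force
    qed
    have high: "j l = 2" if l: "l \<in> {1..d}" "s < l" for l
    proof -
      have "j l \<noteq> 1"
      proof
        assume "j l = 1"
        then have "l \<le> s" unfolding s_def using l(1) by (intro Max_ge) auto
        then show False using l(2) by simp
      qed
      moreover have "j l \<in> {1..2}" using j l(1) by blast
      ultimately show ?thesis by auto
    qed
    have ex: "e \<inter> X (Suc a) = {x a}" if a: "a < s" for a
    proof -
      have ad: "a < d" using a s by auto
      then have l: "Suc a \<in> {1..d}" by simp
      then have "e \<inter> X (Suc a) \<subseteq> F 1 \<inter> X (Suc a)" using bspec[OF j l] low[OF l] a by (metis Int_greatest Int_lower2 Suc_leI)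
      moreover obtain v where "e \<inter> X (Suc a) = {v}" using sing[OF e l] by blast
      ultimately show ?thesis unfolding x[OF ad] by simp
    qed
    have ez: "e \<inter> X (d - b) = {z b}" if b: "b < d - s" for b
    proof -
      have l: "d - b \<in> {1..d}" and bd: "b < d" and "s < d - b" using b by auto
      then have "e \<inter> X (d - b) \<subseteq> F 2 \<inter> X (d - b)" using bspec[OF j l] high[OF l] by (metis Int_greatest Int_lower2)
      moreover obtain v where "e \<inter> X (d - b) = {v}" using sing[OF e l] by blast
      ultimately show ?thesis unfolding z[OF bd] by simp
    qed
    have "e = x ` {..<s} \<union> z ` {..<d - s}"
    proof
      show "x ` {..<s} \<union> z ` {..<d - s} \<subseteq> e" using ex ez by auto
      show "e \<subseteq> x ` {..<s} \<union> z ` {..<d - s}"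
      proof
        fix v assume v: "v \<in> e"
        then obtain l where l: "l \<in> {1..d}" "v \<in> X l" using eV[OF e] XV by blast
        show "v \<in> x ` {..<s} \<union> z ` {..<d - s}"
        proof (cases "l \<le> s")
          case True
          then have "l - 1 < s" "Suc (l - 1) = l" using l by auto
          then have "v = x (l - 1)" using ex[of "l - 1"] v l(2) by auto
          then show ?thesis using \<open>l - 1 < s\<close> by blast
        next
          case False
          then have "d - l < d - s" "d - (d - l) = l" using l by auto
          then have "v = z (d - l)" using ez[of "d - l"] v l(2) by auto
          then show ?thesis using \<open>d - l < d - s\<close> by blast
        qed
      qed
    qed
    moreover from this have "s \<in> S" using e s by (auto simp: S_def)
    ultimately show ?thesis by (auto simp: staircase.edge_def[OF stair])
  qed
  moreover have "staircase.edge x z d ` S \<subseteq> E"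
    by (auto simp: staircase.edge_def[OF stair] S_def)
  ultimately have "E = staircase.edge x z d ` S" by blast
  then show ?thesis using that[OF stair S0] by blast
qed

lemma (in staircase) edge_ideal_eq:
  fixes K :: "'k::field itself"
  shows "edge_ideal K V (edge ` S) = Idl\<^bsub>mpoly_ring K V\<^esub> (generator ` S)"
proof -
  have "(\<Prod>v\<in>edge s. var v) = (generator s :: ('v, 'k) mpoly)" if "s \<in> S" for s
  proof -
    have sub: "{..<s} \<subseteq> {..<d}" "{..<d - s} \<subseteq> {..<d}" using S_le[OF that] by auto
    then have "x ` {..<s} \<inter> z ` {..<d - s} = {}"
      using disj image_mono[OF sub(1), of x] image_mono[OF sub(2), of z] by (meson disjoint_iff subsetD)
    then show ?thesis
      unfolding edge_def generator_def
      by (simp add: prod.union_disjoint prod.reindex[OF inj_on_subset[OF inj_x sub(1)]]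
        prod.reindex[OF inj_on_subset[OF inj_z sub(2)]])
  qed
  then have "(\<lambda>s. \<Prod>v\<in>edge s. var v :: ('v, 'k) mpoly) ` S = generator ` S"
    by (rule image_cong[OF refl])
  moreover have "{\<Prod>v\<in>e. var v :: ('v, 'k) mpoly | e. e \<in> edge ` S} = (\<lambda>s. \<Prod>v\<in>edge s. var v) ` S"
    by blast
  ultimately have "{\<Prod>v\<in>e. var v :: ('v, 'k) mpoly | e. e \<in> edge ` S} = generator ` S"
    by simp
  then show ?thesis by (simp add: edge_ideal_def)
qed

theorem theorem3p1:
  fixes K :: "'k::field itself" and V :: "'v set" and E :: "'v set set"
  assumes "clutter V E"
    and "uniform_clutter E"
    and "admissible_clutter K V E"
    and "unmixed_clutter V E"
    and "ideal_height (mpoly_ring K V) (edge_ideal K V E) = 2"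
  shows "linear_quotients K V (alexander_dual K V E) \<and> cohen_macaulay_clutter K V E"
proof -
  obtain x z d S where stair: "staircase V x z d S" and S: "0 \<in> S" "d \<in> S"
    and E: "E = staircase.edge x z d ` S"
    by (rule staircase_of_admissible[OF assms(1-3,5)])
  interpret staircase V x z d S by (rule stair)
  show ?thesis
    unfolding E cohen_macaulay_clutter_def edge_ideal_eq
    using linear_quotients_alexander_dual[OF S] cohen_macaulay_Quot[OF S] by blast
qed

end
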